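(* Let $k\in\mathbb Z$, $N\in\mathbb N$, and let $f\in HC_k(N)$. For each integer $m\ge1$ we have $$L_f(\varphi_{1+m}^0)=-i^{-m-1}\int_i^{i+1}f(z)\frac{B_{m+1}(z)}{m+1}\,dz+\int_i^{i+1}(\xi_kf^c)(z)\left(c_{k,m}\frac{B_{2+m-k}(z)}{2+m-k}-\sum_{\ell=0}^m\sum_{j=0}^{m-\ell}d_{\ell,j}\,B_{1-\ell+m-j}(x)\right)dz,$$ where $x$ denotes the real part of $z$, $$c_{k,m}:=-\sum_{\ell=0}^m\frac{m!\,(\ell-k)!\,i^{k+m+2\ell}}{(1+m-k)!\,\ell!},\qquad d_{\ell,j}:=m!\,\frac{(-1)^{j-1}\,(\ell-k)!}{\ell!\,(j+\ell-k+1)!\,(1-\ell+m-j)!},$$ and the second integral is present only if $k\le0$ (for $k\ge 1$ one has $\xi_kf^c=0$ and that term is $0$).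
   Context: A harmonic Maass form of weight $k$ for $\Gamma_0(N)$ is a smooth $f:\mathbb H\to\mathbb C$ on the upper half-plane such that: (i) $(cz+d)^{-k}f(\gamma z)=f(z)$ for all $\gamma=\begin{pmatrix}a&b\\c&d\end{pmatrix}\in\Gamma_0(N)$; (ii) $\Delta_kf=0$, where $\Delta_k=-4y^2\frac{\partial}{\partial z}\frac{\partial}{\partial\bar z}+2iky\frac{\partial}{\partial\bar z}$, $z=x+iy$; (iii) for each $\gamma=\begin{pmatrix}*&*\\c&d\end{pmatrix}\in SL_2(\mathbb Z)$ there is a polynomial $P(z)\in\mathbb C[q^{-1}]$, $q=e^{2\pi i z}$, with $f(\gamma z)(cz+d)^{-k}-P(z)=O(e^{-\varepsilon y})$ as $y\to\infty$ for some $\varepsilon>0$. $HC_k(N)$ is the space of those forms with vanishing constant terms at all cusps (harmonic Maass cusp forms). Such $f$ has an expansion $$f(z)=\sum_{n\ge-n_0,\ n\ne0}a_f(n)e^{2\pi inz}+\sum_{n<0}b_f(n)\Gamma(1-k,-4\pi ny)e^{2\pi inz},$$ with $n_0\in\mathbb N$ and $\Gamma(r,z)=\int_z^\infty e^{-t}t^{r-1}dt$ the incomplete Gamma function. Set $\varphi_s^w(t)=\mathbf 1_{[1,\infty)}(t)e^{-wt}t^{s-1}$ for $t>0$. The value $L_f(\varphi_s^0)$ is the limit as $w=ix\to0$, $x\to0^+$, of $$L_f(\varphi_s^w)=\sum_{n\ge-n_0,\ n\ne0}a_f(n)E_{1-s}(2\pi n+w)+\sum_{n<0}b_f(n)\int_1^\infty\Gamma(1-k,-4\pi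 nt)e^{-(2\pi n+w)t}t^{s-1}dt,$$ where $E_s(z)=\int_1^\infty e^{-zt}t^{-s}dt$ for $\operatorname{Re}(z)>0$, continued analytically in $z$ to $\mathbb C\setminus(-\infty,0]$. $B_r(\cdot)$ is the $r$-th Bernoulli polynomial. Set $f^c(z):=\overline{f(-\bar z)}$ and $(\xi_kf)(z):=2iy^k\,\overline{\frac{\partial f}{\partial\bar z}}$, so that $(\xi_kf^c)(z)=-\sum_{n<0}(-4\pi n)^{1-k}b_f(n)e^{-2\pi inz}$. All integrals are along the horizontal segment from $i$ to $i+1$.
   Formalization: In the double sum, B_{1-ℓ+m-j}(x) is multiplied by i^{1-ℓ+m-j}; without this factor the printed formula is false, e.g. for k=0, m=1, where the n-th term of the second integral has the wrong sign. *)

theory Defs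
  imports
    "HOL-Complex_Analysis.Complex_Analysis"
    "HOL-Computational_Algebra.Computational_Algebra"
begin

section \<open>Harmonic Maass cusp forms\<close>

text \<open>A function on the upper half-plane is represented by a total function \<open>complex \<Rightarrow> complex\<close>;
  every condition below only looks at its values on \<open>upper_half_plane\<close>, which is open.\<close>

definition upper_half_plane :: "complex set"
  where "upper_half_plane = {z. Im z > 0}"

definition SL2Z :: "(int ^ 2 ^ 2) set"
  where "SL2Z = {A. det A = 1}"

definition Gamma0 :: "nat \<Rightarrow> (int ^ 2 ^ 2) set"
  where "Gamma0 N = {A \<in> SL2Z. int N dvd A $ 2 $ 1}"

definition slash :: "int \<Rightarrow> int ^ 2 ^ 2 \<Rightarrow> (complex \<Rightarrow> complex) \<Rightarrow> complex \<Rightarrow> complex"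
  where "slash k A f z =
    (of_int (A $ 2 $ 1) * z + of_int (A $ 2 $ 2)) powi (- k) *
    f ((of_int (A $ 1 $ 1) * z + of_int (A $ 1 $ 2)) / (of_int (A $ 2 $ 1) * z + of_int (A $ 2 $ 2)))"

text \<open>Smoothness is meant in the real sense: the Frechet derivatives over the reals of all
  orders exist and are continuous.\<close>

primrec Ck_on :: "nat \<Rightarrow> complex set \<Rightarrow> (complex \<Rightarrow> complex) \<Rightarrow> bool"
  where
    "Ck_on 0 S f = continuous_on S f"
  | "Ck_on (Suc n) S f =
       ((\<forall>z\<in>S. f differentiable (at z)) \<and> (\<forall>v. Ck_on n S (\<lambda>z. frechet_derivative f (at z) v)))"

definition smooth_on :: "complex set \<Rightarrow> (complex \<Rightarrow> complex) \<Rightarrow> bool"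
  where "smooth_on S f = (\<forall>n. Ck_on n S f)"

text \<open>The Wirtinger derivatives \<open>\<partial>/\<partial>z = (\<partial>/\<partial>x - i \<partial>/\<partial>y) / 2\<close> and
  \<open>\<partial>/\<partial>zbar = (\<partial>/\<partial>x + i \<partial>/\<partial>y) / 2\<close>.\<close>

definition d_dz :: "(complex \<Rightarrow> complex) \<Rightarrow> complex \<Rightarrow> complex"
  where "d_dz f z = (frechet_derivative f (at z) 1 - \<i> * frechet_derivative f (at z) \<i>) / 2"

definition d_dzbar :: "(complex \<Rightarrow> complex) \<Rightarrow> complex \<Rightarrow> complex"
  where "d_dzbar f z = (frechet_derivative f (at z) 1 + \<i> * frechet_derivative f (at z) \<i>) / 2"

definition hyp_Laplace :: "int \<Rightarrow> (complex \<Rightarrow> complex) \<Rightarrow> complex \<Rightarrow> complex"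
  where "hyp_Laplace k f z =
    - 4 * of_real (Im z) ^ 2 * d_dz (d_dzbar f) z
    + 2 * \<i> * of_int k * of_real (Im z) * d_dzbar f z"

text \<open>\<open>P\<close>, a polynomial in \<open>q\<^sup>-\<^sup>1 = exp (-2 \<pi> i z)\<close>, is the principal part of \<open>g\<close> at infinity.
  The bound \<open>O(exp (-\<epsilon> y))\<close> for \<open>y \<rightarrow> \<infinity>\<close> is uniform in \<open>x\<close>.\<close>

definition principal_part :: "(complex \<Rightarrow> complex) \<Rightarrow> complex poly \<Rightarrow> bool"
  where "principal_part g P \<longleftrightarrow>
    (\<exists>\<epsilon>>0. \<exists>C Y. \<forall>z. Im z > 0 \<and> Im z \<ge> Y \<longrightarrow>
       norm (g z - poly P (exp (- 2 * of_real pi * \<i> * z))) \<le> C * exp (- \<epsilon> * Im z))"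

definition harmonic_maass_forms :: "int \<Rightarrow> nat \<Rightarrow> (complex \<Rightarrow> complex) set"
  where "harmonic_maass_forms k N = {f.
     smooth_on upper_half_plane f \<and>
     (\<forall>A\<in>Gamma0 N. \<forall>z\<in>upper_half_plane. slash k A f z = f z) \<and>
     (\<forall>z\<in>upper_half_plane. hyp_Laplace k f z = 0) \<and>
     (\<forall>A\<in>SL2Z. \<exists>P. principal_part (slash k A f) P)}"

definition HC :: "int \<Rightarrow> nat \<Rightarrow> (complex \<Rightarrow> complex) set"
  where "HC k N = {f \<in> harmonic_maass_forms k N.
     \<forall>A\<in>SL2Z. \<forall>P. principal_part (slash k A f) P \<longrightarrow> coeff P 0 = 0}"


section \<open>The Fourier expansion\<close>

definition upper_Gamma :: "real \<Rightarrow> real \<Rightarrow> real"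
  where "upper_Gamma r x = integral {x..} (\<lambda>t. exp (- t) * t powr (r - 1))"

definition maass_expansion ::
  "int \<Rightarrow> (complex \<Rightarrow> complex) \<Rightarrow> nat \<Rightarrow> (int \<Rightarrow> complex) \<Rightarrow> (int \<Rightarrow> complex) \<Rightarrow> bool"
  where "maass_expansion k f n0 a b \<longleftrightarrow>
    (\<forall>z\<in>upper_half_plane. \<exists>u v.
       ((\<lambda>n. a n * exp (2 * of_real pi * \<i> * of_int n * z)) has_sum u) {n. n \<ge> - int n0 \<and> n \<noteq> 0} \<and>
       ((\<lambda>n. b n * of_real (upper_Gamma (1 - of_int k) (- 4 * pi * of_int n * Im z)) *
              exp (2 * of_real pi * \<i> * of_int n * z)) has_sum v) {n. n < 0} \<and>
       f z = u + v)"

text \<open>Every \<open>f\<close> in \<open>HC k N\<close> has such an expansion, and \<open>f\<close> determines the coefficients \<open>a n\<close>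
  (\<open>n \<ge> - n0\<close>, \<open>n \<noteq> 0\<close>) and \<open>b n\<close> (\<open>n < 0\<close>). Only \<open>n0\<close> and the values of \<open>a\<close>, \<open>b\<close> at the unused
  indices are chosen arbitrarily; enlarging \<open>n0\<close> merely adds zero coefficients.\<close>

definition maass_data ::
  "int \<Rightarrow> (complex \<Rightarrow> complex) \<Rightarrow> nat \<times> (int \<Rightarrow> complex) \<times> (int \<Rightarrow> complex)"
  where "maass_data k f = (SOME (n0, a, b). maass_expansion k f n0 a b)"

definition coeff_start :: "int \<Rightarrow> (complex \<Rightarrow> complex) \<Rightarrow> nat"
  where "coeff_start k f = fst (maass_data k f)"

definition coeff_a :: "int \<Rightarrow> (complex \<Rightarrow> complex) \<Rightarrow> int \<Rightarrow> complex"
  where "coeff_a k f = fst (snd (maass_data k f))"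

definition coeff_b :: "int \<Rightarrow> (complex \<Rightarrow> complex) \<Rightarrow> int \<Rightarrow> complex"
  where "coeff_b k f = snd (snd (maass_data k f))"


section \<open>The L-series at the test function $\varphi_s^w$\<close>

text \<open>\<open>gen_expint s\<close> is the analytic continuation of
  \<open>z \<mapsto> \<integral>\<^sub>1\<^sup>\<infinity> exp (- z t) t\<^sup>-\<^sup>s dt\<close> from the right half-plane to the plane slit along
  \<open>(-\<infinity>, 0]\<close>. It is unique there since the slit plane is connected; off the slit plane its
  values are unspecified and never used.\<close>

definition gen_expint :: "complex \<Rightarrow> complex \<Rightarrow> complex"
  where "gen_expint s = (SOME g. g holomorphic_on (- \<real>\<^sub>\<le>\<^sub>0) \<and>
    (\<forall>z. Re z > 0 \<longrightarrow> g z = integral {1..} (\<lambda>t. exp (- z * of_real t) * of_real t powr (- s))))"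

definition L_phi :: "int \<Rightarrow> (complex \<Rightarrow> complex) \<Rightarrow> complex \<Rightarrow> complex \<Rightarrow> complex"
  where "L_phi k f s w =
    (\<Sum>\<^sub>\<infinity>n\<in>{n. n \<ge> - int (coeff_start k f) \<and> n \<noteq> 0}.
        coeff_a k f n * gen_expint (1 - s) (2 * of_real pi * of_int n + w)) +
    (\<Sum>\<^sub>\<infinity>n\<in>{n. n < 0}.
        coeff_b k f n *
        integral {1..} (\<lambda>t. of_real (upper_Gamma (1 - of_int k) (- 4 * pi * of_int n * t)) *
          exp (- (2 * of_real pi * of_int n + w) * of_real t) * of_real t powr (s - 1)))"


section \<open>The ingredients of the right-hand side\<close>

text \<open>Generating function: \<open>X exp (z X) / (exp X - 1) = \<Sum>n. B\<^sub>n(z) X\<^sup>n / n!\<close>.\<close>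

definition bernpoly :: "nat \<Rightarrow> complex \<Rightarrow> complex"
  where "bernpoly n z = fact n * fps_nth (fps_X * fps_exp z / (fps_exp 1 - 1)) n"

definition f_conj :: "(complex \<Rightarrow> complex) \<Rightarrow> complex \<Rightarrow> complex"
  where "f_conj f z = cnj (f (- cnj z))"

definition xi_op :: "int \<Rightarrow> (complex \<Rightarrow> complex) \<Rightarrow> complex \<Rightarrow> complex"
  where "xi_op k f z = 2 * \<i> * of_real (Im z) powi k * cnj (d_dzbar f z)"

text \<open>The next two constants are only used for \<open>k \<le> 0\<close> and \<open>j + l \<le> m\<close>, so that the arguments of
  \<open>nat\<close> are nonnegative and the subtraction \<open>1 + m - l - j\<close> does not truncate.\<close>

definition c_const :: "int \<Rightarrow> nat \<Rightarrow> complex"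
  where "c_const k m =
    - (\<Sum>l\<le>m. fact m * fact (nat (int l - k)) * \<i> powi (k + int m + 2 * int l) /
              (fact (nat (1 + int m - k)) * fact l))"

definition d_const :: "int \<Rightarrow> nat \<Rightarrow> nat \<Rightarrow> nat \<Rightarrow> complex"
  where "d_const k m l j =
    fact m * ((- 1) powi (int j - 1) * fact (nat (int l - k)) /
      (fact l * fact (nat (int j + int l - k + 1)) * fact (1 + m - l - j)))"

text \<open>The published formula has \<open>B\<^sub>M(x)\<close>, \<open>M = 1 - l + m - j\<close>, without the factor \<open>i\<^sup>M\<close> below.
  That factor is necessary: for \<open>a = 2 \<pi> \<bar>n\<bar>\<close> repeated integration by parts gives
  \<open>\<integral>\<^sub>0\<^sup>1 exp (i a x) B\<^sub>M(x) dx = (-1)\<^sup>M\<^sup>-\<^sup>1 M! / (i a)\<^sup>M\<close>, whereas the sum has to contribute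
  \<open>(-1)\<^sup>M\<^sup>-\<^sup>1 M! / a\<^sup>M\<close>. E.g. for \<open>k = 0\<close>, \<open>m = 1\<close> the \<open>n\<close>-th term of the second integral has to be
  \<open>2 b(n) exp (-a) / a\<close>, while without the factor it is \<open>- 2 b(n) exp (-a) / a\<close>. The constants
  \<open>c_const\<close> and \<open>d_const\<close> are the published ones.\<close>

definition xi_kernel :: "int \<Rightarrow> nat \<Rightarrow> complex \<Rightarrow> complex"
  where "xi_kernel k m z =
    c_const k m * bernpoly (nat (2 + int m - k)) z / of_int (2 + int m - k) -
    (\<Sum>l\<le>m. \<Sum>j\<le>m - l.
       d_const k m l j * (\<i> ^ (1 + m - l - j) * bernpoly (1 + m - l - j) (of_real (Re z))))"

end

theory Submission
  imports Defs
begin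

text \<open>
  Both sides are series over the Fourier coefficients of \<open>f\<close>, and the identity holds term by term.

  Let \<open>e(nz) = exp(2 \<pi> i n z)\<close>. Because \<open>B\<^sub>r(z + 1) - B\<^sub>r(z) = r z\<^sup>r\<^sup>-\<^sup>1\<close>, integrating
  \<open>e(nx) B\<^sub>r(x + c)\<close> by parts over a period leaves only boundary terms that are powers of \<open>c\<close>
  (\<open>bernpoly_fourier_integral\<close>). For \<open>c = i\<close> and \<open>r = m + 1\<close> the resulting finite sum is, up to the factor
  \<open>- i\<^sup>-\<^sup>m\<^sup>-\<^sup>1\<close> and a power of \<open>e\<close>, the elementary closed form of the exponential integral
  \<open>E\<^sub>-\<^sub>m(2 \<pi> n)\<close> (\<open>expint_kernel_integral\<close>). Hence the first period integral equals
  \<open>\<Sum>\<^sub>n (a(n) + b(n) \<Gamma>(1 - k, - 4 \<pi> n)) E\<^sub>-\<^sub>m(2 \<pi> n)\<close>: its \<open>a\<close>-part is the first half of the L-series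
  at \<open>w = 0\<close>. For \<open>n < 0\<close> the value \<open>E\<^sub>-\<^sub>m(2 \<pi> n)\<close> is the one obtained by analytic continuation, which is the
  same elementary expression.

  What remains for \<open>n = - \<bar>n\<bar>\<close>, with \<open>u = 2 \<pi> \<bar>n\<bar>\<close> and \<open>p = - k \<ge> 0\<close>, is \<open>b(n)\<close> times the difference of
  \<open>\<integral>\<^sub>1\<^sup>\<infinity> \<Gamma>(p + 1, 2 u t) e\<^sup>u\<^sup>t t\<^sup>m dt\<close> and \<open>\<Gamma>(p + 1, 2 u) E\<^sub>-\<^sub>m(- u)\<close>. Integration by parts
  (\<open>incgamma_moment_by_parts\<close>) turns it into \<open>- (2 u)\<^sup>p\<^sup>+\<^sup>1\<close> times a combination of the values
  \<open>E\<^sub>-\<^sub>(\<^sub>l\<^sub>+\<^sub>p\<^sub>)(u)\<close>, \<open>l \<le> m\<close>. The number \<open>- (2 u)\<^sup>p\<^sup>+\<^sup>1 b(n)\<close> is the conjugate of the Fourier coefficient of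
  \<open>\<xi>\<^sub>k f\<close> at \<open>- n\<close> (\<open>maass_expansion_b\<close>), so the kernel of the second period integral only has to produce that
  combination: the \<open>c\<close>-term yields, for each \<open>l\<close>, a multiple of the full sum \<open>\<Sum>\<^sub>s\<^sub>\<le>\<^sub>R u\<^sup>s\<^sup>-\<^sup>R\<^sup>-\<^sup>1 / s!\<close>,
  \<open>R = m + p + 1\<close>, and the \<open>d\<close>-terms cut off its part \<open>s > l + p\<close> (\<open>xi_kernel_integral\<close>).

  In weight \<open>k \<ge> 1\<close> there is no such correction because \<open>\<xi>\<^sub>k f\<close> is a holomorphic cusp form of weight
  \<open>2 - k \<le> 1\<close> and hence vanishes: for odd \<open>k\<close> because \<open>- I\<close> forces \<open>f = 0\<close>, for even \<open>k\<close> by the maximum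
  modulus principle (\<open>HC_xi_zero\<close>). Then \<open>b = 0\<close> as well, since \<open>\<Gamma>(1 - k, x)\<close> is strictly decreasing.

  The analytic part is the existence and convergence of the expansions. The coefficient
  \<open>c\<^sub>n(y) = \<integral>\<^sub>0\<^sup>1 f(x + i y) e(- n x) dx\<close> satisfies a first-order differential equation driven by the coefficient
  of \<open>\<xi>\<^sub>k f\<close> at \<open>- n\<close> (\<open>fourier_at_ode\<close>). Solving it gives the two kinds of terms of the expansion, and combined with
  the growth condition at the cusp it shows that \<open>\<xi>\<^sub>k f\<close> has no coefficients at indices \<open>\<le> 0\<close>. Pointwise convergence
  follows from Chernoff's elementary argument for Fourier series (\<open>fourier_series\<close>). Finally, the limit
  \<open>w \<rightarrow> 0\<close> is taken under the summation sign by dominated convergence (\<open>L_phi_limit\<close>).\<close>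

abbreviation "\<H> \<equiv> upper_half_plane"

section \<open>Fourier series of periodic functions\<close>

definition ee :: "int \<Rightarrow> complex \<Rightarrow> complex"
  where "ee n z = exp (2 * of_real pi * \<i> * of_int n * z)"

lemma ee_0_left [simp]: "ee 0 z = 1"
  by (simp add: ee_def)

lemma ee_nonzero [simp]: "ee n z \<noteq> 0"
  by (simp add: ee_def)

lemma ee_mult: "ee m z * ee n z = ee (m + n) z"
  by (simp add: ee_def exp_add [symmetric] algebra_simps)

lemma ee_add: "ee n (z + w) = ee n z * ee n w"
  by (simp add: ee_def exp_add [symmetric] algebra_simps)

lemma ee_of_int: "ee n (of_int j) = 1"
  using exp_plus_2pin [of 0 "n * j"] by (simp add: ee_def mult_ac)

lemma ee_1 [simp]: "ee n 1 = 1"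
  using ee_of_int [of n 1] by simp

lemma ee_zero [simp]: "ee n 0 = 1"
  by (simp add: ee_def)

lemma norm_ee: "norm (ee n z) = exp (- 2 * pi * of_int n * Im z)"
  by (simp add: ee_def)

lemma cnj_ee: "cnj (ee n z) = ee n (- cnj z)"
  by (simp add: ee_def exp_cnj)

lemma ee_uminus: "ee (- n) z = ee n (- z)"
  by (simp add: ee_def)

lemma cnj_ee_of_real: "cnj (ee n (of_real t)) = ee (- n) (of_real t)"
  by (simp add: cnj_ee ee_uminus)

lemma ee_power: "ee n z ^ j = ee (int j * n) z"
  by (simp add: ee_def exp_of_nat_mult [symmetric] mult_ac)

lemma ee_has_field_derivative [derivative_intros]:
  assumes "(f has_field_derivative f') (at z within S)"
  shows "((\<lambda>z. ee n (f z)) has_field_derivative (2 * of_real pi * \<i> * of_int n * ee n (f z) * f')) (at z within S)"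
  unfolding ee_def by (auto intro!: derivative_eq_intros assms)

lemma continuous_on_ee [continuous_intros]:
  "continuous_on S f \<Longrightarrow> continuous_on S (\<lambda>z. ee n (f z))"
  unfolding ee_def by (intro continuous_intros)

lemma isCont_ee [continuous_intros]: "isCont f z \<Longrightarrow> isCont (\<lambda>z. ee n (f z)) z"
  unfolding ee_def by (intro continuous_intros)

lemma ee_has_vector_derivative:
  "((\<lambda>t. ee n (of_real t)) has_vector_derivative (2 * of_real pi * \<i> * of_int n * ee n (of_real t))) (at t within S)"
proof -
  have "((\<lambda>t. ee n t) has_field_derivative 2 * of_real pi * \<i> * of_int n * ee n (of_real t)) (at (of_real t))"
    by (auto intro!: derivative_eq_intros)
  then show ?thesis
    by (rule has_vector_derivative_real_field)
qed

lemma ee_has_integral: "((\<lambda>t. ee n (of_real t)) has_integral (if n = 0 then 1 else 0)) {0..1::real}"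
proof (cases "n = 0")
  case True
  then show ?thesis using has_integral_const_real [of "1::complex" 0 1] by simp
next
  case False
  define c where "c = 2 * of_real pi * \<i> * (of_int n :: complex)"
  have c: "c \<noteq> 0" using False by (simp add: c_def)
  have "((\<lambda>t. ee n (of_real t)) has_integral (ee n (of_real 1) / c - ee n (of_real 0) / c)) {0..1::real}"
  proof (rule fundamental_theorem_of_calculus)
    fix x :: real
    have "((\<lambda>t. ee n (of_real t) / c) has_vector_derivative ((c * ee n (of_real x)) / c)) (at x within {0..1})"
      unfolding c_def by (intro has_vector_derivative_divide ee_has_vector_derivative)
    then show "((\<lambda>t. ee n (of_real t) / c) has_vector_derivative ee n (of_real x)) (at x within {0..1})"
      using c by simp
  qed simp
  then show ?thesis using False by simp
qed

definition fcoeff :: "(real \<Rightarrow> complex) \<Rightarrow> int \<Rightarrow> complex"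
  where "fcoeff u n = integral {0..1} (\<lambda>t. u t * ee (- n) (of_real t))"

lemma integrable_fcoeff:
  "continuous_on {0..1} u \<Longrightarrow> (\<lambda>t. u t * ee n (of_real t)) integrable_on {0..1::real}"
  by (intro integrable_continuous_real continuous_intros)

lemma fcoeff_has_integral:
  "continuous_on {0..1} u \<Longrightarrow> ((\<lambda>t. u t * ee (- n) (of_real t)) has_integral fcoeff u n) {0..1::real}"
  unfolding fcoeff_def by (intro integrable_integral integrable_fcoeff)

lemma norm_fcoeff_le:
  assumes "continuous_on {0..1} u" and "\<And>t. t \<in> {0..1} \<Longrightarrow> norm (u t) \<le> M"
  shows "norm (fcoeff u n) \<le> M"
proof -
  have "norm (u 0) \<le> M" using assms(2) [of 0] by simp
  then have "0 \<le> M" using norm_ge_zero [of "u 0"] by linarith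
  moreover have "((\<lambda>t. u t * ee (- n) (of_real t)) has_integral fcoeff u n) (cbox 0 (1::real))"
    using fcoeff_has_integral assms(1) by (simp add: cbox_interval)
  ultimately have "norm (fcoeff u n) \<le> M * measure lborel (cbox 0 (1::real))"
    by (rule has_integral_bound) (use assms(2) in \<open>auto simp: norm_mult norm_ee cbox_interval\<close>)
  then show ?thesis by simp
qed

text \<open>Expand \<open>0 \<le> \<integral> \<bar>g - s\<bar>\<^sup>2\<close> for the partial sum \<open>s\<close> of the Fourier series of \<open>g\<close> over \<open>S\<close>;
  by orthonormality both \<open>\<integral> g s\<^sup>*\<close> and \<open>\<integral> s s\<^sup>*\<close> are the sum on the left.\<close>

lemma bessel_inequality:
  assumes "continuous_on {0..1} g" and "finite S"
  shows "(\<Sum>n\<in>S. (norm (fcoeff g n))\<^sup>2) \<le> integral {0..1} (\<lambda>t. (norm (g t))\<^sup>2)"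
proof -
  define s where "s t = (\<Sum>n\<in>S. fcoeff g n * ee n (of_real t))" for t :: real
  define \<Sigma> where "\<Sigma> = (\<Sum>n\<in>S. (norm (fcoeff g n))\<^sup>2)"
  have sq: "of_real ((norm z)\<^sup>2) = z * cnj z" for z :: complex
    by (rule complex_norm_square)
  have cs: "cnj (s t) = (\<Sum>n\<in>S. cnj (fcoeff g n) * ee (- n) (of_real t))" for t
    by (simp add: s_def cnj_ee_of_real)
  have gs: "((\<lambda>t. g t * cnj (s t)) has_integral of_real \<Sigma>) {0..1}"
  proof -
    have "((\<lambda>t. \<Sum>n\<in>S. cnj (fcoeff g n) * (g t * ee (- n) (of_real t))) has_integral
        (\<Sum>n\<in>S. cnj (fcoeff g n) * fcoeff g n)) {0..1}"
      by (intro has_integral_sum assms has_integral_mult_right fcoeff_has_integral)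
    moreover have "(\<Sum>n\<in>S. cnj (fcoeff g n) * fcoeff g n) = of_real \<Sigma>"
      by (simp add: \<Sigma>_def sq mult.commute del: of_real_power)
    ultimately show ?thesis
      by (simp add: cs sum_distrib_left mult_ac)
  qed
  have ss: "((\<lambda>t. s t * cnj (s t)) has_integral of_real \<Sigma>) {0..1}"
  proof -
    have eq: "s t * cnj (s t) = (\<Sum>n\<in>S. \<Sum>m\<in>S. fcoeff g n * cnj (fcoeff g m) * ee (n - m) (of_real t))" for t
    proof -
      have "s t * cnj (s t) = (\<Sum>n\<in>S. \<Sum>m\<in>S. (fcoeff g n * ee n (of_real t)) * (cnj (fcoeff g m) * ee (- m) (of_real t)))"
        unfolding cs by (simp add: s_def sum_product)
      also have "\<dots> = (\<Sum>n\<in>S. \<Sum>m\<in>S. fcoeff g n * cnj (fcoeff g m) * ee (n - m) (of_real t))"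
        using ee_mult [of _ _ "- _"] by (intro sum.cong refl) (simp add: ee_mult [symmetric] diff_conv_add_uminus del: add_uminus_conv_diff)
      finally show ?thesis .
    qed
    have "((\<lambda>t. \<Sum>n\<in>S. \<Sum>m\<in>S. fcoeff g n * cnj (fcoeff g m) * ee (n - m) (of_real t)) has_integral
        (\<Sum>n\<in>S. \<Sum>m\<in>S. fcoeff g n * cnj (fcoeff g m) * (if n - m = 0 then 1 else 0))) {0..1::real}"
      by (intro has_integral_sum assms has_integral_mult_right ee_has_integral)
    moreover have "(\<Sum>n\<in>S. \<Sum>m\<in>S. fcoeff g n * cnj (fcoeff g m) * (if n - m = 0 then 1 else 0)) = of_real \<Sigma>"
    proof -
      have "(\<Sum>m\<in>S. fcoeff g n * cnj (fcoeff g m) * (if n - m = 0 then 1 else 0)) = of_real ((norm (fcoeff g n))\<^sup>2)"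
        if "n \<in> S" for n
      proof -
        have "(\<Sum>m\<in>S. fcoeff g n * cnj (fcoeff g m) * (if n - m = 0 then 1 else 0)) =
          (\<Sum>m\<in>S. if n = m then fcoeff g n * cnj (fcoeff g n) else 0)"
          by (intro sum.cong) auto
        then show ?thesis using that assms(2) by (simp add: sq del: of_real_power)
      qed
      then show ?thesis by (simp add: \<Sigma>_def)
    qed
    ultimately show ?thesis by (simp add: eq)
  qed
  have "((\<lambda>t. Re (g t * cnj (s t))) has_integral \<Sigma>) {0..1}"
    using has_integral_Re [OF gs] by simp
  moreover have "((\<lambda>t. Re (s t * cnj (s t))) has_integral \<Sigma>) {0..1}"
    using has_integral_Re [OF ss] by simp
  moreover have "(\<lambda>t. (norm (g t))\<^sup>2) integrable_on {0..1}"
    by (intro integrable_continuous_real continuous_intros assms)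
  then have "((\<lambda>t. (norm (g t))\<^sup>2) has_integral integral {0..1} (\<lambda>t. (norm (g t))\<^sup>2)) {0..1}"
    by (rule integrable_integral)
  ultimately have "((\<lambda>t. (norm (g t))\<^sup>2 - 2 * Re (g t * cnj (s t)) + Re (s t * cnj (s t))) has_integral
      (integral {0..1} (\<lambda>t. (norm (g t))\<^sup>2) - 2 * \<Sigma> + \<Sigma>)) {0..1}"
    by (intro has_integral_add has_integral_diff has_integral_mult_right)
  moreover have "(norm (g t))\<^sup>2 - 2 * Re (g t * cnj (s t)) + Re (s t * cnj (s t)) = (norm (g t - s t))\<^sup>2" for t
    unfolding cmod_power2 by (simp add: power2_eq_square algebra_simps)
  ultimately have "((\<lambda>t. (norm (g t - s t))\<^sup>2) has_integral
      (integral {0..1} (\<lambda>t. (norm (g t))\<^sup>2) - 2 * \<Sigma> + \<Sigma>)) {0..1}"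
    by simp
  then have "0 \<le> integral {0..1} (\<lambda>t. (norm (g t))\<^sup>2) - 2 * \<Sigma> + \<Sigma>"
    by (rule has_integral_nonneg) simp
  then show ?thesis by (simp add: \<Sigma>_def)
qed

text \<open>An arbitrary injective enumeration \<open>\<sigma>\<close> of indices covers both ends, \<open>n \<rightarrow> \<infinity>\<close> and
  \<open>n \<rightarrow> - \<infinity>\<close>; square summability comes from Bessel's inequality.\<close>

lemma riemann_lebesgue:
  assumes "continuous_on {0..1} g" and "inj (\<sigma> :: nat \<Rightarrow> int)"
  shows "(\<lambda>j. fcoeff g (\<sigma> j)) \<longlonglongrightarrow> 0"
proof -
  have "summable (\<lambda>j. (norm (fcoeff g (\<sigma> j)))\<^sup>2)"
  proof (rule summableI_nonneg_bounded)
    fix n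
    have "(\<Sum>j<n. (norm (fcoeff g (\<sigma> j)))\<^sup>2) = (\<Sum>i\<in>\<sigma> ` {..<n}. (norm (fcoeff g i))\<^sup>2)"
      using assms(2) by (subst sum.reindex) (auto simp: inj_on_def)
    also have "\<dots> \<le> integral {0..1} (\<lambda>t. (norm (g t))\<^sup>2)"
      by (intro bessel_inequality assms(1)) simp
    finally show "(\<Sum>j<n. (norm (fcoeff g (\<sigma> j)))\<^sup>2) \<le> integral {0..1} (\<lambda>t. (norm (g t))\<^sup>2)" .
  qed simp
  then have "(\<lambda>j. (norm (fcoeff g (\<sigma> j)))\<^sup>2) \<longlonglongrightarrow> 0"
    by (rule summable_LIMSEQ_zero)
  then have "(\<lambda>j. sqrt ((norm (fcoeff g (\<sigma> j)))\<^sup>2)) \<longlonglongrightarrow> sqrt 0"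
    by (intro tendsto_intros)
  then show ?thesis
    by (simp add: tendsto_norm_zero_iff)
qed

lemma vector_derivative_quotient_limit:
  fixes u :: "real \<Rightarrow> complex"
  assumes "(u has_vector_derivative d) (at x)"
  shows "((\<lambda>t. (u t - u x) / of_real (t - x)) \<longlongrightarrow> d) (at x)"
proof -
  have "((\<lambda>t. norm ((u t - u x) - (t - x) *\<^sub>R d) / norm (t - x)) \<longlongrightarrow> 0) (at x)"
    using assms unfolding has_vector_derivative_def has_derivative_iff_norm by blast
  moreover have "norm ((u t - u x) - (t - x) *\<^sub>R d) / norm (t - x) = norm ((u t - u x) / of_real (t - x) - d)"
    if "t \<noteq> x" for t
  proof -
    have "(u t - u x) / of_real (t - x) - d = ((u t - u x) - (t - x) *\<^sub>R d) / of_real (t - x)"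
      using that by (simp add: field_simps scaleR_conv_of_real)
    then show ?thesis by (simp only: norm_divide norm_of_real real_norm_def)
  qed
  then have "eventually (\<lambda>t. norm ((u t - u x) - (t - x) *\<^sub>R d) / norm (t - x) = norm ((u t - u x) / of_real (t - x) - d)) (at x)"
    by (auto simp: eventually_at_filter)
  ultimately have "((\<lambda>t. norm ((u t - u x) / of_real (t - x) - d)) \<longlongrightarrow> 0) (at x)"
    by (rule Lim_transform_eventually)
  then show ?thesis
    by (simp add: tendsto_norm_zero_iff LIM_zero_iff)
qed

text \<open>Chernoff's argument: put \<open>q(t) = e(t - x)\<close> and \<open>g = (u - u(x)) / (q - 1)\<close>. Since \<open>u\<close> is differentiable at
  \<open>x\<close>, the quotient \<open>g\<close> extends continuously across the zeros of \<open>q - 1\<close>, and \<open>u = u(x) + g (q - 1)\<close> makes the terms of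
  the series of \<open>u\<close> telescope. The two ends of the telescoping sum are Fourier coefficients of \<open>g\<close> and vanish in the limit
  by Riemann-Lebesgue. Absolute summability is what upgrades the limit of symmetric partial sums to an
  unconditional sum.\<close>

lemma fourier_series:
  fixes u :: "real \<Rightarrow> complex"
  assumes per: "\<And>t. u (t + 1) = u t"
    and der: "\<And>t. (u has_vector_derivative u' t) (at t)"
    and summ: "(\<lambda>n. norm (fcoeff u n)) summable_on UNIV"
  shows "((\<lambda>n. fcoeff u n * ee n (of_real x)) has_sum u x) UNIV"
proof -
  have contu: "isCont u t" for t
    using der has_vector_derivative_continuous by blast
  have conu: "continuous_on S u" for S
    using contu continuous_at_imp_continuous_on by blast
  have per_nat: "u (t + real n) = u t" for t n
  proof (induction n)
    case (Suc n)
    then show ?case using per [of "t + real n"] by (simp add: algebra_simps)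
  qed simp
  have per_int: "u (t + of_int j) = u t" for t j
  proof (cases "j \<ge> 0")
    case True
    then show ?thesis using per_nat [of t "nat j"] by simp
  next
    case False
    then show ?thesis using per_nat [of "t + of_int j" "nat (- j)"] by simp
  qed
  define q where "q t = ee 1 (of_real (t - x))" for t :: real
  have q1: "q t = 1 \<longleftrightarrow> (\<exists>j::int. t = x + of_int j)" for t
  proof
    assume "q t = 1"
    then obtain j :: int where "2 * pi * (t - x) = of_int (2 * j) * pi"
      by (auto simp: q_def ee_def exp_eq_1)
    then have "t = x + of_int j" by simp
    then show "\<exists>j::int. t = x + of_int j" by blast
  next
    assume "\<exists>j::int. t = x + of_int j"
    then show "q t = 1" using ee_of_int [of 1] by (auto simp: q_def)
  qed
  have qper: "q (t + of_int j) = q t" for t and j :: int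
  proof -
    have "q (t + of_int j) = ee 1 (of_real (t - x) + of_int j)"
      by (simp add: q_def algebra_simps)
    then show ?thesis unfolding ee_add ee_of_int by (simp add: q_def)
  qed
  \<comment> \<open>the value that makes \<open>g\<close> continuous: quotient of the derivatives of \<open>u\<close> and \<open>q\<close> at \<open>x\<close>\<close>
  define L where "L = u' x / (2 * of_real pi * \<i>)"
  define g where "g t = (if q t = 1 then L else (u t - u x) / (q t - 1))" for t
  have gper: "g (t + of_int j) = g t" for t and j :: int
    by (simp add: g_def qper per_int)
  have conq: "isCont q t" for t
    unfolding q_def by (intro continuous_intros)
  have qder: "(q has_vector_derivative (2 * of_real pi * \<i>)) (at x)"
  proof -
    have "((\<lambda>t. ee 1 (of_real t) * ee 1 (- of_real x)) has_vector_derivative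
        2 * of_real pi * \<i> * of_int 1 * ee 1 (of_real x) * ee 1 (- of_real x)) (at x)"
      by (intro has_vector_derivative_mult_left ee_has_vector_derivative)
    moreover have "ee 1 (of_real x) * ee 1 (- of_real x) = 1"
      by (simp add: ee_add [symmetric])
    moreover have "(\<lambda>t. ee 1 (of_real t) * ee 1 (- of_real x)) = q"
      by (rule ext) (simp add: q_def ee_add [symmetric])
    ultimately show ?thesis by (simp add: mult.assoc)
  qed
  have qx: "q x = 1" using q1 [of x] by (metis add.right_neutral of_int_0)
  have gx: "isCont g x"
  proof -
    have "((\<lambda>t. ((u t - u x) / of_real (t - x)) / ((q t - q x) / of_real (t - x))) \<longlongrightarrow> u' x / (2 * of_real pi * \<i>)) (at x)"
      by (intro tendsto_divide vector_derivative_quotient_limit der qder) simp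
    moreover have "eventually (\<lambda>t. ((u t - u x) / of_real (t - x)) / ((q t - q x) / of_real (t - x)) = g t) (at x)"
    proof -
      have "eventually (\<lambda>t. (q t - q x) / of_real (t - x) \<noteq> 0) (at x)"
        by (rule tendsto_imp_eventually_ne [OF vector_derivative_quotient_limit [OF qder]]) simp
      then show ?thesis
        by eventually_elim (auto simp: g_def qx)
    qed
    ultimately have "(g \<longlongrightarrow> L) (at x)"
      unfolding L_def by (rule Lim_transform_eventually)
    then show ?thesis
      by (simp add: isCont_def g_def qx)
  qed
  have cong: "isCont g t" for t
  proof (cases "q t = 1")
    case True
    then obtain j :: int where j: "t = x + of_int j" using q1 by blast
    have "isCont (\<lambda>s. g (s + of_int (- j))) t"
      by (rule isCont_o2 [where g = g]) (use j gx in \<open>auto intro: continuous_intros\<close>)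
    then show ?thesis by (simp only: gper)
  next
    case False
    then have ev: "eventually (\<lambda>s. q s \<noteq> 1) (nhds t)"
      using continuous_at_avoid [OF conq [of t] False] by (auto simp: eventually_nhds_metric dist_commute)
    have "isCont (\<lambda>t. (u t - u x) / (q t - 1)) t"
      using False by (intro continuous_intros contu conq) auto
    moreover have "eventually (\<lambda>s. g s = (u s - u x) / (q s - 1)) (nhds t)"
      using ev by eventually_elim (simp add: g_def)
    ultimately show ?thesis by (simp add: isCont_cong)
  qed
  have cg: "continuous_on {0..1} g"
    using cong continuous_at_imp_continuous_on by blast
  have key: "u t - u x = g t * (q t - 1)" for t
  proof (cases "q t = 1")
    case True
    then obtain j :: int where "t = x + of_int j" using q1 by blast
    then show ?thesis using True per_int by simp
  qed (simp add: g_def)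
  define G where "G n = ee n (of_real x) * fcoeff g n" for n
  have tele: "fcoeff u n * ee n (of_real x) - (if n = 0 then u x else 0) = G (n - 1) - G n" for n
  proof -
    have "((\<lambda>t. u t * ee (- n) (of_real t) - u x * ee (- n) (of_real t)) has_integral
        (fcoeff u n - u x * (if - n = 0 then 1 else 0))) {0..1}"
      by (intro has_integral_diff has_integral_mult_right fcoeff_has_integral conu ee_has_integral)
    moreover have "((\<lambda>t. ee 1 (- of_real x) * (g t * ee (- (n - 1)) (of_real t)) - g t * ee (- n) (of_real t)) has_integral
        (ee 1 (- of_real x) * fcoeff g (n - 1) - fcoeff g n)) {0..1}"
      by (intro has_integral_diff has_integral_mult_right fcoeff_has_integral cg)
    moreover have "u t * ee (- n) (of_real t) - u x * ee (- n) (of_real t) =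
      ee 1 (- of_real x) * (g t * ee (- (n - 1)) (of_real t)) - g t * ee (- n) (of_real t)" for t
    proof -
      have "u t * ee (- n) (of_real t) - u x * ee (- n) (of_real t) = g t * (q t - 1) * ee (- n) (of_real t)"
        by (simp only: key [symmetric] left_diff_distrib)
      also have "q t = ee 1 (of_real t) * ee 1 (- of_real x)"
        by (simp add: q_def ee_add [symmetric])
      finally show ?thesis
        using ee_mult [of 1 "of_real t" "- n"] by (simp add: algebra_simps)
    qed
    ultimately have "fcoeff u n - u x * (if - n = 0 then 1 else 0) = ee 1 (- of_real x) * fcoeff g (n - 1) - fcoeff g n"
      by (metis (no_types, lifting) has_integral_unique has_integral_cong)
    then have *: "fcoeff u n - u x * (if n = 0 then 1 else 0) = ee 1 (- of_real x) * fcoeff g (n - 1) - fcoeff g n"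
      by simp
    have "ee n (of_real x) * (fcoeff u n - u x * (if n = 0 then 1 else 0)) =
        ee n (of_real x) * (ee 1 (- of_real x)) * fcoeff g (n - 1) - G n"
      unfolding * G_def by (simp add: algebra_simps)
    also have "ee n (of_real x) * ee 1 (- of_real x) = ee (n - 1) (of_real x)"
      using ee_mult [of n "of_real x" "-1"] by (simp add: ee_uminus)
    finally show ?thesis by (auto simp: G_def algebra_simps split: if_splits)
  qed
  have partial: "(\<Sum>n\<in>{- int M..int M}. fcoeff u n * ee n (of_real x)) = u x + G (- int (Suc M)) - G (int M)" for M
  proof -
    have "(\<Sum>n\<in>{- int M..int M}. G (n - 1) - G n) = G (- int (Suc M)) - G (int M)"
    proof (induction M)
      case (Suc M)
      have "{- int (Suc M)..int (Suc M)} = insert (- int (Suc M)) (insert (int (Suc M)) {- int M..int M})"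
        by auto
      then show ?case using Suc by (simp add: algebra_simps)
    qed simp
    moreover have "(\<Sum>n\<in>{- int M..int M}. if n = 0 then u x else 0) = u x"
      by (simp add: sum.delta)
    ultimately have "(\<Sum>n\<in>{- int M..int M}. fcoeff u n * ee n (of_real x)) - u x = G (- int (Suc M)) - G (int M)"
      unfolding tele [symmetric] sum_subtractf by simp
    then show ?thesis by (simp add: algebra_simps)
  qed
  have lim: "(\<lambda>M. \<Sum>n\<in>{- int M..int M}. fcoeff u n * ee n (of_real x)) \<longlonglongrightarrow> u x"
  proof -
    have nG: "norm (G n) = norm (fcoeff g n)" for n
      by (simp add: G_def norm_mult norm_ee)
    have "(\<lambda>M. fcoeff g (- int (Suc M))) \<longlonglongrightarrow> 0" "(\<lambda>M. fcoeff g (int M)) \<longlonglongrightarrow> 0"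
      by (rule riemann_lebesgue [OF cg], auto simp: inj_def)+
    then have "(\<lambda>M. G (- int (Suc M))) \<longlonglongrightarrow> 0" "(\<lambda>M. G (int M)) \<longlonglongrightarrow> 0"
      by (subst tendsto_norm_zero_iff [symmetric], simp only: nG tendsto_norm_zero_iff)+
    then have "(\<lambda>M. u x + G (- int (Suc M)) - G (int M)) \<longlonglongrightarrow> u x + 0 - 0"
      by (intro tendsto_intros)
    then show ?thesis by (simp add: partial)
  qed
  have "(\<lambda>n. norm (fcoeff u n * ee n (of_real x))) summable_on UNIV"
    using summ by (simp add: norm_mult norm_ee)
  then have "(\<lambda>n. fcoeff u n * ee n (of_real x)) summable_on UNIV"
    by (rule Infinite_Sum.abs_summable_summable)
  then obtain s where s: "((\<lambda>n. fcoeff u n * ee n (of_real x)) has_sum s) UNIV"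
    by (auto simp: summable_on_def)
  \<comment> \<open>symmetric partial sums are cofinal among all finite partial sums\<close>
  have "filterlim (\<lambda>M. {- int M..int M}) (finite_subsets_at_top UNIV) sequentially"
    unfolding filterlim_finite_subsets_at_top
  proof (intro allI impI)
    fix X :: "int set"
    assume X: "finite X \<and> X \<subseteq> UNIV"
    then have "finite (abs ` X)" by blast
    then obtain B where B: "\<And>n. n \<in> X \<Longrightarrow> \<bar>n\<bar> \<le> B"
      by (meson Max_ge imageI)
    have "eventually (\<lambda>M. M \<ge> nat B) sequentially" by (rule eventually_ge_at_top)
    then show "\<forall>\<^sub>F M in sequentially. finite {- int M..int M} \<and> X \<subseteq> {- int M..int M} \<and> {- int M..int M} \<subseteq> UNIV"
    proof eventually_elim
      case (elim M)
      show ?case using B elim by fastforce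
    qed
  qed
  then have "(\<lambda>M. \<Sum>n\<in>{- int M..int M}. fcoeff u n * ee n (of_real x)) \<longlonglongrightarrow> s"
    using s unfolding has_sum_def by (rule filterlim_compose [rotated])
  with lim have "s = u x" by (rule LIMSEQ_unique [rotated])
  with s show ?thesis by simp
qed

section \<open>Exponential integrals and the incomplete Gamma function\<close>

text \<open>On \<open>[a, a + k]\<close> this is the fundamental theorem of calculus; the bound \<open>h\<close> allows \<open>k \<rightarrow> \<infinity>\<close>.\<close>

lemma FTC_to_infinity:
  fixes F :: "real \<Rightarrow> 'b::euclidean_space"
  assumes der: "\<And>t. t \<ge> a \<Longrightarrow> (F has_vector_derivative f t) (at t)"
    and lim: "(F \<longlongrightarrow> L) at_top"
    and h: "h integrable_on {a..}" and fh: "\<And>t. t \<ge> a \<Longrightarrow> norm (f t) \<le> h t"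
  shows "(f has_integral (L - F a)) {a..}"
proof -
  define g where "g k t = (if t \<in> {a..a + real k} then f t else 0)" for k t
  have 1: "(g k has_integral (F (a + real k) - F a)) {a..}" for k
  proof -
    have "(f has_integral (F (a + real k) - F a)) {a..a + real k}"
      by (rule fundamental_theorem_of_calculus) (auto intro: der has_vector_derivative_at_within)
    then show ?thesis
      unfolding g_def by (subst has_integral_restrict) auto
  qed
  have 2: "(\<lambda>k. F (a + real k) - F a) \<longlonglongrightarrow> L - F a"
  proof -
    have "filterlim (\<lambda>k. a + real k) at_top sequentially"
      by (intro filterlim_tendsto_add_at_top [OF tendsto_const] filterlim_real_sequentially)
    then show ?thesis
      by (intro tendsto_diff tendsto_const filterlim_compose [OF lim])
  qed
  have 3: "(\<lambda>k. g k t) \<longlonglongrightarrow> f t" if "t \<in> {a..}" for t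
  proof (rule tendsto_eventually)
    have "eventually (\<lambda>k. k \<ge> nat \<lceil>t - a\<rceil>) sequentially" by (rule eventually_ge_at_top)
    then show "eventually (\<lambda>k. g k t = f t) sequentially"
      by eventually_elim (use that in \<open>auto simp: g_def; linarith\<close>)
  qed
  show ?thesis
  proof (rule has_integral_dominated_convergence [OF 1 h _ _ 2])
    show "\<forall>x\<in>{a..}. norm (g k x) \<le> h x" for k
    proof
      fix x assume "x \<in> {a..}"
      then have "norm (f x) \<le> h x" using fh by simp
      moreover have "0 \<le> norm (f x)" by simp
      ultimately have "0 \<le> h x" by linarith
      with \<open>norm (f x) \<le> h x\<close> show "norm (g k x) \<le> h x"
        by (simp add: g_def)
    qed
  qed (use 3 in blast)
qed

text \<open>The elementary part of an incomplete Gamma function of integer order: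
  \<open>\<integral>\<^sub>t\<^sup>\<infinity> s\<^sup>p e\<^sup>-\<^sup>z\<^sup>s ds = e\<^sup>-\<^sup>z\<^sup>t incexp p z t\<close> for \<open>Re z > 0\<close>. Being rational in \<open>z\<close>, it also describes the
  analytic continuation of that integral to all \<open>z \<noteq> 0\<close>. The type is left open because the same identities
  are used over the reals and over the complex numbers.\<close>

definition incexp :: "nat \<Rightarrow> 'a::{real_normed_field,banach} \<Rightarrow> 'a \<Rightarrow> 'a"
  where "incexp p z t = (\<Sum>l\<le>p. fact p / (fact l * z ^ (p - l + 1)) * t ^ l)"

lemma incexp_0: "incexp 0 z t = 1 / z"
  by (simp add: incexp_def)

lemma incexp_Suc:
  fixes z t :: "'a::{real_normed_field,banach}"
  shows "incexp (Suc p) z t = t ^ Suc p / z + of_nat (Suc p) / z * incexp p z t"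
proof -
  have nz: "1 + of_nat p \<noteq> (0::'a)"
    by (metis of_nat_Suc of_nat_neq_0)
  have "incexp (Suc p) z t = t ^ Suc p / z + (\<Sum>l\<le>p. fact (Suc p) / (fact l * z ^ (Suc p - l + 1)) * t ^ l)"
    by (simp add: incexp_def add.commute nz)
  also have "(\<Sum>l\<le>p. fact (Suc p) / (fact l * z ^ (Suc p - l + 1)) * t ^ l) =
      (\<Sum>l\<le>p. of_nat (Suc p) / z * (fact p / (fact l * z ^ (p - l + 1)) * t ^ l))"
    by (intro sum.cong refl) (simp add: Suc_diff_le nz mult_ac)
  finally show ?thesis by (simp add: incexp_def sum_distrib_left)
qed

lemma incexp_has_field_derivative:
  assumes "z \<noteq> 0"
  shows "(incexp p z has_field_derivative (z * incexp p z t - t ^ p)) (at t)"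
proof (induction p)
  case 0
  then show ?case using assms by (simp add: incexp_0 [abs_def])
next
  case (Suc p)
  have "((\<lambda>t. t ^ Suc p) has_field_derivative (of_nat (Suc p) * t ^ p)) (at t)"
    by (rule derivative_eq_intros refl | simp del: power_Suc of_nat_Suc)+
  then have "((\<lambda>t. t ^ Suc p / z + of_nat (Suc p) / z * incexp p z t) has_field_derivative
      (of_nat (Suc p) * t ^ p / z + of_nat (Suc p) / z * (z * incexp p z t - t ^ p))) (at t)"
    by (intro DERIV_add DERIV_cdivide DERIV_cmult Suc)
  moreover have "of_nat (Suc p) * t ^ p / z + of_nat (Suc p) / z * (z * incexp p z t - t ^ p) =
      z * incexp (Suc p) z t - t ^ Suc p"
    using assms by (simp add: incexp_Suc field_simps)
  ultimately show ?case by (simp add: incexp_Suc [abs_def])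
qed

text \<open>For \<open>z = - u < 0\<close> this is the antiderivative of the growing function \<open>- t\<^sup>p e\<^sup>u\<^sup>t\<close> that integration by parts
  calls for.\<close>

lemma exp_incexp_has_field_derivative:
  assumes "z \<noteq> 0"
  shows "((\<lambda>t. exp (- (z * t)) * incexp p z t) has_field_derivative - (t ^ p * exp (- (z * t)))) (at t)"
  using assms by (auto intro!: derivative_eq_intros incexp_has_field_derivative simp: algebra_simps)

lemma power_times_exp_tendsto_0:
  assumes "c > (0::real)"
  shows "((\<lambda>t. t ^ l * exp (- (c * t))) \<longlongrightarrow> 0) at_top"
proof -
  have "((\<lambda>t. (c * t) ^ l / exp (c * t)) \<longlongrightarrow> 0) at_top"
    by (rule filterlim_compose [OF tendsto_power_div_exp_0 filterlim_tendsto_pos_mult_at_top [OF tendsto_const assms filterlim_ident]])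
  then have "((\<lambda>t. (1 / c ^ l) * ((c * t) ^ l / exp (c * t))) \<longlongrightarrow> (1 / c ^ l) * 0) at_top"
    by (intro tendsto_intros)
  then show ?thesis
    using assms by (simp add: power_mult_distrib exp_minus field_simps)
qed

lemma exp_incexp_tendsto_0:
  assumes "u > (0::real)"
  shows "((\<lambda>t. exp (- (u * t)) * incexp q u t) \<longlongrightarrow> 0) at_top"
proof -
  have "((\<lambda>t. \<Sum>l\<le>q. fact q / (fact l * u ^ (q - l + 1)) * (t ^ l * exp (- (u * t)))) \<longlongrightarrow>
      (\<Sum>l\<le>q. fact q / (fact l * u ^ (q - l + 1)) * 0)) at_top"
    by (intro tendsto_intros power_times_exp_tendsto_0 assms)
  then show ?thesis by (simp add: incexp_def sum_distrib_left mult_ac)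
qed

lemma power_fact_le_exp: "x \<ge> 0 \<Longrightarrow> x ^ p / fact p \<le> exp (x::real)"
proof -
  assume x: "x \<ge> 0"
  have "(\<Sum>n\<in>{p}. x ^ n /\<^sub>R fact n) \<le> (\<Sum>n. x ^ n /\<^sub>R fact n)"
    using x by (intro sum_le_suminf summable_exp_generic) auto
  then show ?thesis by (simp add: exp_def divide_inverse mult.commute)
qed

text \<open>Half of the exponent absorbs the power, because \<open>(c t / 2)\<^sup>p / p! \<le> e\<^sup>c\<^sup>t\<^sup>/\<^sup>2\<close>.\<close>

lemma exp_power_integrable:
  fixes a c t :: real
  assumes "c > 0" "a \<ge> 0"
  shows "(\<lambda>t. (fact p * (2 / c) ^ p) * exp (- (c / 2) * t)) integrable_on {a..}"
    and "t \<ge> 0 \<Longrightarrow> t ^ p * exp (- (c * t)) \<le> (fact p * (2 / c) ^ p) * exp (- (c / 2) * t)"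
proof -
  show "(\<lambda>t. (fact p * (2 / c) ^ p) * exp (- (c / 2) * t)) integrable_on {a..}"
    using integrable_on_cmult_left [OF integrable_on_exp_minus_to_infinity [of "c / 2" a]] assms by simp
  assume t: "t \<ge> 0"
  have "(c / 2 * t) ^ p / fact p \<le> exp (c / 2 * t)"
    using t assms by (intro power_fact_le_exp) simp
  then have "t ^ p \<le> fact p * (2 / c) ^ p * exp (c / 2 * t)"
    using assms by (simp add: power_mult_distrib power_divide field_simps)
  then have "t ^ p * exp (- (c * t)) \<le> fact p * (2 / c) ^ p * exp (c / 2 * t) * exp (- (c * t))"
    by (rule mult_right_mono) simp
  also have "\<dots> = fact p * (2 / c) ^ p * exp (- (c / 2) * t)"
    by (simp add: mult.assoc exp_add [symmetric] algebra_simps)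
  finally show "t ^ p * exp (- (c * t)) \<le> (fact p * (2 / c) ^ p) * exp (- (c / 2) * t)" .
qed

lemma power_exp_has_integral:
  fixes z :: complex
  assumes z: "Re z > 0" and a: "a \<ge> 0"
  shows "((\<lambda>t. of_real t ^ p * exp (- (z * of_real t))) has_integral
      exp (- (z * of_real a)) * incexp p z (of_real a)) {a..}"
proof -
  define F where "F t = - (exp (- (z * of_real t)) * incexp p z (of_real t))" for t :: real
  have z0: "z \<noteq> 0" using z by auto
  have nrm: "norm (of_real t ^ l * exp (- (z * of_real t))) = t ^ l * exp (- (Re z * t))" if "t \<ge> 0" for t l
    using that by (simp add: norm_mult norm_power)
  have "((\<lambda>t. of_real t ^ p * exp (- (z * of_real t))) has_integral (0 - F a)) {a..}"
  proof (rule FTC_to_infinity)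
    show "(F has_vector_derivative of_real t ^ p * exp (- (z * of_real t))) (at t)" for t
      unfolding F_def
      using has_vector_derivative_minus [OF has_vector_derivative_real_field [OF exp_incexp_has_field_derivative [OF z0]]]
      by simp
    have "((\<lambda>t. of_real t ^ l * exp (- (z * of_real t))) \<longlongrightarrow> 0) at_top" for l
    proof (rule tendsto_norm_zero_cancel)
      have "eventually (\<lambda>t. t ^ l * exp (- (Re z * t)) = norm (of_real t ^ l * exp (- (z * of_real t)))) at_top"
        using eventually_ge_at_top [of 0] by eventually_elim (simp add: nrm)
      then show "((\<lambda>t. norm (of_real t ^ l * exp (- (z * of_real t)))) \<longlongrightarrow> 0) at_top"
        by (rule Lim_transform_eventually [OF power_times_exp_tendsto_0 [OF z]])
    qed
    then have "((\<lambda>t. - (\<Sum>l\<le>p. fact p / (fact l * z ^ (p - l + 1)) * (of_real t ^ l * exp (- (z * of_real t)))))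
        \<longlongrightarrow> - (\<Sum>l\<le>p. fact p / (fact l * z ^ (p - l + 1)) * 0)) at_top"
      by (intro tendsto_intros)
    then show "(F \<longlongrightarrow> 0) at_top"
      by (simp add: F_def [abs_def] incexp_def sum_distrib_left mult_ac)
    show "(\<lambda>t. (fact p * (2 / Re z) ^ p) * exp (- (Re z / 2) * t)) integrable_on {a..}"
      by (rule exp_power_integrable [OF z a])
    show "norm (of_real t ^ p * exp (- (z * of_real t))) \<le> (fact p * (2 / Re z) ^ p) * exp (- (Re z / 2) * t)"
      if "t \<ge> a" for t
      using exp_power_integrable(2) [OF z a, of t p] nrm [of t p] that a by simp
  qed
  then show ?thesis by (simp add: F_def)
qed

lemma upper_Gamma_closed_form:
  assumes "k \<le> 0" "x > 0"
  shows "upper_Gamma (1 - of_int k) x = exp (- x) * incexp (nat (- k)) 1 x"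
proof -
  define p where "p = nat (- k)"
  have "((\<lambda>t. Re (of_real t ^ p * exp (- (1 * of_real t)))) has_integral
      Re (exp (- (1 * of_real x)) * incexp p 1 (of_real x))) {x..}"
    by (intro has_integral_Re power_exp_has_integral) (use assms in auto)
  moreover have "Re (of_real t ^ p * exp (- (1 * of_real t))) = t ^ p * exp (- t)" for t
  proof -
    have "of_real t ^ p * exp (- (1 * of_real t)) = complex_of_real (t ^ p * exp (- t))"
      by (simp add: exp_of_real [symmetric])
    then show ?thesis by (simp only: Re_complex_of_real)
  qed
  moreover have "exp (- (1 * of_real x)) * incexp p 1 (of_real x) = complex_of_real (exp (- x) * incexp p 1 x)"
    by (simp add: exp_of_real [symmetric] incexp_def)
  ultimately have 1: "((\<lambda>t. t ^ p * exp (- t)) has_integral exp (- x) * incexp p 1 x) {x..}"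
    by (simp only: Re_complex_of_real)
  have "1 - of_int k - 1 = real p" using assms by (simp add: p_def)
  then have "exp (- t) * t powr (1 - of_int k - 1) = t ^ p * exp (- t)" if "t \<in> {x..}" for t
    using that assms by (simp add: powr_realpow)
  then have "integral {x..} (\<lambda>t. exp (- t) * t powr (1 - of_int k - 1)) = integral {x..} (\<lambda>t. t ^ p * exp (- t))"
    by (intro integral_cong)
  then show ?thesis
    using 1 by (simp add: upper_Gamma_def p_def integral_unique)
qed

text \<open>In weight \<open>k \<ge> 1\<close>, where \<open>r = 1 - k \<le> 0\<close> and no elementary form is available, strict monotonicity is
  what shows that \<open>b \<Gamma>(r, v y)\<close> can be constant in \<open>y\<close> only for \<open>b = 0\<close>.\<close>

lemma upper_Gamma_strict_decreasing:
  assumes "0 < x" "x < y"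
    and r: "r \<le> 1"
  shows "upper_Gamma r y < upper_Gamma r x"
proof -
  define g where "g t = exp (- t) * t powr (r - 1)" for t :: real
  have contg: "continuous_on {a..b} g" if "a > 0" for a b
    unfolding g_def using that by (intro continuous_intros) auto
  have contg': "continuous_on {a..} g" if "a > 0" for a
    unfolding g_def using that by (intro continuous_intros) auto
  have int: "g integrable_on {a..}" if a: "a > 0" for a
  proof (rule measurable_bounded_by_integrable_imp_integrable)
    show "g \<in> borel_measurable (lebesgue_on {a..})"
      by (intro continuous_imp_measurable_on_sets_lebesgue contg' a) simp
    show "(\<lambda>t. a powr (r - 1) * exp (- 1 * t)) integrable_on {a..}"
      using integrable_on_cmult_left [OF integrable_on_exp_minus_to_infinity [of 1 a]] by simp
    show "norm (g t) \<le> a powr (r - 1) * exp (- 1 * t)" if "t \<in> {a..}" for t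
      using that a r by (auto simp: g_def mult.commute intro!: mult_left_mono powr_mono2')
  qed simp
  have "integral {x..} g = integral {x..y} g + integral {y..} g"
  proof -
    have "{x..} = {x..y} \<union> {y..}" using assms by auto
    moreover have "{x..y} \<inter> {y..} = {y}" using assms by auto
    ultimately show ?thesis
      using assms by (simp add: integral_Un [OF integrable_continuous_real [OF contg] int])
  qed
  moreover have "0 < integral {x..y} g"
  proof -
    have "exp (- y) * y powr (r - 1) \<le> g t" if "t \<in> {x..y}" for t
      unfolding g_def using that assms by (intro mult_mono powr_mono2') auto
    then have "integral {x..y} (\<lambda>t. exp (- y) * y powr (r - 1)) \<le> integral {x..y} g"
      using assms by (intro integral_le integrable_continuous_real contg continuous_intros) auto
    then have "(y - x) * (exp (- y) * y powr (r - 1)) \<le> integral {x..y} g"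
      using assms by (simp add: mult_ac)
    moreover have "0 < (y - x) * (exp (- y) * y powr (r - 1))"
      using assms by simp
    ultimately show ?thesis by linarith
  qed
  ultimately show ?thesis
    unfolding upper_Gamma_def by (simp add: g_def [abs_def])
qed

text \<open>The function \<open>E\<^sub>-\<^sub>m(z) = \<integral>\<^sub>1\<^sup>\<infinity> e\<^sup>-\<^sup>z\<^sup>t t\<^sup>m dt\<close> together with its continuation.\<close>

definition expint_closed :: "nat \<Rightarrow> complex \<Rightarrow> complex"
  where "expint_closed m z = exp (- z) * incexp m z 1"

text \<open>The closed form is one admissible choice for the continuation, and the slit plane is connected, so the two
  functions, which agree on the right half-plane, agree everywhere on it.\<close>

lemma gen_expint_eq:
  assumes "z \<notin> \<real>\<^sub>\<le>\<^sub>0"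
  shows "gen_expint (- of_nat m) z = expint_closed m z"
proof -
  let ?P = "\<lambda>g. g holomorphic_on (- \<real>\<^sub>\<le>\<^sub>0) \<and>
    (\<forall>z. Re z > 0 \<longrightarrow> g z = integral {1..} (\<lambda>t. exp (- z * of_real t) * of_real t powr (- (- of_nat m))))"
  have int: "integral {1..} (\<lambda>t. exp (- z * of_real t) * of_real t powr (- (- of_nat m))) = expint_closed m z"
    if "Re z > 0" for z :: complex
  proof -
    have "integral {1..} (\<lambda>t. exp (- z * of_real t) * of_real t powr (- (- of_nat m))) =
        integral {1..} (\<lambda>t. of_real t ^ m * exp (- (z * of_real t)))"
      by (intro integral_cong) (auto simp: powr_nat')
    then show ?thesis
      using integral_unique [OF power_exp_has_integral [OF that, of 1 m]] by (simp add: expint_closed_def)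
  qed
  have hol: "expint_closed m holomorphic_on (- \<real>\<^sub>\<le>\<^sub>0)"
    unfolding expint_closed_def [abs_def] incexp_def
    by (intro holomorphic_intros) auto
  then have "?P (expint_closed m)" using int by simp
  then have P: "?P (gen_expint (- of_nat m))"
    unfolding gen_expint_def by (rule someI [of ?P])
  show ?thesis
  proof (rule analytic_continuation_open [of "{z. Re z > 0}" "- \<real>\<^sub>\<le>\<^sub>0" "gen_expint (- of_nat m)" "expint_closed m"])
    show "open {z. 0 < Re z}" by (rule open_halfspace_Re_gt)
    show "open (- \<real>\<^sub>\<le>\<^sub>0 :: complex set)" by (intro open_Compl closed_nonpos_Reals_complex)
    have "(\<real>\<^sub>\<le>\<^sub>0 :: complex set) = of_real ` {..0}"
      by (auto simp: nonpos_Reals_def)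
    then show "connected (- \<real>\<^sub>\<le>\<^sub>0 :: complex set)"
      using starlike_slotted_complex_plane_left [of 0] starlike_imp_connected by metis
    show "{z. 0 < Re z} \<noteq> {}" by (auto intro: exI [of _ 1])
    show "{z. 0 < Re z} \<subseteq> - \<real>\<^sub>\<le>\<^sub>0" by (auto simp: complex_nonpos_Reals_iff)
  qed (use P hol int assms in auto)
qed

text \<open>With \<open>\<Gamma>(p + 1, 2 u t)\<close> written out as \<open>e\<^sup>-\<^sup>2\<^sup>u\<^sup>t\<close> times a polynomial in \<open>t\<close>, the moment
  \<open>\<integral>\<^sub>1\<^sup>\<infinity> \<Gamma>(p + 1, 2 u t) e\<^sup>(\<^sup>u\<^sup>-\<^sup>w\<^sup>)\<^sup>t t\<^sup>m dt\<close> becomes a finite sum of exponential integrals at \<open>u + w\<close>.\<close>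

definition incgamma_moment :: "nat \<Rightarrow> nat \<Rightarrow> real \<Rightarrow> complex \<Rightarrow> complex"
  where "incgamma_moment p m u w =
    (\<Sum>j\<le>p. of_real (fact p / fact j * (2 * u) ^ j) * expint_closed (j + m) (of_real u + w))"

lemma incgamma_moment_integral:
  assumes k: "k \<le> 0" and u: "u > 0" and w: "Re w \<ge> 0"
  shows "integral {1..} (\<lambda>t. of_real (upper_Gamma (1 - of_int k) (2 * u * t)) * exp (- (- of_real u + w) * of_real t) *
      of_real t powr of_nat m) = incgamma_moment (nat (- k)) m u w"
proof -
  define p where "p = nat (- k)"
  define v where "v = of_real u + w"
  have v: "Re v > 0" using u w by (simp add: v_def)
  have "((\<lambda>t. \<Sum>j\<le>p. of_real (fact p / fact j * (2 * u) ^ j) * (of_real t ^ (j + m) * exp (- (v * of_real t))))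
      has_integral (\<Sum>j\<le>p. of_real (fact p / fact j * (2 * u) ^ j) * (exp (- (v * of_real 1)) * incexp (j + m) v (of_real 1)))) {1..}"
    by (intro has_integral_sum has_integral_mult_right power_exp_has_integral v) auto
  then have I: "((\<lambda>t. \<Sum>j\<le>p. of_real (fact p / fact j * (2 * u) ^ j) * (of_real t ^ (j + m) * exp (- (v * of_real t))))
      has_integral incgamma_moment p m u w) {1..}"
    by (simp add: incgamma_moment_def expint_closed_def v_def)
  have "integral {1..} (\<lambda>t. of_real (upper_Gamma (1 - of_int k) (2 * u * t)) * exp (- (- of_real u + w) * of_real t) *
      of_real t powr of_nat m) =
    integral {1..} (\<lambda>t. \<Sum>j\<le>p. of_real (fact p / fact j * (2 * u) ^ j) * (of_real t ^ (j + m) * exp (- (v * of_real t))))"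
  proof (rule integral_cong)
    fix t :: real assume "t \<in> {1..}"
    then have t: "t \<ge> 1" by simp
    have "complex_of_real (upper_Gamma (1 - of_int k) (2 * u * t)) =
        of_real (exp (- (2 * u * t))) * (\<Sum>j\<le>p. of_real (fact p / fact j * (2 * u) ^ j) * of_real t ^ j)"
      using t u by (simp add: upper_Gamma_closed_form [OF k] incexp_def power_mult_distrib p_def mult_ac)
    moreover have "of_real (exp (- (2 * u * t))) * exp (- (- of_real u + w) * of_real t) = exp (- (v * of_real t))"
      by (simp add: exp_of_real [symmetric] v_def exp_add [symmetric] algebra_simps)
    moreover have "complex_of_real t powr of_nat m = of_real t ^ m" using t by (simp add: powr_nat')
    ultimately show "of_real (upper_Gamma (1 - of_int k) (2 * u * t)) * exp (- (- of_real u + w) * of_real t) * of_real t powr of_nat m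
       = (\<Sum>j\<le>p. of_real (fact p / fact j * (2 * u) ^ j) * (of_real t ^ (j + m) * exp (- (v * of_real t))))"
      by (simp add: sum_distrib_left sum_distrib_right power_add mult_ac flip: \<open>of_real (exp (- (2 * u * t))) * exp (- (- of_real u + w) * of_real t) = exp (- (v * of_real t))\<close>)
  qed
  then show ?thesis
    using I by (simp add: p_def integral_unique)
qed

text \<open>Integration by parts in \<open>\<integral>\<^sub>1\<^sup>\<infinity> \<Gamma>(p + 1, 2 u t) e\<^sup>u\<^sup>t t\<^sup>m dt\<close>, the factor \<open>e\<^sup>u\<^sup>t t\<^sup>m\<close> being the one that is
  integrated. It is carried out on antiderivatives: with \<open>t\<close> in place of the lower limit \<open>1\<close>, the difference \<open>\<Psi>(t)\<close>
  of the two sides has derivative zero and tends to \<open>0\<close> at infinity.\<close>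

lemma incgamma_moment_by_parts_real:
  fixes u :: real
  assumes u: "u > 0"
  shows "(\<Sum>j\<le>p. fact p / fact j * (2 * u) ^ j * (exp (- u) * incexp (j + m) u 1))
      - (exp (- (2 * u)) * incexp p 1 (2 * u)) * (exp u * incexp m (- u) 1)
    = - ((2 * u) ^ (p + 1) * (\<Sum>l\<le>m. fact m / (fact l * (- u) ^ (m - l + 1)) * (exp (- u) * incexp (l + p) u 1)))"
proof -
  \<comment> \<open>\<open>A\<close> stands for the moment over \<open>[t, \<infinity>)\<close>, \<open>B\<close> for \<open>\<Gamma>(p + 1, 2 u t)\<close>, \<open>C\<close> for the continued exponential
    integral at \<open>- u\<close>, and \<open>D\<close> for the sum on the right\<close>
  define A where "A t = (\<Sum>j\<le>p. fact p / fact j * (2 * u) ^ j * (exp (- (u * t)) * incexp (j + m) u t))" for t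
  define B where "B t = (exp (- (1 * (2 * u * t))) * incexp p 1 (2 * u * t))" for t
  define C where "C t = exp (- (- u * t)) * incexp m (- u) t" for t
  define D where "D t = (\<Sum>l\<le>m. fact m / (fact l * (- u) ^ (m - l + 1)) * (exp (- (u * t)) * incexp (l + p) u t))" for t
  define \<Psi> where "\<Psi> t = A t - B t * C t + (2 * u) ^ (p + 1) * D t" for t
  have A': "(A has_real_derivative (\<Sum>j\<le>p. fact p / fact j * (2 * u) ^ j * - (t ^ (j + m) * exp (- (u * t))))) (at t)" for t
    unfolding A_def [abs_def] using u
    by (intro DERIV_sum DERIV_cmult exp_incexp_has_field_derivative) auto
  have D': "(D has_real_derivative (\<Sum>l\<le>m. fact m / (fact l * (- u) ^ (m - l + 1)) * - (t ^ (l + p) * exp (- (u * t))))) (at t)" for t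
    unfolding D_def [abs_def] using u
    by (intro DERIV_sum DERIV_cmult exp_incexp_has_field_derivative) auto
  have B': "(B has_real_derivative - ((2 * u * t) ^ p * exp (- (1 * (2 * u * t)))) * (2 * u)) (at t)" for t
    unfolding B_def [abs_def]
    by (rule DERIV_chain2 [OF exp_incexp_has_field_derivative]) (auto intro!: derivative_eq_intros)
  have C': "(C has_real_derivative - (t ^ m * exp (- (- u * t)))) (at t)" for t
    unfolding C_def [abs_def] using u by (intro exp_incexp_has_field_derivative) auto
  have "(\<Psi> has_real_derivative 0) (at t)" for t
  proof -
    have eu: "exp (- (1 * (2 * u * t))) * exp (- (- u * t)) = exp (- (u * t))"
      by (simp add: exp_add [symmetric])
    have h1: "B t * (t ^ m * exp (- (- u * t))) = (\<Sum>j\<le>p. fact p / fact j * (2 * u) ^ j * (t ^ (j + m) * exp (- (u * t))))"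
      unfolding B_def incexp_def eu [symmetric]
      by (simp add: sum_distrib_left sum_distrib_right power_add power_mult_distrib mult_ac)
    have h2: "((2 * u * t) ^ p * exp (- (1 * (2 * u * t)))) * (2 * u) * C t =
      (2 * u) ^ (p + 1) * (\<Sum>l\<le>m. fact m / (fact l * (- u) ^ (m - l + 1)) * (t ^ (l + p) * exp (- (u * t))))" (is "?c = ?d * ?S")
      unfolding C_def incexp_def eu [symmetric]
      by (simp add: sum_distrib_left sum_distrib_right power_add power_mult_distrib mult_ac)
    have "(\<Sum>j\<le>p. fact p / fact j * (2 * u) ^ j * - (t ^ (j + m) * exp (- (u * t)))) -
       (- ((2 * u * t) ^ p * exp (- (1 * (2 * u * t)))) * (2 * u) * C t + - (t ^ m * exp (- (- u * t))) * B t) +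
       (2 * u) ^ (p + 1) * (\<Sum>l\<le>m. fact m / (fact l * (- u) ^ (m - l + 1)) * - (t ^ (l + p) * exp (- (u * t)))) = 0"
      unfolding mult_minus_right mult_minus_left sum_negf h1 [unfolded mult_minus_left, symmetric] h2 [symmetric] by (simp only: mult.commute [of "B t"])
    then show ?thesis
      using DERIV_add [OF DERIV_diff [OF A' [of t] DERIV_mult [OF B' [of t] C' [of t]]] DERIV_cmult [OF D' [of t], of "(2 * u) ^ (p + 1)"]]
      unfolding \<Psi>_def [abs_def] by (simp only:)
  qed
  then have const: "\<Psi> s = \<Psi> t" for s t
    using DERIV_isconst_all by blast
  note lim0 = exp_incexp_tendsto_0 [OF u]
  have "(A \<longlongrightarrow> (\<Sum>j\<le>p. fact p / fact j * (2 * u) ^ j * 0)) at_top"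
    unfolding A_def [abs_def] by (intro tendsto_intros lim0)
  moreover have "(D \<longlongrightarrow> (\<Sum>l\<le>m. fact m / (fact l * (- u) ^ (m - l + 1)) * 0)) at_top"
    unfolding D_def [abs_def] by (intro tendsto_intros lim0)
  \<comment> \<open>here \<open>C\<close> grows like \<open>e\<^sup>u\<^sup>t\<close>, but \<open>B\<close> decays like \<open>e\<^sup>-\<^sup>2\<^sup>u\<^sup>t\<close>\<close>
  moreover have "((\<lambda>t. B t * C t) \<longlongrightarrow> 0) at_top"
  proof -
    have "((\<lambda>t. \<Sum>j\<le>p. \<Sum>l\<le>m. fact p / fact j * (2 * u) ^ j * (fact m / (fact l * (- u) ^ (m - l + 1))) * (t ^ (j + l) * exp (- (u * t)))) \<longlongrightarrow>
        (\<Sum>j\<le>p. \<Sum>l\<le>m. fact p / fact j * (2 * u) ^ j * (fact m / (fact l * (- u) ^ (m - l + 1))) * 0)) at_top"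
      by (intro tendsto_intros power_times_exp_tendsto_0 u)
    moreover have "B t * C t = (\<Sum>j\<le>p. \<Sum>l\<le>m. fact p / fact j * (2 * u) ^ j * (fact m / (fact l * (- u) ^ (m - l + 1))) * (t ^ (j + l) * exp (- (u * t))))" for t
    proof -
      have "B t * C t = exp (- (u * t)) * (incexp p 1 (2 * u * t) * incexp m (- u) t)"
        by (simp add: B_def C_def mult_ac exp_add [symmetric])
      also have "incexp p 1 (2 * u * t) * incexp m (- u) t =
        (\<Sum>j\<le>p. \<Sum>l\<le>m. (fact p / (fact j * 1 ^ (p - j + 1)) * (2 * u * t) ^ j) * (fact m / (fact l * (- u) ^ (m - l + 1)) * t ^ l))"
        by (simp only: incexp_def sum_product)
      finally show ?thesis
        by (simp add: sum_distrib_left power_add power_mult_distrib mult_ac)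
    qed
    ultimately show ?thesis by simp
  qed
  ultimately have "(\<Psi> \<longlongrightarrow> (\<Sum>j\<le>p. fact p / fact j * (2 * u) ^ j * 0) - 0 + (2 * u) ^ (p + 1) * (\<Sum>l\<le>m. fact m / (fact l * (- u) ^ (m - l + 1)) * 0)) at_top"
    unfolding \<Psi>_def [abs_def] by (intro tendsto_intros)
  then have "(\<Psi> \<longlongrightarrow> 0) at_top" by simp
  moreover have "\<Psi> = (\<lambda>t. \<Psi> 1)" using const by auto
  ultimately have "\<Psi> 1 = 0"
    by (metis tendsto_const tendsto_unique trivial_limit_at_top_linorder)
  then show ?thesis
    by (simp add: \<Psi>_def A_def B_def C_def D_def)
qed

section \<open>Interchanging infinite sums with limits and integrals\<close>

text \<open>By the Weierstrass M-test the partial sums converge uniformly in \<open>x\<close>, so the two limits commute.\<close>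

lemma tendsto_infsum_dominated:
  fixes h :: "'a \<Rightarrow> 'b \<Rightarrow> complex"
  assumes lim: "\<And>n. n \<in> A \<Longrightarrow> (h n \<longlongrightarrow> l n) F"
    and S: "eventually (\<lambda>x. x \<in> S) F"
    and bound: "\<And>n x. n \<in> A \<Longrightarrow> x \<in> S \<Longrightarrow> norm (h n x) \<le> M n"
    and M: "M summable_on A" and F: "F \<noteq> bot"
  shows "((\<lambda>x. \<Sum>\<^sub>\<infinity>n\<in>A. h n x) \<longlongrightarrow> (\<Sum>\<^sub>\<infinity>n\<in>A. l n)) F"
proof -
  have lb: "norm (l n) \<le> M n" if "n \<in> A" for n
  proof (rule tendsto_upperbound [OF tendsto_norm [OF lim [OF that]] _ F])
    show "eventually (\<lambda>x. norm (h n x) \<le> M n) F"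
      using S by eventually_elim (use bound that in auto)
  qed
  have "l summable_on A"
    by (rule Infinite_Sum.abs_summable_summable, rule Infinite_Sum.abs_summable_on_comparison_test' [OF M lb])
  then have "((\<lambda>X. \<Sum>n\<in>X. l n) \<longlongrightarrow> (\<Sum>\<^sub>\<infinity>n\<in>A. l n)) (finite_subsets_at_top A)"
    using has_sum_infsum unfolding has_sum_def by blast
  moreover have "uniform_limit S (\<lambda>X x. \<Sum>n\<in>X. h n x) (\<lambda>x. \<Sum>\<^sub>\<infinity>n\<in>A. h n x) (finite_subsets_at_top A)"
    by (rule Weierstrass_m_test_general [OF bound M])
  moreover have "\<forall>\<^sub>F X in finite_subsets_at_top A. ((\<lambda>x. \<Sum>n\<in>X. h n x) \<longlongrightarrow> (\<Sum>n\<in>X. l n)) F"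
    by (rule eventually_finite_subsets_at_top_weakI) (intro tendsto_sum lim, blast)
  ultimately show ?thesis
    using swap_uniform_limit' [of "\<lambda>X x. \<Sum>n\<in>X. h n x" "\<lambda>X. \<Sum>n\<in>X. l n" F "finite_subsets_at_top A"] S by simp
qed

lemma has_sum_integral:
  fixes \<phi> :: "'a \<Rightarrow> real \<Rightarrow> complex"
  assumes cont: "\<And>n. continuous_on {a..b} (\<phi> n)"
    and bound: "\<And>n t. n \<in> A \<Longrightarrow> t \<in> {a..b} \<Longrightarrow> norm (\<phi> n t) \<le> M n"
    and M: "M summable_on A"
    and s: "\<And>t. t \<in> {a..b} \<Longrightarrow> ((\<lambda>n. \<phi> n t) has_sum s t) A"
  shows "((\<lambda>n. integral {a..b} (\<phi> n)) has_sum integral {a..b} s) A"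
proof -
  have "uniform_limit {a..b} (\<lambda>X t. \<Sum>n\<in>X. \<phi> n t) s (finite_subsets_at_top A)"
    by (rule Weierstrass_m_test_general' [OF bound s M])
  moreover have "continuous_on {a..b} (\<lambda>t. \<Sum>n\<in>X. \<phi> n t)" for X
    by (intro continuous_on_sum cont)
  ultimately obtain I J where I: "\<And>X. ((\<lambda>t. \<Sum>n\<in>X. \<phi> n t) has_integral I X) {a..b}"
    and J: "(s has_integral J) {a..b}" and lim: "(I \<longlongrightarrow> J) (finite_subsets_at_top A)"
    by (rule uniform_limit_integral) auto
  have "I X = (\<Sum>n\<in>X. integral {a..b} (\<phi> n))" if "finite X" for X
    using I [of X] integral_sum [of X \<phi> "{a..b}"] that cont
    by (metis integrable_continuous_real integral_unique)
  then have "eventually (\<lambda>X. I X = (\<Sum>n\<in>X. integral {a..b} (\<phi> n))) (finite_subsets_at_top A)"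
    by (intro eventually_finite_subsets_at_top_weakI) auto
  with lim have "((\<lambda>X. \<Sum>n\<in>X. integral {a..b} (\<phi> n)) \<longlongrightarrow> J) (finite_subsets_at_top A)"
    by (rule Lim_transform_eventually)
  with J show ?thesis by (simp add: has_sum_def integral_unique)
qed

section \<open>Fourier coefficients on horizontal lines\<close>

lemma Complex_in_upper [simp]: "Complex t y \<in> \<H> \<longleftrightarrow> y > 0"
  by (simp add: upper_half_plane_def)

lemma open_upper_half_plane: "open \<H>"
  unfolding upper_half_plane_def by (rule open_halfspace_Im_gt)

lemma ee_Complex: "ee n (Complex t y) = of_real (exp (- 2 * pi * of_int n * y)) * ee n (of_real t)"
proof -
  have "Complex t y = of_real t + \<i> * of_real y" by (simp add: complex_eq_iff)
  then have "ee n (Complex t y) = ee n (of_real t) * ee n (\<i> * of_real y)"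
    by (simp only: ee_add)
  also have "ee n (\<i> * of_real y) = of_real (exp (- 2 * pi * of_int n * y))"
    unfolding ee_def exp_of_real [symmetric] by (simp add: algebra_simps)
  finally show ?thesis by (simp add: mult.commute)
qed

text \<open>Real continuous differentiability with the partial derivatives as explicit data. It is all that
  \<open>\<xi>\<^sub>k\<close> and the Fourier coefficients require, and it is inherited by holomorphic substitutions and factors.\<close>

definition has_partials :: "(complex \<Rightarrow> complex) \<Rightarrow> (complex \<Rightarrow> complex) \<Rightarrow> (complex \<Rightarrow> complex) \<Rightarrow> bool"
  where "has_partials F Fx Fy \<longleftrightarrow>
    continuous_on \<H> Fx \<and> continuous_on \<H> Fy \<and>
    (\<forall>z\<in>\<H>. (F has_derivative (\<lambda>v. of_real (Re v) * Fx z + of_real (Im v) * Fy z)) (at z))"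

lemma has_partialsD:
  assumes "has_partials F Fx Fy" "z \<in> \<H>"
  shows "(F has_derivative (\<lambda>v. of_real (Re v) * Fx z + of_real (Im v) * Fy z)) (at z)"
  using assms by (simp add: has_partials_def)

lemma has_partials_continuous:
  assumes "has_partials F Fx Fy"
  shows "continuous_on \<H> F" "continuous_on \<H> Fx" "continuous_on \<H> Fy"
  using assms has_derivative_continuous continuous_at_imp_continuous_on
  unfolding has_partials_def by blast+

lemma has_partials_d_dzbar:
  assumes "has_partials F Fx Fy" "z \<in> \<H>"
  shows "d_dzbar F z = (Fx z + \<i> * Fy z) / 2"
proof -
  have "frechet_derivative F (at z) = (\<lambda>v. of_real (Re v) * Fx z + of_real (Im v) * Fy z)"
    using frechet_derivative_at [OF has_partialsD [OF assms]] by simp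
  then show ?thesis by (simp add: d_dzbar_def)
qed

lemma has_partials_horizontal:
  assumes "has_partials F Fx Fy" "y > 0"
  shows "((\<lambda>t. F (Complex t y)) has_vector_derivative Fx (Complex t y)) (at t within S)"
proof -
  have "((\<lambda>t. Complex t y) has_derivative (\<lambda>s. of_real s)) (at t within S)"
    unfolding Complex_eq by (auto intro!: derivative_eq_intros)
  then have "((\<lambda>t. F (Complex t y)) has_derivative
      (\<lambda>s. of_real (Re (of_real s)) * Fx (Complex t y) + of_real (Im (of_real s)) * Fy (Complex t y))) (at t within S)"
    by (rule has_derivative_compose) (use assms in \<open>auto intro: has_partialsD\<close>)
  then show ?thesis
    by (simp add: has_vector_derivative_def scaleR_conv_of_real)
qed

lemma has_partials_vertical:
  assumes "has_partials F Fx Fy" "y > 0"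
  shows "((\<lambda>y. F (Complex t y)) has_vector_derivative Fy (Complex t y)) (at y within S)"
proof -
  have "((\<lambda>y. Complex t y) has_derivative (\<lambda>s. \<i> * of_real s)) (at y within S)"
    unfolding Complex_eq by (auto intro!: derivative_eq_intros)
  then have "((\<lambda>y. F (Complex t y)) has_derivative
      (\<lambda>s. of_real (Re (\<i> * of_real s)) * Fx (Complex t y) + of_real (Im (\<i> * of_real s)) * Fy (Complex t y))) (at y within S)"
    by (rule has_derivative_compose) (use assms in \<open>auto intro: has_partialsD\<close>)
  then show ?thesis
    by (simp add: has_vector_derivative_def scaleR_conv_of_real)
qed

lemma has_partials_holomorphic:
  assumes "G holomorphic_on \<H>"
  shows "has_partials G (deriv G) (\<lambda>z. \<i> * deriv G z)"
  unfolding has_partials_def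
proof (intro conjI ballI)
  have "deriv G holomorphic_on \<H>"
    by (intro holomorphic_deriv assms open_upper_half_plane)
  then have *: "continuous_on \<H> (deriv G)"
    by (rule holomorphic_on_imp_continuous_on)
  then show "continuous_on \<H> (deriv G)" .
  show "continuous_on \<H> (\<lambda>z. \<i> * deriv G z)"
    by (intro continuous_intros *)
  fix z assume "z \<in> \<H>"
  then have "(G has_field_derivative deriv G z) (at z)"
    using assms open_upper_half_plane holomorphic_derivI by blast
  moreover have "(\<lambda>v. of_real (Re v) * deriv G z + of_real (Im v) * (\<i> * deriv G z)) = (*) (deriv G z)"
  proof
    fix v :: complex
    have "v = of_real (Re v) + of_real (Im v) * \<i>"
      by (simp add: complex_eq_iff)
    then show "of_real (Re v) * deriv G z + of_real (Im v) * (\<i> * deriv G z) = deriv G z * v"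
      by (metis distrib_left mult.assoc mult.commute)
  qed
  ultimately show "(G has_derivative (\<lambda>v. of_real (Re v) * deriv G z + of_real (Im v) * (\<i> * deriv G z))) (at z)"
    by (simp add: has_field_derivative_def)
qed

definition fourier_at :: "(complex \<Rightarrow> complex) \<Rightarrow> int \<Rightarrow> real \<Rightarrow> complex"
  where "fourier_at F n y = fcoeff (\<lambda>t. F (Complex t y)) n"

lemma continuous_on_horizontal:
  assumes "continuous_on \<H> F" "y > 0"
  shows "continuous_on S (\<lambda>t. F (Complex t y))"
  by (rule continuous_on_compose2 [OF assms(1)]) (use assms(2) in \<open>auto intro!: continuous_intros simp: Complex_eq upper_half_plane_def\<close>)

lemma fourier_at_has_vector_derivative:
  assumes F: "has_partials F Fx Fy" and y: "y > 0"
  shows "(fourier_at F n has_vector_derivative fourier_at Fy n y) (at y)"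
proof -
  have "((\<lambda>y. integral (cbox 0 1) (\<lambda>t. F (Complex t y) * ee (- n) (of_real t))) has_vector_derivative
      integral (cbox 0 1) (\<lambda>t. Fy (Complex t y) * ee (- n) (of_real t))) (at y within {0<..})"
  proof (rule leibniz_rule_vector_derivative)
    fix y t :: real assume "y \<in> {0<..}"
    then show "((\<lambda>y. F (Complex t y) * ee (- n) (of_real t)) has_vector_derivative Fy (Complex t y) * ee (- n) (of_real t)) (at y within {0<..})"
      by (intro has_vector_derivative_mult_left has_partials_vertical [OF F]) simp
  next
    fix y :: real assume "y \<in> {0<..}"
    then show "(\<lambda>t. F (Complex t y) * ee (- n) (of_real t)) integrable_on cbox 0 1"
      unfolding cbox_interval
      by (intro integrable_continuous_real continuous_intros continuous_on_horizontal has_partials_continuous(1) [OF F]) simp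
  next
    have "continuous_on ({0<..} \<times> cbox 0 1) (\<lambda>p. Fy (Complex (snd p) (fst p)))"
      by (rule continuous_on_compose2 [OF has_partials_continuous(3) [OF F]])
         (auto intro!: continuous_intros simp: Complex_eq upper_half_plane_def)
    then show "continuous_on ({0<..} \<times> cbox 0 1) (\<lambda>(y, t). Fy (Complex t y) * ee (- n) (of_real t))"
      unfolding split_beta by (intro continuous_intros)
  qed (use y in auto)
  then show ?thesis
    using y by (simp add: fourier_at_def [abs_def] fcoeff_def cbox_interval at_within_open [of _ "{0<..}"])
qed

text \<open>Integration by parts in \<open>x\<close>; the boundary terms cancel by periodicity.\<close>

lemma fourier_at_horizontal:
  assumes F: "has_partials F Fx Fy" and y: "y > 0"
    and per: "\<And>z. z \<in> \<H> \<Longrightarrow> F (z + 1) = F z"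
  shows "fourier_at Fx n y = 2 * of_real pi * \<i> * of_int n * fourier_at F n y"
proof -
  let ?c = "2 * of_real pi * \<i> * of_int (- n) :: complex"
  have cont: "continuous_on {0..1} (\<lambda>t. F (Complex t y))" "continuous_on {0..1} (\<lambda>t. Fx (Complex t y))"
    by (intro continuous_on_horizontal has_partials_continuous [OF F] y)+
  have "((\<lambda>t. F (Complex t y) * (?c * ee (- n) (of_real t)) + Fx (Complex t y) * ee (- n) (of_real t)) has_integral
      (F (Complex 1 y) * ee (- n) (of_real 1) - F (Complex 0 y) * ee (- n) (of_real 0))) {0..1}"
    by (intro fundamental_theorem_of_calculus has_vector_derivative_mult has_partials_horizontal [OF F y] ee_has_vector_derivative) simp
  moreover have "((\<lambda>t. ?c * (F (Complex t y) * ee (- n) (of_real t)) + Fx (Complex t y) * ee (- n) (of_real t)) has_integral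
      (?c * fourier_at F n y + fourier_at Fx n y)) {0..1}"
    unfolding fourier_at_def
    by (intro has_integral_add has_integral_mult_right fcoeff_has_integral cont)
  ultimately have "?c * fourier_at F n y + fourier_at Fx n y = F (Complex 1 y) - F (Complex 0 y)"
    by (simp add: has_integral_unique mult_ac)
  also have "F (Complex 1 y) = F (Complex 0 y)"
    using per [of "Complex 0 y"] y by (simp add: plus_complex.ctr one_complex.ctr)
  finally show ?thesis by (simp add: algebra_simps eq_neg_iff_add_eq_0)
qed

lemma fourier_at_bounded:
  assumes "continuous_on \<H> F" "y > 0"
  obtains M where "\<And>n. norm (fourier_at F n y) \<le> M"
proof -
  have cont: "continuous_on {0..1} (\<lambda>t. F (Complex t y))"
    by (rule continuous_on_horizontal [OF assms])
  then have "compact ((\<lambda>t. F (Complex t y)) ` {0..1})"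
    by (intro compact_continuous_image) auto
  then have "bounded ((\<lambda>t. F (Complex t y)) ` {0..1})"
    by (rule compact_imp_bounded)
  then obtain M where "\<forall>x\<in>(\<lambda>t. F (Complex t y)) ` {0..1}. norm x \<le> M"
    unfolding bounded_iff by blast
  then have "\<And>t. t \<in> {0..1} \<Longrightarrow> norm (F (Complex t y)) \<le> M"
    by blast
  then show thesis
    by (intro that [of M]) (auto simp: fourier_at_def intro: norm_fcoeff_le [OF cont])
qed

lemma exp_has_vector_derivative:
  "((\<lambda>y. complex_of_real (exp (c * y))) has_vector_derivative of_real (c * exp (c * y))) (at y within S)"
proof -
  have "((\<lambda>y. exp (c * y)) has_vector_derivative c * exp (c * y)) (at y within S)"
    unfolding has_real_derivative_iff_has_vector_derivative [symmetric]
    by (auto intro!: derivative_eq_intros)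
  then show ?thesis
    by (rule bounded_linear.has_vector_derivative [OF bounded_linear_of_real])
qed

text \<open>For holomorphic \<open>G\<close> we have \<open>\<partial>G/\<partial>y = i \<partial>G/\<partial>x\<close>, so the \<open>n\<close>-th coefficient solves \<open>c' = - 2 \<pi> n c\<close>.\<close>

lemma fourier_at_holomorphic:
  assumes G: "G holomorphic_on \<H>"
    and per: "\<And>z. z \<in> \<H> \<Longrightarrow> G (z + 1) = G z"
  obtains g where "\<And>n y. y > 0 \<Longrightarrow> fourier_at G n y = g n * of_real (exp (- 2 * pi * of_int n * y))"
proof -
  note part = has_partials_holomorphic [OF G]
  have "\<exists>c. \<forall>y\<in>{0<..}. of_real (exp (2 * pi * of_int n * y)) * fourier_at G n y = c" for n
  proof (rule has_vector_derivative_zero_constant)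
    fix y :: real assume "y \<in> {0<..}"
    then have y: "y > 0" by simp
    have Gy: "fourier_at (\<lambda>z. \<i> * deriv G z) n y = - 2 * of_real pi * of_int n * fourier_at G n y"
    proof -
      have "fourier_at (\<lambda>z. \<i> * deriv G z) n y = \<i> * fourier_at (deriv G) n y"
        by (simp add: fourier_at_def fcoeff_def mult.assoc)
      also have "fourier_at (deriv G) n y = 2 * of_real pi * \<i> * of_int n * fourier_at G n y"
        by (rule fourier_at_horizontal [OF part y]) (rule per)
      also have "\<i> * (2 * of_real pi * \<i> * of_int n * fourier_at G n y) =
          (\<i> * \<i>) * (2 * of_real pi * of_int n * fourier_at G n y)"
        by (simp only: mult_ac)
      finally show ?thesis by simp
    qed
    have "((\<lambda>y. of_real (exp (2 * pi * of_int n * y)) * fourier_at G n y) has_vector_derivative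
        (of_real (exp (2 * pi * of_int n * y)) * fourier_at (\<lambda>z. \<i> * deriv G z) n y +
         of_real ((2 * pi * of_int n) * exp (2 * pi * of_int n * y)) * fourier_at G n y)) (at y)"
      by (rule has_vector_derivative_mult [OF exp_has_vector_derivative fourier_at_has_vector_derivative [OF part y]])
    then have "((\<lambda>y. of_real (exp (2 * pi * of_int n * y)) * fourier_at G n y) has_vector_derivative 0) (at y)"
      by (simp add: Gy)
    then show "((\<lambda>y. of_real (exp (2 * pi * of_int n * y)) * fourier_at G n y) has_vector_derivative 0) (at y within {0<..})"
      by (rule has_vector_derivative_at_within)
  qed auto
  then have "\<exists>g. \<forall>n. \<forall>y\<in>{0<..}. of_real (exp (2 * pi * of_int n * y)) * fourier_at G n y = g n"
    by (intro choice allI)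
  then obtain g where g: "\<And>n y. y > 0 \<Longrightarrow> of_real (exp (2 * pi * of_int n * y)) * fourier_at G n y = g n"
    by auto
  show thesis
  proof (rule that)
    fix n :: int and y :: real assume "y > 0"
    then have "g n * of_real (exp (- 2 * pi * of_int n * y)) =
      of_real (exp (2 * pi * of_int n * y) * exp (- 2 * pi * of_int n * y)) * fourier_at G n y"
      by (simp flip: g)
    then show "fourier_at G n y = g n * of_real (exp (- 2 * pi * of_int n * y))"
      by (simp add: exp_add [symmetric])
  qed
qed

lemma has_partials_periodic:
  assumes F: "has_partials F Fx Fy" and per: "\<And>z. z \<in> \<H> \<Longrightarrow> F (z + 1) = F z"
    and z: "z \<in> \<H>"
  shows "Fx (z + 1) = Fx z" "Fy (z + 1) = Fy z"
proof -
  have z1: "z + 1 \<in> \<H>" using z by (simp add: upper_half_plane_def)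
  have "((\<lambda>z. z + 1) has_derivative (\<lambda>v. v)) (at z)"
    by (auto intro!: derivative_eq_intros)
  then have "((\<lambda>z. F (z + 1)) has_derivative (\<lambda>v. of_real (Re v) * Fx (z + 1) + of_real (Im v) * Fy (z + 1))) (at z)"
    by (rule has_derivative_compose) (rule has_partialsD [OF F z1])
  then have "(F has_derivative (\<lambda>v. of_real (Re v) * Fx (z + 1) + of_real (Im v) * Fy (z + 1))) (at z)"
    by (rule has_derivative_transform_within_open [OF _ open_upper_half_plane z]) (use per in auto)
  then have eq: "(\<lambda>v. of_real (Re v) * Fx (z + 1) + of_real (Im v) * Fy (z + 1)) = (\<lambda>v. of_real (Re v) * Fx z + of_real (Im v) * Fy z)"
    by (rule has_derivative_unique) (rule has_partialsD [OF F z])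
  show "Fx (z + 1) = Fx z" using fun_cong [OF eq, of 1] by simp
  show "Fy (z + 1) = Fy z" using fun_cong [OF eq, of \<i>] by simp
qed

lemma xi_op_periodic:
  assumes F: "has_partials F Fx Fy" and per: "\<And>z. z \<in> \<H> \<Longrightarrow> F (z + 1) = F z"
    and z: "z \<in> \<H>"
  shows "xi_op k F (z + 1) = xi_op k F z"
proof -
  have z1: "z + 1 \<in> \<H>" using z by (simp add: upper_half_plane_def)
  show ?thesis
    using has_partials_periodic [OF F per z]
    by (simp add: xi_op_def has_partials_d_dzbar [OF F z] has_partials_d_dzbar [OF F z1])
qed

text \<open>The equation is the definition of \<open>\<xi>\<^sub>k\<close> read off on Fourier coefficients. The complex conjugation in \<open>\<xi>\<^sub>k\<close>
  exchanges the indices \<open>n\<close> and \<open>- n\<close>, so the \<open>n\<close>-th coefficient of \<open>F\<close> is driven by the coefficient of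
  \<open>\<xi>\<^sub>k F\<close> at \<open>- n\<close>.\<close>

lemma fourier_at_ode:
  assumes F: "has_partials F Fx Fy" and per: "\<And>z. z \<in> \<H> \<Longrightarrow> F (z + 1) = F z"
    and g: "\<And>n y. y > 0 \<Longrightarrow> fourier_at (xi_op k F) n y = g n * of_real (exp (- 2 * pi * of_int n * y))"
    and y: "y > 0"
  shows "((\<lambda>y. of_real (exp (2 * pi * of_int n * y)) * fourier_at F n y) has_vector_derivative
     of_real (y powi (- k) * exp (4 * pi * of_int n * y)) * cnj (g (- n))) (at y)"
proof -
  let ?W = "fourier_at (d_dzbar F)"
  have cont: "continuous_on {0..1} (\<lambda>t. Fx (Complex t y))" "continuous_on {0..1} (\<lambda>t. Fy (Complex t y))"
    by (intro continuous_on_horizontal has_partials_continuous [OF F] y)+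
  have "((\<lambda>t. (Fx (Complex t y) * ee (- n) (of_real t) + \<i> * (Fy (Complex t y) * ee (- n) (of_real t))) / 2) has_integral
      (fourier_at Fx n y + \<i> * fourier_at Fy n y) / 2) {0..1}"
    unfolding fourier_at_def
    by (intro has_integral_divide has_integral_add has_integral_mult_right fcoeff_has_integral cont)
  then have "((\<lambda>t. d_dzbar F (Complex t y) * ee (- n) (of_real t)) has_integral
      (fourier_at Fx n y + \<i> * fourier_at Fy n y) / 2) {0..1}"
    using y by (simp add: has_partials_d_dzbar [OF F] algebra_simps add_divide_distrib)
  then have "((\<lambda>t. (2 * \<i> * of_real y powi k) * cnj (d_dzbar F (Complex t y) * ee (- n) (of_real t))) has_integral
      (2 * \<i> * of_real y powi k) * cnj ((fourier_at Fx n y + \<i> * fourier_at Fy n y) / 2)) {0..1}"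
    by (intro has_integral_mult_right has_integral_cnj [THEN iffD2, unfolded o_def])
  then have "((\<lambda>t. xi_op k F (Complex t y) * ee (- (- n)) (of_real t)) has_integral
      (2 * \<i> * of_real y powi k) * cnj ((fourier_at Fx n y + \<i> * fourier_at Fy n y) / 2)) {0..1}"
    by (simp add: xi_op_def cnj_ee_of_real mult.assoc del: cnj_ee)
  then have "fourier_at (xi_op k F) (- n) y = (2 * \<i> * of_real y powi k) * cnj ((fourier_at Fx n y + \<i> * fourier_at Fy n y) / 2)"
    by (simp add: fourier_at_def fcoeff_def integral_unique)
  also have "fourier_at (xi_op k F) (- n) y = g (- n) * of_real (exp (2 * pi * of_int n * y))"
    using g [OF y, of "- n"] by simp
  finally have "cnj (g (- n) * of_real (exp (2 * pi * of_int n * y))) =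
      cnj ((2 * \<i> * of_real y powi k) * cnj ((fourier_at Fx n y + \<i> * fourier_at Fy n y) / 2))"
    by (rule arg_cong)
  then have "cnj (g (- n)) * of_real (exp (2 * pi * of_int n * y)) =
      - (\<i> * of_real y powi k) * (fourier_at Fx n y + \<i> * fourier_at Fy n y)"
    by simp
  also have "\<dots> = of_real y powi k * (2 * of_real pi * of_int n * fourier_at F n y + fourier_at Fy n y)"
    using fourier_at_horizontal [OF F y per, of n] by (simp add: algebra_simps)
  finally have eq: "of_real y powi k * (2 * of_real pi * of_int n * fourier_at F n y + fourier_at Fy n y) =
      cnj (g (- n)) * of_real (exp (2 * pi * of_int n * y))" by simp
  have "((\<lambda>y. of_real (exp (2 * pi * of_int n * y)) * fourier_at F n y) has_vector_derivative
        (of_real (exp (2 * pi * of_int n * y)) * fourier_at Fy n y +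
         of_real ((2 * pi * of_int n) * exp (2 * pi * of_int n * y)) * fourier_at F n y)) (at y)"
    by (rule has_vector_derivative_mult [OF exp_has_vector_derivative fourier_at_has_vector_derivative [OF F y]])
  moreover have "of_real (exp (2 * pi * of_int n * y)) * fourier_at Fy n y +
         of_real ((2 * pi * of_int n) * exp (2 * pi * of_int n * y)) * fourier_at F n y =
       of_real (y powi (- k) * exp (4 * pi * of_int n * y)) * cnj (g (- n))"
  proof -
    have "of_real (exp (2 * pi * of_int n * y)) * fourier_at Fy n y +
         of_real ((2 * pi * of_int n) * exp (2 * pi * of_int n * y)) * fourier_at F n y =
       of_real (exp (2 * pi * of_int n * y)) * (2 * of_real pi * of_int n * fourier_at F n y + fourier_at Fy n y)"
      by (simp add: algebra_simps)
    also have "2 * of_real pi * of_int n * fourier_at F n y + fourier_at Fy n y =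
      of_real (y powi (- k)) * (of_real y powi k * (2 * of_real pi * of_int n * fourier_at F n y + fourier_at Fy n y))"
      using y by (simp add: power_int_minus)
    also have "of_real (exp (2 * pi * of_int n * y)) * (of_real (y powi (- k)) * (of_real y powi k * (2 * of_real pi * of_int n * fourier_at F n y + fourier_at Fy n y)))
      = of_real (y powi (- k) * (exp (2 * pi * of_int n * y) * exp (2 * pi * of_int n * y))) * cnj (g (- n))"
      unfolding eq by (simp add: mult_ac)
    also have "exp (2 * pi * of_int n * y) * exp (2 * pi * of_int n * y) = exp (4 * pi * of_int n * y)"
      by (simp add: exp_add [symmetric])
    finally show ?thesis .
  qed
  ultimately show ?thesis by simp
qed

text \<open>A lower bound that does not depend on the sign of the exponent.\<close>

lemma powi_lower_bound:
  assumes "1 \<le> (t::real)" "t \<le> s"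
  shows "inverse (s ^ nat \<bar>k\<bar>) \<le> t powi k"
proof (cases "k \<ge> 0")
  case True
  have "inverse (s ^ nat \<bar>k\<bar>) \<le> 1" using assms by (intro inverse_le_1_iff [THEN iffD2]) (auto intro: one_le_power)
  also have "1 \<le> t powi k" using assms True by (simp add: power_int_def one_le_power)
  finally show ?thesis .
next
  case False
  then show ?thesis
    using assms by (auto simp: power_int_def power_inverse intro!: le_imp_inverse_le power_mono)
qed

text \<open>Let \<open>\<phi>(y) = e\<^sup>2\<^sup>\<pi>\<^sup>n\<^sup>y c\<^sub>n(y)\<close> for the \<open>n\<close>-th coefficient \<open>c\<^sub>n\<close> of \<open>F\<close>. By the differential equation \<open>\<phi>\<close>
  grows over \<open>[s - 1, s]\<close> by at least a constant times \<open>\<bar>g(- n)\<bar> s\<^sup>-\<^sup>q e\<^sup>4\<^sup>\<pi>\<^sup>n\<^sup>s\<close>, whereas the decay of \<open>c\<^sub>n\<close> allows only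
  a growth of order \<open>e\<^sup>2\<^sup>\<pi>\<^sup>n\<^sup>s\<^sup>-\<^sup>\<epsilon>\<^sup>s\<close>. Since \<open>n \<ge> 0\<close>, letting \<open>s \<rightarrow> \<infinity>\<close> forces \<open>g(- n) = 0\<close>.\<close>

lemma fourier_at_decay_imp_zero:
  assumes F: "has_partials F Fx Fy" and per: "\<And>z. z \<in> \<H> \<Longrightarrow> F (z + 1) = F z"
    and g: "\<And>n y. y > 0 \<Longrightarrow> fourier_at (xi_op k F) n y = g n * of_real (exp (- 2 * pi * of_int n * y))"
    and n: "n \<ge> 0" and \<epsilon>: "\<epsilon> > 0"
    and decay: "\<And>y. y \<ge> Y \<Longrightarrow> norm (fourier_at F n y) \<le> K * exp (- \<epsilon> * y)"
  shows "g (- n) = 0"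
proof (rule ccontr)
  define C where "C = cnj (g (- n))"
  define q where "q = nat \<bar>- k\<bar>"
  define a where "a = 2 * pi * of_int n"
  assume "g (- n) \<noteq> 0"
  then have C: "C \<noteq> 0" by (simp add: C_def)
  define \<phi> where "\<phi> y = of_real (exp (a * y)) * fourier_at F n y" for y
  have K: "0 \<le> K"
  proof -
    have "0 \<le> K * exp (- \<epsilon> * Y)" using decay [of Y] norm_ge_zero order_trans by blast
    then show ?thesis by (simp add: zero_le_mult_iff)
  qed
  have a: "a \<ge> 0" using n by (simp add: a_def)
  \<comment> \<open>dividing by \<open>C\<close> makes the derivative real and positive, so the mean value theorem applies\<close>
  have der: "((\<lambda>y. Re (\<phi> y / C)) has_real_derivative (y powi (- k) * exp (2 * a * y))) (at y)" if "y > 0" for y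
  proof -
    have "(\<phi> has_vector_derivative of_real (y powi (- k) * exp (2 * a * y)) * C) (at y)"
      using fourier_at_ode [OF F per g that, of n] by (simp add: \<phi>_def [abs_def] C_def a_def mult_ac)
    then have "((\<lambda>y. \<phi> y / C) has_vector_derivative of_real (y powi (- k) * exp (2 * a * y)) * C / C) (at y)"
      by (rule has_vector_derivative_divide)
    then have "((\<lambda>y. \<phi> y / C) has_vector_derivative of_real (y powi (- k) * exp (2 * a * y))) (at y)"
      using C by simp
    then have "((\<lambda>y. Re (\<phi> y / C)) has_vector_derivative Re (of_real (y powi (- k) * exp (2 * a * y)))) (at y)"
      by (rule bounded_linear.has_vector_derivative [OF bounded_linear_Re])
    then show ?thesis
      by (simp only: Re_complex_of_real has_real_derivative_iff_has_vector_derivative)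
  qed
  have bound: "norm C \<le> 2 * K * exp (a + \<epsilon>) * (s ^ q * exp (- (\<epsilon> * s)))" if s: "s \<ge> max Y 1 + 1" for s
  proof -
    define y where "y = s - 1"
    have y: "y \<ge> 1" "y \<ge> Y" "y < s" using s by (auto simp: y_def)
    obtain t where t: "y < t" "t < s" "Re (\<phi> s / C) - Re (\<phi> y / C) = (s - y) * (t powi (- k) * exp (2 * a * t))"
      using MVT2 [OF \<open>y < s\<close>, of "\<lambda>y. Re (\<phi> y / C)" "\<lambda>y. y powi (- k) * exp (2 * a * y)"] der y by force
    have \<phi>b: "norm (\<phi> x) \<le> exp (a * s) * (K * exp (- \<epsilon> * y))" if "y \<le> x" "x \<le> s" for x
    proof -
      have "norm (fourier_at F n x) \<le> K * exp (- \<epsilon> * x)" using decay that y by simp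
      also have "\<dots> \<le> K * exp (- \<epsilon> * y)" using that \<epsilon> K by (intro mult_left_mono) auto
      finally have "norm (fourier_at F n x) \<le> K * exp (- \<epsilon> * y)" .
      moreover have "exp (a * x) \<le> exp (a * s)" using that a by (simp add: mult_left_mono)
      ultimately show ?thesis unfolding \<phi>_def norm_mult norm_of_real
        by (intro mult_mono) auto
    qed
    have "inverse (s ^ q) * exp (2 * a * y) \<le> t powi (- k) * exp (2 * a * t)"
      unfolding q_def using t y a by (intro mult_mono powi_lower_bound) (auto intro: mult_left_mono)
    also have "\<dots> = Re (\<phi> s / C) - Re (\<phi> y / C)" using t by (simp add: y_def)
    also have "\<dots> = Re ((\<phi> s - \<phi> y) / C)" by (simp add: diff_divide_distrib)
    also have "\<dots> \<le> norm ((\<phi> s - \<phi> y) / C)" by (rule complex_Re_le_cmod)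
    also have "\<dots> = norm (\<phi> s - \<phi> y) / norm C" by (rule norm_divide)
    also have "\<dots> \<le> (2 * (exp (a * s) * (K * exp (- \<epsilon> * y)))) / norm C"
      using norm_triangle_ineq4 [of "\<phi> s" "\<phi> y"] \<phi>b [of s] \<phi>b [of y] y by (intro divide_right_mono) auto
    finally have "norm C * (inverse (s ^ q) * exp (2 * a * y)) \<le> 2 * (exp (a * s) * (K * exp (- \<epsilon> * y)))"
      using C by (simp add: field_simps)
    then have "norm C \<le> 2 * (exp (a * s) * (K * exp (- \<epsilon> * y))) * (s ^ q * exp (- (2 * a * y)))"
      using y by (simp add: exp_minus field_simps)
    also have "\<dots> = 2 * K * s ^ q * exp (a * s + - \<epsilon> * y + - (2 * a * y))"
      by (simp only: exp_add mult_ac)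
    also have "\<dots> \<le> 2 * K * s ^ q * exp (a + \<epsilon> - \<epsilon> * s)"
    proof (intro mult_left_mono)
      have "a * 1 \<le> a * y" using a y by (intro mult_left_mono) auto
      then show "exp (a * s + - \<epsilon> * y + - (2 * a * y)) \<le> exp (a + \<epsilon> - \<epsilon> * s)"
        using a y(1) by (simp add: y_def algebra_simps)
    qed (use K y in auto)
    also have "\<dots> = 2 * K * exp (a + \<epsilon>) * (s ^ q * exp (- (\<epsilon> * s)))"
      by (simp add: exp_diff exp_minus field_simps)
    finally show ?thesis .
  qed
  have "((\<lambda>s. 2 * K * exp (a + \<epsilon>) * (s ^ q * exp (- (\<epsilon> * s)))) \<longlongrightarrow> 2 * K * exp (a + \<epsilon>) * 0) at_top"
    by (intro tendsto_intros power_times_exp_tendsto_0 \<epsilon>)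
  then have "norm C \<le> 2 * K * exp (a + \<epsilon>) * 0"
    by (rule tendsto_lowerbound) (use bound in \<open>auto simp: eventually_at_top_linorder\<close>)
  with C show False by simp
qed

text \<open>The growth condition is uniform in \<open>x\<close>, hence it may be integrated against \<open>e(- n x)\<close>; that picks the coefficient
  of \<open>q\<^sup>n\<close> out of the principal part.\<close>

lemma principal_part_fourier_at:
  assumes pp: "principal_part F P" and cont: "continuous_on \<H> F"
  obtains \<epsilon> K Y where "\<epsilon> > 0" and "Y > 0" and
    "\<And>n y. y \<ge> Y \<Longrightarrow> norm (fourier_at F n y - (if n \<le> 0 then coeff P (nat (- n)) * of_real (exp (- 2 * pi * of_int n * y)) else 0))
       \<le> K * exp (- \<epsilon> * y)"
proof -
  obtain \<epsilon> K Y where \<epsilon>: "\<epsilon> > 0" and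
    b: "\<And>z. Im z > 0 \<and> Im z \<ge> Y \<Longrightarrow> norm (F z - poly P (exp (- 2 * of_real pi * \<i> * z))) \<le> K * exp (- \<epsilon> * Im z)"
    using pp unfolding principal_part_def by blast
  have pol: "poly P (exp (- 2 * of_real pi * \<i> * z)) = (\<Sum>i\<le>degree P. coeff P i * ee (- int i) z)" for z
  proof -
    have "exp (- 2 * of_real pi * \<i> * z) = ee (- 1) z" by (simp add: ee_def)
    then show ?thesis by (simp add: poly_altdef ee_power)
  qed
  show thesis
  proof (rule that [OF \<epsilon>])
    show "max Y 1 > 0" by simp
    fix n :: int and y :: real assume "y \<ge> max Y 1"
    then have y: "y > 0" "y \<ge> Y" by auto
    have contF: "continuous_on {0..1} (\<lambda>t. F (Complex t y))"
      by (rule continuous_on_horizontal [OF cont y(1)])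
    define d where "d t = F (Complex t y) - (\<Sum>i\<le>degree P. coeff P i * ee (- int i) (Complex t y))" for t
    have contd: "continuous_on {0..1} d"
      unfolding d_def Complex_eq by (intro continuous_intros contF [unfolded Complex_eq])
    have "fcoeff d n = fourier_at F n y - (if n \<le> 0 then coeff P (nat (- n)) * of_real (exp (- 2 * pi * of_int n * y)) else 0)"
    proof -
      have "((\<lambda>t. F (Complex t y) * ee (- n) (of_real t) -
          (\<Sum>i\<le>degree P. coeff P i * of_real (exp (2 * pi * of_nat i * y)) * ee (- int i + - n) (of_real t))) has_integral
          (fourier_at F n y - (\<Sum>i\<le>degree P. coeff P i * of_real (exp (2 * pi * of_nat i * y)) * (if - int i + - n = 0 then 1 else 0)))) {0..1}"
        unfolding fourier_at_def
        by (intro has_integral_diff fcoeff_has_integral contF has_integral_sum has_integral_mult_right ee_has_integral) simp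
      moreover have "F (Complex t y) * ee (- n) (of_real t) -
          (\<Sum>i\<le>degree P. coeff P i * of_real (exp (2 * pi * of_nat i * y)) * ee (- int i + - n) (of_real t)) = d t * ee (- n) (of_real t)" for t
        unfolding d_def left_diff_distrib sum_distrib_right ee_Complex ee_mult [symmetric]
        by (intro arg_cong2 [where f = "(-)"] sum.cong refl) (simp add: mult_ac)
      moreover have "(\<Sum>i\<le>degree P. coeff P i * of_real (exp (2 * pi * of_nat i * y)) * (if - int i + - n = 0 then 1 else 0)) =
          (if n \<le> 0 then coeff P (nat (- n)) * of_real (exp (- 2 * pi * of_int n * y)) else 0)"
      proof -
        have "(\<Sum>i\<le>degree P. coeff P i * of_real (exp (2 * pi * of_nat i * y)) * (if - int i + - n = 0 then 1 else 0)) =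
          (\<Sum>i\<le>degree P. if i = nat (- n) then (if n \<le> 0 then coeff P (nat (- n)) * of_real (exp (- 2 * pi * of_int n * y)) else 0) else 0)"
          by (intro sum.cong) auto
        also have "\<dots> = (if n \<le> 0 then coeff P (nat (- n)) * of_real (exp (- 2 * pi * of_int n * y)) else 0)"
          by (auto simp: coeff_eq_0)
        finally show ?thesis .
      qed
      ultimately show ?thesis by (simp add: fcoeff_def integral_unique)
    qed
    moreover have "norm (fcoeff d n) \<le> K * exp (- \<epsilon> * y)"
    proof (rule norm_fcoeff_le [OF contd])
      fix t :: real
      show "norm (d t) \<le> K * exp (- \<epsilon> * y)"
        using b [of "Complex t y", unfolded pol] y by (simp add: d_def)
    qed
    ultimately show "norm (fourier_at F n y - (if n \<le> 0 then coeff P (nat (- n)) * of_real (exp (- 2 * pi * of_int n * y)) else 0))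
       \<le> K * exp (- \<epsilon> * y)" by simp
  qed
qed

lemma summable_exp_abs:
  assumes "c > (0::real)"
  shows "(\<lambda>n::int. exp (- c * of_int \<bar>n\<bar>)) summable_on UNIV"
proof -
  have geo: "(\<lambda>n::nat. exp (- c * real n)) summable_on UNIV"
  proof (rule norm_summable_imp_summable_on)
    have "summable (\<lambda>n. exp (- c) ^ n)" using assms by (intro summable_geometric) simp
    then show "summable (\<lambda>n. norm (exp (- c * real n)))"
      by (simp add: exp_of_nat_mult [symmetric] mult.commute)
  qed
  then have geo: "(\<lambda>n::nat. exp (- (c * real n))) summable_on UNIV" by simp
  have "(\<lambda>n::int. exp (- c * of_int \<bar>n\<bar>)) summable_on (range int)"
    by (subst summable_on_reindex) (auto simp: o_def geo inj_on_def)
  moreover have "(\<lambda>n::int. exp (- c * of_int \<bar>n\<bar>)) summable_on (range (\<lambda>n. - int n))"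
    by (subst summable_on_reindex) (auto simp: o_def geo inj_on_def)
  ultimately have "(\<lambda>n::int. exp (- c * of_int \<bar>n\<bar>)) summable_on (range int \<union> range (\<lambda>n. - int n))"
    by (rule summable_on_union)
  moreover have "range int \<union> range (\<lambda>n. - int n) = UNIV"
  proof -
    have "n \<in> range int \<union> range (\<lambda>n. - int n)" for n
      by (cases n rule: int_cases2) auto
    then show ?thesis by blast
  qed
  ultimately show ?thesis by simp
qed

lemma fourier_series_upper_half_plane:
  assumes F: "has_partials F Fx Fy" and per: "\<And>z. z \<in> \<H> \<Longrightarrow> F (z + 1) = F z"
    and y: "y > 0" and summ: "(\<lambda>n. norm (fourier_at F n y)) summable_on UNIV"
  shows "((\<lambda>n. fourier_at F n y * ee n (of_real t)) has_sum F (Complex t y)) UNIV"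
  unfolding fourier_at_def
proof (rule fourier_series)
  show "F (Complex (t + 1) y) = F (Complex t y)" for t
    using per [of "Complex t y"] y by (simp add: plus_complex.ctr one_complex.ctr)
  show "((\<lambda>t. F (Complex t y)) has_vector_derivative Fx (Complex t y)) (at t)" for t
    by (rule has_partials_horizontal [OF F y])
qed (use summ in \<open>simp add: fourier_at_def\<close>)

section \<open>The Fourier expansions of \<open>f\<close> and \<open>\<xi>\<^sub>k f\<close>\<close>

text \<open>The properties of the \<open>q\<close>-expansion of a function that is holomorphic and decaying at infinity: its Fourier coefficients
  on horizontal lines are \<open>g(n) e\<^sup>-\<^sup>2\<^sup>\<pi>\<^sup>n\<^sup>y\<close>, only \<open>n > 0\<close> occurs, and the series converges absolutely.\<close>

definition cusp_expansion :: "(complex \<Rightarrow> complex) \<Rightarrow> (int \<Rightarrow> complex) \<Rightarrow> bool"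
  where "cusp_expansion G g \<longleftrightarrow> (\<forall>n\<le>0. g n = 0) \<and>
    (\<forall>n. \<forall>y>0. fourier_at G n y = g n * of_real (exp (- 2 * pi * of_int n * y))) \<and>
    (\<forall>y>0. (\<lambda>n. norm (g n) * exp (- 2 * pi * of_int n * y)) summable_on UNIV) \<and>
    (\<forall>z\<in>\<H>. ((\<lambda>n. g n * ee n z) has_sum G z) UNIV)"

lemma cusp_expansionD:
  assumes "cusp_expansion G g"
  shows "n \<le> 0 \<Longrightarrow> g n = 0"
    and "y > 0 \<Longrightarrow> fourier_at G n y = g n * of_real (exp (- 2 * pi * of_int n * y))"
    and "y > 0 \<Longrightarrow> (\<lambda>n. norm (g n) * exp (- 2 * pi * of_int n * y)) summable_on UNIV"
    and "z \<in> \<H> \<Longrightarrow> ((\<lambda>n. g n * ee n z) has_sum G z) UNIV"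
  using assms unfolding cusp_expansion_def by simp_all

text \<open>The growth condition on \<open>F\<close> passes to \<open>\<xi>\<^sub>k F\<close>: the decay of the coefficients of \<open>F\<close> at the indices \<open>n \<ge> 0\<close>
  annihilates the coefficients of \<open>\<xi>\<^sub>k F\<close> at the indices \<open>\<le> 0\<close>. Absolute convergence at height \<open>y\<close> follows
  from the boundedness of the Fourier coefficients at height \<open>y / 2\<close>.\<close>

lemma xi_expansion:
  assumes F: "has_partials F Fx Fy" and per: "\<And>z. z \<in> \<H> \<Longrightarrow> F (z + 1) = F z"
    and hol: "xi_op k F holomorphic_on \<H>"
    and pp: "principal_part F P" and P0: "coeff P 0 = 0"
  shows "\<exists>g. cusp_expansion (xi_op k F) g"
proof -
  have perG: "xi_op k F (z + 1) = xi_op k F z" if "z \<in> \<H>" for z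
    by (rule xi_op_periodic [OF F _ that]) (rule per)
  obtain g where g: "\<And>n y. y > 0 \<Longrightarrow> fourier_at (xi_op k F) n y = g n * of_real (exp (- 2 * pi * of_int n * y))"
    by (rule fourier_at_holomorphic [OF hol perG], assumption, (rule that; blast))
  obtain \<epsilon> K Y where \<epsilon>: "\<epsilon> > 0" and
    decay: "\<And>n y. y \<ge> Y \<Longrightarrow> norm (fourier_at F n y - (if n \<le> 0 then coeff P (nat (- n)) * of_real (exp (- 2 * pi * of_int n * y)) else 0))
       \<le> K * exp (- \<epsilon> * y)"
    by (rule principal_part_fourier_at [OF pp has_partials_continuous(1) [OF F]]) (rule that; blast)
  have g0: "g n = 0" if "n \<le> 0" for n
  proof -
    have "g (- (- n)) = 0"
    proof (rule fourier_at_decay_imp_zero [OF F _ g _ \<epsilon>])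
      show "norm (fourier_at F (- n) y) \<le> K * exp (- \<epsilon> * y)" if "y \<ge> Y" for y
        using decay [OF that, of "- n"] \<open>n \<le> 0\<close> P0 by (cases "n = 0") auto
    qed (use that per in auto)
    then show ?thesis by simp
  qed
  have summ: "(\<lambda>n. norm (g n) * exp (- 2 * pi * of_int n * y)) summable_on UNIV" if y: "y > 0" for y
  proof -
    obtain M where M: "\<And>n. norm (fourier_at (xi_op k F) n (y / 2)) \<le> M"
      using fourier_at_bounded [OF holomorphic_on_imp_continuous_on [OF hol], of "y / 2"] y by auto
    have M0: "0 \<le> M" using M [of 0] norm_ge_zero order_trans by blast
    have "norm (g n) * exp (- 2 * pi * of_int n * y) \<le> M * exp (- (pi * y) * of_int \<bar>n\<bar>)" for n
    proof (cases "n \<le> 0")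
      case True
      then show ?thesis using g0 M0 by simp
    next
      case False
      have "norm (g n) * exp (- pi * of_int n * y) \<le> M"
        using M [of n] g [of "y / 2" n] y by (simp add: norm_mult mult_ac)
      then have "norm (g n) * exp (- pi * of_int n * y) * exp (- pi * of_int n * y) \<le> M * exp (- pi * of_int n * y)"
        by (rule mult_right_mono) simp
      then show ?thesis
        using False by (simp add: mult.assoc exp_add [symmetric] algebra_simps)
    qed
    moreover have "(\<lambda>n. M * exp (- (pi * y) * of_int \<bar>n\<bar>)) summable_on UNIV"
      using y by (intro summable_on_cmult_right summable_exp_abs) simp
    ultimately have "(\<lambda>n. norm (norm (g n) * exp (- 2 * pi * of_int n * y))) summable_on UNIV"
      by (intro Infinite_Sum.abs_summable_on_comparison_test') auto
    then show ?thesis by simp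
  qed
  have "((\<lambda>n. g n * ee n z) has_sum xi_op k F z) UNIV" if z: "z \<in> \<H>" for z
  proof -
    define t y where "t = Re z" and "y = Im z"
    have zz: "z = Complex t y" and y: "y > 0"
      using z by (auto simp: t_def y_def upper_half_plane_def)
    have "((\<lambda>n. fourier_at (xi_op k F) n y * ee n (of_real t)) has_sum xi_op k F (Complex t y)) UNIV"
      by (rule fourier_series_upper_half_plane [OF has_partials_holomorphic [OF hol] perG y])
         (use summ [OF y] y in \<open>simp_all add: g norm_mult\<close>)
    then show "((\<lambda>n. g n * ee n z) has_sum xi_op k F z) UNIV"
      using y by (simp add: zz g ee_Complex mult_ac)
  qed
  with g0 g summ have "cusp_expansion (xi_op k F) g"
    unfolding cusp_expansion_def by blast
  then show ?thesis by blast
qed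

text \<open>Only indices \<open>n \<ge> 1\<close> occur, so each term shrinks by at least \<open>e\<^sup>-\<^sup>2\<^sup>\<pi>\<^sup>(\<^sup>y\<^sup>-\<^sup>y\<^sup>0\<^sup>)\<close> on the way from height \<open>y\<^sub>0\<close> up to
  height \<open>y\<close>.\<close>

lemma cusp_expansion_decay:
  assumes g: "cusp_expansion G g"
    and y0: "y0 > 0"
  obtains C where "\<And>z. Im z \<ge> y0 \<Longrightarrow> norm (G z) \<le> C * exp (- 2 * pi * Im z)"
proof -
  define S where "S = (\<Sum>\<^sub>\<infinity>n. norm (g n) * exp (- 2 * pi * of_int n * y0))"
  have S: "((\<lambda>n. norm (g n) * exp (- 2 * pi * of_int n * y0)) has_sum S) UNIV"
    unfolding S_def by (intro has_sum_infsum cusp_expansionD(3) [OF g y0])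
  show thesis
  proof (rule that)
    fix z assume z: "Im z \<ge> y0"
    have "norm (G z) \<le> S * exp (- 2 * pi * (Im z - y0))"
    proof (rule norm_infsum_le [OF cusp_expansionD(4) [OF g] has_sum_cmult_left [OF S]])
      show "z \<in> \<H>" using z y0 by (simp add: upper_half_plane_def)
      fix n :: int
      show "norm (g n * ee n z) \<le> norm (g n) * exp (- 2 * pi * of_int n * y0) * exp (- 2 * pi * (Im z - y0))"
      proof (cases "n \<le> 0")
        case False
        then have "1 * (2 * pi * (Im z - y0)) \<le> of_int n * (2 * pi * (Im z - y0))"
          using z by (intro mult_right_mono) auto
        then have "exp (- 2 * pi * of_int n * Im z) \<le> exp (- 2 * pi * of_int n * y0 + - 2 * pi * (Im z - y0))"
          by (simp add: algebra_simps)
        then have "exp (- 2 * pi * of_int n * Im z) \<le> exp (- 2 * pi * of_int n * y0) * exp (- 2 * pi * (Im z - y0))"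
          by (simp only: exp_add)
        then show ?thesis
          by (simp only: norm_mult norm_ee mult.assoc) (rule mult_left_mono, auto)
      qed (simp add: cusp_expansionD(1) [OF g])
    qed
    also have "S * exp (- 2 * pi * (Im z - y0)) = S * exp (2 * pi * y0) * exp (- 2 * pi * Im z)"
      by (simp add: exp_add [symmetric] algebra_simps)
    finally show "norm (G z) \<le> S * exp (2 * pi * y0) * exp (- 2 * pi * Im z)" .
  qed
qed

lemma upper_Gamma_has_vector_derivative:
  assumes k: "k \<le> 0" and v: "v > 0" and y: "y > 0"
  shows "((\<lambda>y. complex_of_real (upper_Gamma (1 - of_int k) (v * y))) has_vector_derivative
     - of_real (v ^ (nat (- k) + 1) * (y ^ nat (- k) * exp (- (v * y))))) (at y)"
proof -
  define p where "p = nat (- k)"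
  have "((\<lambda>y. exp (- (1 * (v * y))) * incexp p 1 (v * y)) has_real_derivative
      - ((v * y) ^ p * exp (- (1 * (v * y)))) * v) (at y)"
    by (rule DERIV_chain2 [OF exp_incexp_has_field_derivative]) (auto intro!: derivative_eq_intros)
  then have "((\<lambda>y. exp (- (v * y)) * incexp p 1 (v * y)) has_vector_derivative
      - (v ^ (p + 1) * (y ^ p * exp (- (v * y))))) (at y)"
    by (simp add: has_real_derivative_iff_has_vector_derivative power_mult_distrib mult_ac)
  then have "((\<lambda>y. complex_of_real (exp (- (v * y)) * incexp p 1 (v * y))) has_vector_derivative
      of_real (- (v ^ (p + 1) * (y ^ p * exp (- (v * y)))))) (at y)"
    by (rule bounded_linear.has_vector_derivative [OF bounded_linear_of_real])
  then have "((\<lambda>y. complex_of_real (upper_Gamma (1 - of_int k) (v * y))) has_vector_derivative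
      of_real (- (v ^ (p + 1) * (y ^ p * exp (- (v * y)))))) (at y)"
    by (rule has_vector_derivative_transform_within_open [of _ _ _ "{0<..}"])
       (use y v in \<open>auto simp: upper_Gamma_closed_form [OF k] p_def\<close>)
  then show ?thesis by (simp add: p_def)
qed

lemma upper_Gamma_tendsto_0:
  assumes k: "k \<le> 0" and v: "v > 0"
  shows "((\<lambda>y. complex_of_real (upper_Gamma (1 - of_int k) (v * y))) \<longlongrightarrow> 0) at_top"
proof -
  have "filterlim (\<lambda>y. v * y) at_top at_top"
    by (rule filterlim_tendsto_pos_mult_at_top [OF tendsto_const v filterlim_ident])
  then have "((\<lambda>y. exp (- (1 * (v * y))) * incexp (nat (- k)) 1 (v * y)) \<longlongrightarrow> 0) at_top"
    by (rule filterlim_compose [OF exp_incexp_tendsto_0, rotated]) simp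
  then have "((\<lambda>y. complex_of_real (exp (- (1 * (v * y))) * incexp (nat (- k)) 1 (v * y))) \<longlongrightarrow> of_real 0) at_top"
    by (intro tendsto_of_real)
  moreover have "eventually (\<lambda>y. complex_of_real (exp (- (1 * (v * y))) * incexp (nat (- k)) 1 (v * y)) = of_real (upper_Gamma (1 - of_int k) (v * y))) at_top"
    using eventually_gt_at_top [of 0] by eventually_elim (use v in \<open>simp add: upper_Gamma_closed_form [OF k]\<close>)
  ultimately show ?thesis by (simp add: Lim_transform_eventually)
qed

text \<open>Bounds \<open>\<Gamma>(p + 1, v y)\<close> by \<open>e\<^sup>-\<^sup>v\<^sup>y v\<^sup>p\<close> times a constant in \<open>v\<close>, where \<open>v\<close> runs through multiples of the index \<open>n\<close>.\<close>

lemma incexp_1_bounds: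
  assumes "v \<ge> (1::real)" "y > 0"
  shows "0 \<le> incexp p 1 (v * y)" "incexp p 1 (v * y) \<le> v ^ p * incexp p 1 y"
proof -
  show "0 \<le> incexp p 1 (v * y)"
    using assms by (auto simp: incexp_def intro!: sum_nonneg)
  show "incexp p 1 (v * y) \<le> v ^ p * incexp p 1 y"
    unfolding incexp_def sum_distrib_left
  proof (rule sum_mono)
    fix l assume l: "l \<in> {..p}"
    have "v ^ l \<le> v ^ p" using assms l by (intro power_increasing) auto
    then have "v ^ l * (fact p / (fact l * 1 ^ (p - l + 1)) * y ^ l) \<le> v ^ p * (fact p / (fact l * 1 ^ (p - l + 1)) * y ^ l)"
      using assms by (intro mult_right_mono) auto
    then show "fact p / (fact l * 1 ^ (p - l + 1)) * (v * y) ^ l \<le> v ^ p * (fact p / (fact l * 1 ^ (p - l + 1)) * y ^ l)"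
      by (simp add: power_mult_distrib mult_ac)
  qed
qed

text \<open>Both \<open>e\<^sup>2\<^sup>\<pi>\<^sup>n\<^sup>y c\<^sub>n(y)\<close> and \<open>b(n) \<Gamma>(1 - k, - 4 \<pi> n y)\<close>, for the right choice of \<open>b(n)\<close>, solve the differential equation
  of the Fourier coefficients, so they differ by a constant \<open>a(n)\<close>. The last hypothesis is there because \<open>b(n)\<close> is expressed
  through the closed form of \<open>\<Gamma>(1 - k, \<cdot>)\<close>, which exists for \<open>k \<le> 0\<close>; when \<open>\<xi>\<^sub>k F = 0\<close>
  all \<open>b(n)\<close> are taken to be \<open>0\<close>.\<close>

lemma maass_expansion_exists:
  assumes F: "has_partials F Fx Fy" and per: "\<And>z. z \<in> \<H> \<Longrightarrow> F (z + 1) = F z"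
    and hol: "xi_op k F holomorphic_on \<H>"
    and pp: "principal_part F P" and P0: "coeff P 0 = 0"
    and k: "k \<le> 0 \<or> (\<forall>z\<in>\<H>. xi_op k F z = 0)"
  shows "\<exists>n0 a b. maass_expansion k F n0 a b"
proof -
  have "\<exists>g. cusp_expansion (xi_op k F) g"
    by (rule xi_expansion [OF F _ hol pp P0]) (rule per)
  then obtain g where cg: "cusp_expansion (xi_op k F) g" ..
  note g0 = cusp_expansionD(1) [OF cg] and g = cusp_expansionD(2) [OF cg] and gsumm = cusp_expansionD(3) [OF cg]
  define p where "p = nat (- k)"
  define \<Gamma> where "\<Gamma> n y = complex_of_real (upper_Gamma (1 - of_int k) (- 4 * pi * of_int n * y))" for n y
  \<comment> \<open>the derivative of \<open>\<Gamma>(p + 1, v y)\<close> in \<open>y\<close> is \<open>- v\<^sup>p\<^sup>+\<^sup>1 y\<^sup>p e\<^sup>-\<^sup>v\<^sup>y\<close>, which dictates this normalisation\<close>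
  define b where "b n = (if k \<le> 0 then - cnj (g (- n)) / of_real ((- 4 * pi * of_int n) ^ (p + 1)) else 0)" for n
  define \<beta> where "\<beta> n y = (if n < 0 then b n * \<Gamma> n y else 0)" for n y
  have gk: "g n = 0" if "\<not> k \<le> 0" for n
  proof -
    have "fourier_at (xi_op k F) n 1 = 0"
      using k that by (simp add: fourier_at_def fcoeff_def)
    then show ?thesis using g [of 1 n] by simp
  qed
  have \<beta>_der: "(\<beta> n has_vector_derivative of_real (y powi (- k) * exp (4 * pi * of_int n * y)) * cnj (g (- n))) (at y)"
    if y: "y > 0" for n y
  proof (cases "n < 0 \<and> k \<le> 0")
    case True
    have v: "- 4 * pi * of_int n > 0" using True by (simp add: mult_pos_neg)
    have "((\<lambda>y. b n * \<Gamma> n y) has_vector_derivative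
        b n * - of_real ((- 4 * pi * of_int n) ^ (nat (- k) + 1) * (y ^ nat (- k) * exp (- ((- 4 * pi * of_int n) * y))))) (at y)"
      unfolding \<Gamma>_def using True by (intro has_vector_derivative_mult_right upper_Gamma_has_vector_derivative v y) auto
    moreover have eq: "b n * - of_real ((- 4 * pi * of_int n) ^ (nat (- k) + 1) * (y ^ nat (- k) * exp (- ((- 4 * pi * of_int n) * y))))
        = of_real (y powi (- k) * exp (4 * pi * of_int n * y)) * cnj (g (- n))"
    proof -
      define V where "V = (- 4 * pi * of_int n) ^ (p + 1)"
      have "V > 0" unfolding V_def by (rule zero_less_power [OF v])
      then have "complex_of_real V \<noteq> 0" by simp
      moreover have "b n = - cnj (g (- n)) / of_real V" using True by (simp add: b_def V_def)
      moreover have "y powi (- k) = y ^ p" using True by (simp add: p_def power_int_def)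
      moreover have "- ((- 4 * pi * of_int n) * y) = 4 * pi * of_int n * y" by simp
      ultimately show ?thesis
        unfolding p_def [symmetric] V_def [symmetric] by simp
    qed
    moreover have "\<beta> n = (\<lambda>y. b n * \<Gamma> n y)" using True by (simp add: \<beta>_def fun_eq_iff)
    ultimately show ?thesis by (simp only: eq)
  next
    case False
    have "g (- n) = 0"
    proof (cases "n < 0")
      case True
      then show ?thesis using False gk by blast
    next
      case False
      then show ?thesis by (intro g0) simp
    qed
    moreover from False have "\<beta> n = (\<lambda>y. 0)" by (auto simp: \<beta>_def b_def)
    ultimately show ?thesis by simp
  qed
  have "\<exists>c. \<forall>y\<in>{0<..}. of_real (exp (2 * pi * of_int n * y)) * fourier_at F n y - \<beta> n y = c" for n
  proof (rule has_vector_derivative_zero_constant)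
    fix y :: real assume "y \<in> {0<..}"
    then have y: "y > 0" by simp
    have "((\<lambda>y. of_real (exp (2 * pi * of_int n * y)) * fourier_at F n y) has_vector_derivative
     of_real (y powi (- k) * exp (4 * pi * of_int n * y)) * cnj (g (- n))) (at y)"
      by (rule fourier_at_ode [OF F _ g y]) (rule per)
    from has_vector_derivative_diff [OF this \<beta>_der [OF y, of n]]
    have "((\<lambda>y. of_real (exp (2 * pi * of_int n * y)) * fourier_at F n y - \<beta> n y) has_vector_derivative 0) (at y)"
      by simp
    then show "((\<lambda>y. of_real (exp (2 * pi * of_int n * y)) * fourier_at F n y - \<beta> n y) has_vector_derivative 0) (at y within {0<..})"
      by (rule has_vector_derivative_at_within)
  qed auto
  then have "\<exists>a. \<forall>n. \<forall>y\<in>{0<..}. of_real (exp (2 * pi * of_int n * y)) * fourier_at F n y - \<beta> n y = a n"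
    by (intro choice allI)
  then obtain a where a': "\<And>n y. y > 0 \<Longrightarrow> of_real (exp (2 * pi * of_int n * y)) * fourier_at F n y - \<beta> n y = a n"
    by auto
  have a: "fourier_at F n y = (a n + \<beta> n y) * of_real (exp (- 2 * pi * of_int n * y))" if "y > 0" for n y
  proof -
    have "(a n + \<beta> n y) * of_real (exp (- 2 * pi * of_int n * y)) =
      of_real (exp (2 * pi * of_int n * y) * exp (- 2 * pi * of_int n * y)) * fourier_at F n y"
      unfolding a' [OF that, of n, symmetric] by simp
    then show ?thesis by (simp add: exp_add [symmetric])
  qed
  obtain \<epsilon> K Y where \<epsilon>: "\<epsilon> > 0" and Y: "Y > 0" and
    decay: "\<And>n y. y \<ge> Y \<Longrightarrow> norm (fourier_at F n y - (if n \<le> 0 then coeff P (nat (- n)) * of_real (exp (- 2 * pi * of_int n * y)) else 0))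
       \<le> K * exp (- \<epsilon> * y)"
    by (rule principal_part_fourier_at [OF pp has_partials_continuous(1) [OF F]]) (rule that; blast)
  \<comment> \<open>for these indices the principal part contributes nothing, so \<open>a(n) + \<beta>(n, y)\<close> decays, and so does \<open>\<beta>(n, y)\<close>\<close>
  have a0: "a n = 0" if n: "n = 0 \<or> n < - int (degree P)" for n
  proof -
    have n0: "n \<le> 0" using n by auto
    have cP: "coeff P (nat (- n)) = 0" using n P0 by (auto intro: coeff_eq_0)
    have "norm (a n + \<beta> n y) \<le> K * exp (- (\<epsilon> * y))" if "y \<ge> Y" for y
    proof -
      have y: "y > 0" using that Y by simp
      have "norm (fourier_at F n y) \<le> K * exp (- (\<epsilon> * y))"
        using decay [OF that, of n] by (simp add: cP cong: if_cong)
      moreover have "norm (a n + \<beta> n y) * 1 \<le> norm (a n + \<beta> n y) * exp (- 2 * pi * of_int n * y)"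
        using n0 y by (intro mult_left_mono) (auto simp: mult_nonpos_nonneg mult_nonneg_nonpos)
      ultimately show ?thesis
        by (simp add: a [OF y] norm_mult)
    qed
    then have ev: "eventually (\<lambda>y. norm (a n + \<beta> n y) \<le> K * exp (- (\<epsilon> * y))) at_top"
      by (auto simp: eventually_at_top_linorder)
    have "((\<lambda>y. K * (y ^ 0 * exp (- (\<epsilon> * y)))) \<longlongrightarrow> K * 0) at_top"
      by (intro tendsto_intros power_times_exp_tendsto_0 \<epsilon>)
    then have "((\<lambda>y. a n + \<beta> n y) \<longlongrightarrow> 0) at_top"
      by (intro Lim_null_comparison [OF ev]) simp
    moreover have "((\<lambda>y. a n + \<beta> n y) \<longlongrightarrow> a n + 0) at_top"
    proof (intro tendsto_add tendsto_const)
      show "(\<beta> n \<longlongrightarrow> 0) at_top"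
      proof (cases "n < 0 \<and> k \<le> 0")
        case True
        then have "((\<lambda>y. b n * \<Gamma> n y) \<longlongrightarrow> b n * 0) at_top"
          unfolding \<Gamma>_def by (intro tendsto_intros upper_Gamma_tendsto_0) (auto simp: mult_pos_neg)
        then show ?thesis using True by (simp add: \<beta>_def [abs_def])
      next
        case False
        then have "\<beta> n = (\<lambda>y. 0)" by (auto simp: \<beta>_def b_def)
        then show ?thesis by simp
      qed
    qed
    ultimately show ?thesis
      using tendsto_unique trivial_limit_at_top_linorder by fastforce
  qed
  \<comment> \<open>domination by the convergent expansion of \<open>\<xi>\<^sub>k F\<close> at the same height\<close>
  have b_summ: "(\<lambda>n. norm (\<beta> n y * of_real (exp (- 2 * pi * of_int n * y)))) summable_on UNIV" if y: "y > 0" for y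
  proof -
    have "norm (\<beta> n y * of_real (exp (- 2 * pi * of_int n * y))) \<le>
       incexp p 1 y * (norm (g (- n)) * exp (- 2 * pi * of_int (- n) * y))" for n
    proof (cases "n < 0 \<and> k \<le> 0")
      case True
      define v where "v = - 4 * pi * of_int n"
      have "1 * 1 \<le> (4 * pi) * of_int (- n)"
        using True pi_ge_two by (intro mult_mono) auto
      then have v: "v \<ge> 1" by (simp add: v_def)
      have "\<Gamma> n y = of_real (upper_Gamma (1 - of_int k) (v * y))"
        by (simp add: \<Gamma>_def v_def)
      also have "upper_Gamma (1 - of_int k) (v * y) = exp (- (v * y)) * incexp p 1 (v * y)"
        unfolding p_def by (rule upper_Gamma_closed_form) (use True v y in auto)
      finally have G: "norm (\<Gamma> n y) = exp (- (v * y)) * incexp p 1 (v * y)"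
        using incexp_1_bounds(1) [OF v y, of p] by (simp add: norm_mult abs_mult)
      have "b n = - cnj (g (- n)) / of_real (v ^ (p + 1))"
        using True by (simp add: b_def v_def)
      then have "norm (b n) = norm (g (- n)) / v ^ (p + 1)"
        using v by (simp only: norm_divide norm_minus_cancel complex_mod_cnj norm_of_real) simp
      then have "norm (\<beta> n y) = norm (g (- n)) / v ^ (p + 1) * (exp (- (v * y)) * incexp p 1 (v * y))"
        using True G by (simp only: \<beta>_def norm_mult simp_thms if_True)
      also have "\<dots> \<le> norm (g (- n)) / v ^ (p + 1) * (exp (- (v * y)) * (v ^ p * incexp p 1 y))"
        using v by (intro mult_left_mono incexp_1_bounds y) auto
      also have "\<dots> = norm (g (- n)) * incexp p 1 y * exp (- (v * y)) / v"
        using v by (simp add: field_simps)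
      also have "\<dots> \<le> norm (g (- n)) * incexp p 1 y * exp (- (v * y))"
      proof -
        have "0 \<le> norm (g (- n)) * incexp p 1 y * exp (- (v * y))"
          using incexp_1_bounds(1) [of 1 y p] y by simp
        then show ?thesis using v by (simp add: divide_le_eq mult_le_cancel_left1)
      qed
      finally have "norm (\<beta> n y) * exp (- 2 * pi * of_int n * y) \<le>
          norm (g (- n)) * incexp p 1 y * exp (- (v * y)) * exp (- 2 * pi * of_int n * y)"
        by (rule mult_right_mono) simp
      also have "\<dots> = incexp p 1 y * (norm (g (- n)) * (exp (- (v * y)) * exp (- 2 * pi * of_int n * y)))"
        by (simp only: mult_ac)
      also have "exp (- (v * y)) * exp (- 2 * pi * of_int n * y) = exp (- 2 * pi * of_int (- n) * y)"
        by (simp add: exp_add [symmetric] v_def algebra_simps)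
      finally show ?thesis by (simp add: norm_mult)
    next
      case False
      then have "\<beta> n = (\<lambda>y. 0)" by (auto simp: \<beta>_def b_def)
      then show ?thesis
        using incexp_1_bounds(1) [of 1 y p] y by simp
    qed
    moreover have "(\<lambda>n. incexp p 1 y * (norm (g (- n)) * exp (- 2 * pi * of_int (- n) * y))) summable_on UNIV"
    proof (intro summable_on_cmult_right)
      show "(\<lambda>n. norm (g (- n)) * exp (- 2 * pi * of_int (- n) * y)) summable_on UNIV"
        using summable_on_reindex_bij_betw [of uminus UNIV UNIV "\<lambda>n. norm (g n) * exp (- 2 * pi * of_int n * y)"] gsumm [OF y]
        by (simp add: bij_uminus)
    qed
    ultimately show ?thesis
      by (intro Infinite_Sum.abs_summable_on_comparison_test') auto
  qed
  \<comment> \<open>for \<open>n > 0\<close> the coefficients at height \<open>y / 2\<close> are bounded, which gives geometric decay at height \<open>y\<close>; only finitely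
    many \<open>a(n)\<close> with \<open>n \<le> 0\<close> are nonzero\<close>
  have a_summ: "(\<lambda>n. norm (a n * of_real (exp (- 2 * pi * of_int n * y)))) summable_on UNIV" if y: "y > 0" for y
  proof -
    obtain M where M: "\<And>n. norm (fourier_at F n (y / 2)) \<le> M"
      using fourier_at_bounded [OF has_partials_continuous(1) [OF F], of "y / 2"] y by auto
    have M0: "0 \<le> M" using M [of 0] norm_ge_zero order_trans by blast
    define T where "T n = norm (a n * of_real (exp (- 2 * pi * of_int n * y))) * exp (pi * y * of_int \<bar>n\<bar>)" for n
    define M' where "M' = M + (\<Sum>n\<in>{- int (degree P)..0}. T n)"
    have T: "T n \<le> M'" for n
    proof (cases "n > 0")
      case True
      have "norm (a n) * exp (- pi * of_int n * y) \<le> M"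
        using M [of n] a [of "y / 2" n] y True by (simp add: norm_mult \<beta>_def mult_ac)
      moreover have "T n = norm (a n) * (exp (- 2 * pi * of_int n * y) * exp (pi * y * of_int \<bar>n\<bar>))"
        by (simp add: T_def norm_mult)
      moreover have "exp (- 2 * pi * of_int n * y) * exp (pi * y * of_int \<bar>n\<bar>) = exp (- pi * of_int n * y)"
        using True by (simp add: exp_add [symmetric] algebra_simps)
      moreover have "0 \<le> (\<Sum>n\<in>{- int (degree P)..0}. T n)"
        by (intro sum_nonneg) (simp add: T_def)
      ultimately show ?thesis by (simp add: M'_def)
    next
      case False
      show ?thesis
      proof (cases "n < - int (degree P)")
        case True
        then show ?thesis using a0 [of n] M0 by (auto simp: T_def M'_def intro!: add_nonneg_nonneg sum_nonneg)
      next
        case f: False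
        have "T n \<le> (\<Sum>n\<in>{- int (degree P)..0}. T n)"
          by (rule member_le_sum) (use f False in \<open>auto simp: T_def\<close>)
        then show ?thesis using M0 by (simp add: M'_def)
      qed
    qed
    have "norm (a n * of_real (exp (- 2 * pi * of_int n * y))) \<le> M' * exp (- (pi * y) * of_int \<bar>n\<bar>)" for n
    proof -
      have "norm (a n * of_real (exp (- 2 * pi * of_int n * y))) = T n * exp (- (pi * y) * of_int \<bar>n\<bar>)"
        by (simp add: T_def exp_minus)
      then show ?thesis using mult_right_mono [OF T [of n], of "exp (- (pi * y) * of_int \<bar>n\<bar>)"] by simp
    qed
    moreover have "(\<lambda>n. M' * exp (- (pi * y) * of_int \<bar>n\<bar>)) summable_on UNIV"
      using y by (intro summable_on_cmult_right summable_exp_abs) simp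
    ultimately show ?thesis
      by (intro Infinite_Sum.abs_summable_on_comparison_test') auto
  qed
  have "maass_expansion k F (degree P) a b"
    unfolding maass_expansion_def
  proof
    fix z assume z: "z \<in> \<H>"
    define t y where "t = Re z" and "y = Im z"
    have zz: "z = Complex t y" and y: "y > 0"
      using z by (auto simp: t_def y_def upper_half_plane_def)
    define A B where "A n = a n * ee n z" and "B n = \<beta> n y * ee n z" for n
    have AB: "A n + B n = fourier_at F n y * ee n (of_real t)" for n
      by (simp add: A_def B_def a [OF y] zz ee_Complex algebra_simps)
    have "(\<lambda>n. norm (A n)) summable_on UNIV" "(\<lambda>n. norm (B n)) summable_on UNIV"
      using a_summ [OF y] b_summ [OF y] by (simp_all add: A_def B_def zz ee_Complex norm_mult norm_ee)
    then obtain u v where u: "(A has_sum u) UNIV" and v: "(B has_sum v) UNIV"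
      using Infinite_Sum.abs_summable_summable unfolding summable_on_def by metis
    have "((\<lambda>n. fourier_at F n y * ee n (of_real t)) has_sum F (Complex t y)) UNIV"
    proof (rule fourier_series_upper_half_plane [OF F _ y])
      have "(\<lambda>n. norm (a n * of_real (exp (- 2 * pi * of_int n * y))) + norm (\<beta> n y * of_real (exp (- 2 * pi * of_int n * y)))) summable_on UNIV"
        by (intro summable_on_add a_summ b_summ y)
      then show "(\<lambda>n. norm (fourier_at F n y)) summable_on UNIV"
      proof (rule Infinite_Sum.abs_summable_on_comparison_test')
        show "norm (fourier_at F n y) \<le> norm (a n * of_real (exp (- 2 * pi * of_int n * y))) + norm (\<beta> n y * of_real (exp (- 2 * pi * of_int n * y)))" for n
          unfolding a [OF y] distrib_right by (rule norm_triangle_ineq)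
      qed
    qed (rule per)
    moreover have "((\<lambda>n. fourier_at F n y * ee n (of_real t)) has_sum (u + v)) UNIV"
      using has_sum_add [OF u v] by (simp add: AB)
    ultimately have "F z = u + v"
      unfolding zz by (rule has_sum_unique)
    moreover have "((\<lambda>n. a n * exp (2 * of_real pi * \<i> * of_int n * z)) has_sum u) {n. n \<ge> - int (degree P) \<and> n \<noteq> 0}"
      by (rule has_sum_cong_neutral [THEN iffD1, OF _ _ _ u]) (auto simp: A_def ee_def intro!: a0)
    moreover have "((\<lambda>n. b n * of_real (upper_Gamma (1 - of_int k) (- 4 * pi * of_int n * Im z)) *
              exp (2 * of_real pi * \<i> * of_int n * z)) has_sum v) {n. n < 0}"
      by (rule has_sum_cong_neutral [THEN iffD1, OF _ _ _ v]) (auto simp: B_def ee_def \<beta>_def \<Gamma>_def y_def)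
    ultimately show "\<exists>u v.
       ((\<lambda>n. a n * exp (2 * of_real pi * \<i> * of_int n * z)) has_sum u) {n. n \<ge> - int (degree P) \<and> n \<noteq> 0} \<and>
       ((\<lambda>n. b n * of_real (upper_Gamma (1 - of_int k) (- 4 * pi * of_int n * Im z)) *
              exp (2 * of_real pi * \<i> * of_int n * z)) has_sum v) {n. n < 0} \<and> F z = u + v"
      by blast
  qed
  then show ?thesis by blast
qed

text \<open>Extending both families of coefficients by zero turns the two sums, which have different index sets, into one sum over
  all integers.\<close>

definition hol_coeff :: "nat \<Rightarrow> (int \<Rightarrow> complex) \<Rightarrow> int \<Rightarrow> complex"
  where "hol_coeff n0 a n = (if n \<ge> - int n0 \<and> n \<noteq> 0 then a n else 0)"

definition nonhol_coeff :: "int \<Rightarrow> (int \<Rightarrow> complex) \<Rightarrow> int \<Rightarrow> real \<Rightarrow> complex"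
  where "nonhol_coeff k b n y = (if n < 0 then b n * of_real (upper_Gamma (1 - of_int k) (- 4 * pi * of_int n * y)) else 0)"

lemma maass_expansion_has_sum:
  assumes "maass_expansion k F n0 a b" "y > 0"
  shows "((\<lambda>n. (hol_coeff n0 a n + nonhol_coeff k b n y) * ee n (Complex t y)) has_sum F (Complex t y)) UNIV"
proof -
  obtain u v where u: "((\<lambda>n. a n * exp (2 * of_real pi * \<i> * of_int n * Complex t y)) has_sum u) {n. n \<ge> - int n0 \<and> n \<noteq> 0}"
    and v: "((\<lambda>n. b n * of_real (upper_Gamma (1 - of_int k) (- 4 * pi * of_int n * Im (Complex t y))) *
              exp (2 * of_real pi * \<i> * of_int n * Complex t y)) has_sum v) {n. n < 0}"
    and uv: "F (Complex t y) = u + v"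
    using assms unfolding maass_expansion_def by (blast intro: Complex_in_upper [THEN iffD2])
  have "((\<lambda>n. hol_coeff n0 a n * ee n (Complex t y)) has_sum u) UNIV"
    by (rule has_sum_cong_neutral [THEN iffD1, OF _ _ _ u]) (auto simp: hol_coeff_def ee_def)
  moreover have "((\<lambda>n. nonhol_coeff k b n y * ee n (Complex t y)) has_sum v) UNIV"
    by (rule has_sum_cong_neutral [THEN iffD1, OF _ _ _ v]) (auto simp: nonhol_coeff_def ee_def)
  ultimately show ?thesis
    unfolding uv distrib_right by (rule has_sum_add)
qed

text \<open>At \<open>t = 0\<close> the hypothesis says that \<open>c\<close> is summable, which for complex families means absolutely summable; this
  dominates the integrated series.\<close>

lemma has_sum_line_integral:
  assumes sum: "\<And>t. ((\<lambda>n. c n * ee n (of_real t)) has_sum s t) UNIV" and K: "continuous_on {0..1} K"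
  shows "((\<lambda>n. c n * integral {0..1} (\<lambda>t. ee n (of_real t) * K t)) has_sum integral {0..1} (\<lambda>t. s t * K t)) UNIV"
proof -
  have "compact (K ` {0..1})" by (intro compact_continuous_image K) simp
  then have "bounded (K ` {0..1})" by (rule compact_imp_bounded)
  then obtain B where "\<forall>x\<in>K ` {0..1}. norm x \<le> B" unfolding bounded_iff by blast
  then have B: "\<And>t. t \<in> {0..1} \<Longrightarrow> norm (K t) \<le> B" by blast
  have "(\<lambda>n. c n * ee n (of_real 0)) summable_on UNIV" using sum [of 0] summable_on_def by blast
  then have "(\<lambda>n. norm (c n)) summable_on UNIV"
    by (simp add: summable_on_iff_abs_summable_on_complex)
  then have M: "(\<lambda>n. norm (c n) * B) summable_on UNIV"
    by (rule summable_on_cmult_left)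
  have "((\<lambda>n. integral {0..1} (\<lambda>t. c n * ee n (of_real t) * K t)) has_sum integral {0..1} (\<lambda>t. s t * K t)) UNIV"
  proof (rule has_sum_integral [OF _ _ M])
    show "continuous_on {0..1} (\<lambda>t. c n * ee n (of_real t) * K t)" for n
      by (intro continuous_intros K)
    show "norm (c n * ee n (of_real t) * K t) \<le> norm (c n) * B" if "t \<in> {0..1}" for n and t :: real
      using B [OF that] by (simp add: norm_mult norm_ee mult_left_mono)
    show "((\<lambda>n. c n * ee n (of_real t) * K t) has_sum s t * K t) UNIV" for t
      by (intro has_sum_cmult_left sum)
  qed
  then show ?thesis by (simp add: mult.assoc)
qed

text \<open>Uniqueness of the expansion: integrating it term by term against \<open>e(- n x)\<close> isolates the \<open>n\<close>-th term.\<close>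

lemma maass_expansion_fourier_at:
  assumes "maass_expansion k F n0 a b" "y > 0"
  shows "fourier_at F n y = (hol_coeff n0 a n + nonhol_coeff k b n y) * of_real (exp (- 2 * pi * of_int n * y))"
proof -
  define c where "c m = (hol_coeff n0 a m + nonhol_coeff k b m y) * of_real (exp (- 2 * pi * of_int m * y))" for m
  have "((\<lambda>m. c m * ee m (of_real t)) has_sum F (Complex t y)) UNIV" for t
    using maass_expansion_has_sum [OF assms, of t] by (simp add: c_def ee_Complex mult_ac)
  then have "((\<lambda>m. c m * integral {0..1} (\<lambda>t. ee m (of_real t) * ee (- n) (of_real t))) has_sum
      integral {0..1} (\<lambda>t. F (Complex t y) * ee (- n) (of_real t))) UNIV"
    by (rule has_sum_line_integral) (intro continuous_intros)
  then have 1: "((\<lambda>m. if m = n then c n else 0) has_sum fourier_at F n y) UNIV"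
    unfolding fourier_at_def fcoeff_def ee_mult integral_unique [OF ee_has_integral]
    by (rule has_sum_cong [THEN iffD1, rotated]) auto
  have "((\<lambda>m. if m = n then c n else 0) has_sum c n) UNIV"
    by (rule has_sum_finite_neutralI [of "{n}"]) auto
  with 1 show ?thesis unfolding c_def [symmetric] by (rule has_sum_unique)
qed

text \<open>Compares the derivative of \<open>e\<^sup>2\<^sup>\<pi>\<^sup>n\<^sup>y c\<^sub>n(y)\<close> obtained from the expansion with the one given by the differential equation.
  This applies to every expansion of \<open>F\<close>, in particular to the one selected to define the coefficients.\<close>

lemma maass_expansion_b:
  assumes F: "has_partials F Fx Fy" and per: "\<And>z. z \<in> \<H> \<Longrightarrow> F (z + 1) = F z"
    and cg: "cusp_expansion (xi_op k F) g"
    and exp: "maass_expansion k F n0 a b" and n: "n < 0"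
  shows "k \<le> 0 \<Longrightarrow> cnj (g (- n)) = - of_real ((- 4 * pi * of_int n) ^ (nat (- k) + 1)) * b n"
    and "k \<ge> 1 \<Longrightarrow> g (- n) = 0 \<Longrightarrow> b n = 0"
proof -
  define v where "v = - 4 * pi * of_int n"
  have v: "v > 0" using n by (simp add: v_def mult_pos_neg)
  define \<phi> where "\<phi> y = of_real (exp (2 * pi * of_int n * y)) * fourier_at F n y" for y
  have \<phi>: "\<phi> y = hol_coeff n0 a n + b n * of_real (upper_Gamma (1 - of_int k) (v * y))" if "y > 0" for y
  proof -
    have "\<phi> y = of_real (exp (2 * pi * of_int n * y) * exp (- 2 * pi * of_int n * y)) * (hol_coeff n0 a n + nonhol_coeff k b n y)"
      by (simp add: \<phi>_def maass_expansion_fourier_at [OF exp that] mult_ac)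
    then show ?thesis using n by (simp add: exp_add [symmetric] nonhol_coeff_def v_def)
  qed
  have der: "(\<phi> has_vector_derivative of_real (y powi (- k) * exp (- (v * y))) * cnj (g (- n))) (at y)" if "y > 0" for y
    using fourier_at_ode [OF F _ cusp_expansionD(2) [OF cg] that, of n] per by (simp add: \<phi>_def [abs_def] v_def)
  show "cnj (g (- n)) = - of_real ((- 4 * pi * of_int n) ^ (nat (- k) + 1)) * b n" if k: "k \<le> 0"
  proof -
    have "((\<lambda>y. hol_coeff n0 a n + b n * of_real (upper_Gamma (1 - of_int k) (v * y))) has_vector_derivative
       0 + b n * - of_real (v ^ (nat (- k) + 1) * (1 ^ nat (- k) * exp (- (v * 1))))) (at 1)"
      by (intro has_vector_derivative_add has_vector_derivative_const has_vector_derivative_mult_right upper_Gamma_has_vector_derivative k v) simp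
    then have "(\<phi> has_vector_derivative 0 + b n * - of_real (v ^ (nat (- k) + 1) * (1 ^ nat (- k) * exp (- (v * 1))))) (at 1)"
      by (rule has_vector_derivative_transform_within_open [of _ _ _ "{0<..}"]) (auto simp: \<phi>)
    from vector_derivative_unique_at [OF this der [of 1]]
    have "b n * - of_real (v ^ (nat (- k) + 1)) * of_real (exp (- v)) = cnj (g (- n)) * of_real (exp (- v))"
      by (simp add: mult_ac)
    then have "b n * - of_real (v ^ (nat (- k) + 1)) = cnj (g (- n))"
      by (rule mult_right_cancel [THEN iffD1, rotated]) simp
    then show ?thesis by (simp add: v_def mult.commute)
  qed
  show "b n = 0" if k: "k \<ge> 1" and g0: "g (- n) = 0"
  proof -
    have "\<exists>c. \<forall>y\<in>{0<..}. \<phi> y = c"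
    proof (rule has_vector_derivative_zero_constant)
      fix y :: real assume "y \<in> {0<..}"
      then show "(\<phi> has_vector_derivative 0) (at y within {0<..})"
        using der [of y] g0 by (auto intro: has_vector_derivative_at_within)
    qed auto
    then have "\<phi> 1 = \<phi> 2" by auto
    then have "b n * of_real (upper_Gamma (1 - of_int k) v) = b n * of_real (upper_Gamma (1 - of_int k) (v * 2))"
      using \<phi> [of 1] \<phi> [of 2] by simp
    moreover have "upper_Gamma (1 - of_int k) (v * 2) < upper_Gamma (1 - of_int k) v"
      by (rule upper_Gamma_strict_decreasing) (use v k in auto)
    ultimately show ?thesis by auto
  qed
qed

section \<open>The operator \<open>\<xi>\<^sub>k\<close> and the slash action\<close>

lemma differentiable_has_partials:
  assumes "\<And>z. z \<in> \<H> \<Longrightarrow> f differentiable (at z)"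
    and "\<And>v. continuous_on \<H> (\<lambda>z. frechet_derivative f (at z) v)"
  shows "has_partials f (\<lambda>z. frechet_derivative f (at z) 1) (\<lambda>z. frechet_derivative f (at z) \<i>)"
  unfolding has_partials_def
proof (intro conjI ballI assms(2))
  fix z assume "z \<in> \<H>"
  then have der: "(f has_derivative frechet_derivative f (at z)) (at z)"
    using assms(1) frechet_derivative_works by blast
  then interpret bounded_linear "frechet_derivative f (at z)"
    by (rule has_derivative_bounded_linear)
  have "frechet_derivative f (at z) v = of_real (Re v) * frechet_derivative f (at z) 1 + of_real (Im v) * frechet_derivative f (at z) \<i>" for v
  proof -
    have "v = Re v *\<^sub>R 1 + Im v *\<^sub>R \<i>" by (simp add: complex_eq_iff)
    then have "frechet_derivative f (at z) v = frechet_derivative f (at z) (Re v *\<^sub>R 1 + Im v *\<^sub>R \<i>)"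
      by simp
    then show ?thesis unfolding add scaleR by (simp add: scaleR_conv_of_real)
  qed
  then have "frechet_derivative f (at z) = (\<lambda>v. of_real (Re v) * frechet_derivative f (at z) 1 + of_real (Im v) * frechet_derivative f (at z) \<i>)"
    by (rule ext)
  with der show "(f has_derivative (\<lambda>v. of_real (Re v) * frechet_derivative f (at z) 1 + of_real (Im v) * frechet_derivative f (at z) \<i>)) (at z)"
    by (rule has_derivative_eq_rhs)
qed

lemma smooth_has_partials:
  assumes "smooth_on \<H> f"
  shows "has_partials f (\<lambda>z. frechet_derivative f (at z) 1) (\<lambda>z. frechet_derivative f (at z) \<i>)"
proof -
  have "Ck_on (Suc 0) \<H> f" using assms unfolding smooth_on_def by blast
  then show ?thesis by (intro differentiable_has_partials) auto
qed

text \<open>The equation \<open>\<Delta>\<^sub>k f = 0\<close> is, up to conjugation and the factor \<open>y\<^sup>k\<close>, the Cauchy-Riemann equation for \<open>\<xi>\<^sub>k f\<close>.\<close>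

lemma xi_op_holomorphic:
  assumes f: "smooth_on \<H> f"
    and lap: "\<And>z. z \<in> \<H> \<Longrightarrow> hyp_Laplace k f z = 0"
  shows "xi_op k f holomorphic_on \<H>"
proof (rule holomorphic_onI)
  fix z assume z: "z \<in> \<H>"
  define y where "y = Im z"
  have y: "y > 0" using z by (simp add: y_def upper_half_plane_def)
  have "Ck_on (Suc (Suc 0)) \<H> f" using f unfolding smooth_on_def by blast
  then have dd: "(\<lambda>z. frechet_derivative f (at z) v) differentiable (at z)" for v
    using z by simp
  have "(\<lambda>z. (frechet_derivative f (at z) 1 + \<i> * frechet_derivative f (at z) \<i>) / 2) differentiable (at z)"
    by (intro differentiable_divide differentiable_add differentiable_mult dd differentiable_const) simp
  then have "d_dzbar f differentiable (at z)"
    by (simp add: d_dzbar_def [abs_def])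
  then have der: "(d_dzbar f has_derivative frechet_derivative (d_dzbar f) (at z)) (at z)"
    using frechet_derivative_works by blast
  define W W' where "W = d_dzbar f z" and "W' = frechet_derivative (d_dzbar f) (at z)"
  interpret W': bounded_linear W'
    unfolding W'_def using der by (rule has_derivative_bounded_linear)
  \<comment> \<open>the real differential of \<open>\<xi>\<^sub>k f\<close> at \<open>z\<close> by the product rule; the aim is \<open>D i = i D 1\<close>\<close>
  define D where "D v = 2 * \<i> * (of_real y powi k * cnj (W' v) + of_real (Im v) * (of_int k * of_real y powi (k - 1)) * cnj W)" for v
  have "((\<lambda>z. 2 * \<i> * (of_real (Im z) powi k * cnj (d_dzbar f z))) has_derivative D) (at z)"
    unfolding D_def W_def W'_def y_def using y
    by (auto intro!: derivative_eq_intros der simp: y_def)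
  then have GD: "(xi_op k f has_derivative D) (at z)"
    by (simp add: xi_op_def [abs_def] mult.assoc)
  have "- 4 * of_real y ^ 2 * ((W' 1 - \<i> * W' \<i>) / 2) + 2 * \<i> * of_int k * of_real y * W = 0"
    using lap [OF z] by (simp add: hyp_Laplace_def d_dz_def W_def W'_def y_def)
  moreover have "- 4 * of_real y ^ 2 * ((W' 1 - \<i> * W' \<i>) / 2) + 2 * \<i> * of_int k * of_real y * W =
      - (2 * of_real y) * (of_real y * (W' 1 - \<i> * W' \<i>) - \<i> * of_int k * W)"
    by (simp add: power2_eq_square field_simps)
  ultimately have "- (2 * of_real y) * (of_real y * (W' 1 - \<i> * W' \<i>) - \<i> * of_int k * W) = 0"
    by (simp only:)
  then have "of_real y * (W' 1 - \<i> * W' \<i>) - \<i> * of_int k * W = 0"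
    using y unfolding mult_eq_0_iff by simp
  then have "of_real y * (W' 1 - \<i> * W' \<i>) = \<i> * of_int k * W"
    by (simp only: right_minus_eq)
  then have "cnj (of_real y * (W' 1 - \<i> * W' \<i>)) = cnj (\<i> * of_int k * W)"
    by (rule arg_cong)
  then have cr: "of_real y * (cnj (W' 1) + \<i> * cnj (W' \<i>)) = - \<i> * of_int k * cnj W"
    by simp
  have powi: "of_real y powi k = of_real y powi (k - 1) * (of_real y :: complex)"
    using y power_int_add_1 [of "of_real y :: complex" "k - 1"] by simp
  have "D \<i> = 2 * \<i> * of_real y powi (k - 1) * (of_real y * cnj (W' \<i>) + of_int k * cnj W)"
    unfolding D_def powi by (simp add: algebra_simps)
  also have "of_int k * cnj W = - (\<i> * \<i>) * (of_int k * cnj W)"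
    by simp
  also have "\<dots> = \<i> * (- \<i> * of_int k * cnj W)"
    by (simp only: mult_ac mult_minus_left mult_minus_right)
  also have "\<dots> = \<i> * (of_real y * (cnj (W' 1) + \<i> * cnj (W' \<i>)))"
    unfolding cr by simp
  also have "2 * \<i> * of_real y powi (k - 1) * (of_real y * cnj (W' \<i>) + \<i> * (of_real y * (cnj (W' 1) + \<i> * cnj (W' \<i>))))
     = \<i> * D 1"
    unfolding D_def powi by (simp add: algebra_simps)
  finally have Di: "D \<i> = \<i> * D 1" .
  interpret D: bounded_linear D by (rule has_derivative_bounded_linear [OF GD])
  have "D v = D 1 * v" for v
  proof -
    have v: "v = Re v *\<^sub>R 1 + Im v *\<^sub>R \<i>" by (simp add: complex_eq_iff)
    have "D v = D (Re v *\<^sub>R 1 + Im v *\<^sub>R \<i>)" using v by simp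
    also have "\<dots> = of_real (Re v) * D 1 + of_real (Im v) * (\<i> * D 1)"
      unfolding D.add D.scaleR Di by (simp add: scaleR_conv_of_real)
    also have "\<dots> = D 1 * (of_real (Re v) + \<i> * of_real (Im v))" by (simp add: algebra_simps)
    also have "of_real (Re v) + \<i> * of_real (Im v) = v" by (simp add: complex_eq_iff)
    finally show ?thesis .
  qed
  then have "D = (*) (D 1)" by blast
  with GD have "(xi_op k f has_field_derivative D 1) (at z)"
    by (simp add: has_field_derivative_def)
  then show "xi_op k f field_differentiable at z within \<H>"
    using field_differentiable_at_within field_differentiable_def by blast
qed

text \<open>For holomorphic \<open>\<phi>\<close> and \<open>\<mu>\<close> only \<open>f\<close> contributes to \<open>\<partial>/\<partial>zbar\<close>, and the chain rule produces the conjugate of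
  \<open>\<mu>'\<close>.\<close>

lemma xi_op_compose:
  assumes f: "has_partials f fx fy"
    and \<phi>: "\<phi> holomorphic_on \<H>" and \<mu>: "\<mu> holomorphic_on \<H>"
    and \<mu>H: "\<And>z. z \<in> \<H> \<Longrightarrow> \<mu> z \<in> \<H>"
  shows "\<exists>Fx Fy. has_partials (\<lambda>z. \<phi> z * f (\<mu> z)) Fx Fy"
    and "z \<in> \<H> \<Longrightarrow> xi_op k (\<lambda>z. \<phi> z * f (\<mu> z)) z =
       of_real (Im z / Im (\<mu> z)) powi k * cnj (\<phi> z) * deriv \<mu> z * xi_op k f (\<mu> z)"
proof -
  define L where "L z w = of_real (Re w) * fx (\<mu> z) + of_real (Im w) * fy (\<mu> z)" for z w
  define Fx where "Fx z = deriv \<phi> z * f (\<mu> z) + \<phi> z * L z (deriv \<mu> z)" for z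
  define Fy where "Fy z = \<i> * deriv \<phi> z * f (\<mu> z) + \<phi> z * L z (\<i> * deriv \<mu> z)" for z
  have c\<mu>: "continuous_on \<H> \<mu>" and c\<phi>: "continuous_on \<H> \<phi>"
    using \<mu> \<phi> holomorphic_on_imp_continuous_on by auto
  have cd: "continuous_on \<H> (deriv \<phi>)" "continuous_on \<H> (deriv \<mu>)"
    by (intro holomorphic_on_imp_continuous_on holomorphic_deriv \<phi> \<mu> open_upper_half_plane)+
  have \<mu>H': "\<mu> ` \<H> \<subseteq> \<H>" using \<mu>H by blast
  note cf = has_partials_continuous(1) [OF f, THEN continuous_on_compose2, OF c\<mu> \<mu>H']
    has_partials_continuous(2) [OF f, THEN continuous_on_compose2, OF c\<mu> \<mu>H']
    has_partials_continuous(3) [OF f, THEN continuous_on_compose2, OF c\<mu> \<mu>H']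
  have part: "has_partials (\<lambda>z. \<phi> z * f (\<mu> z)) Fx Fy"
    unfolding has_partials_def
  proof (intro conjI ballI)
    show "continuous_on \<H> Fx" "continuous_on \<H> Fy"
      unfolding Fx_def Fy_def L_def by (intro continuous_intros c\<phi> cd cf)+
    fix z assume z: "z \<in> \<H>"
    have d\<phi>: "(\<phi> has_derivative (*) (deriv \<phi> z)) (at z)" and d\<mu>: "(\<mu> has_derivative (*) (deriv \<mu> z)) (at z)"
      using holomorphic_derivI [OF \<phi> open_upper_half_plane z] holomorphic_derivI [OF \<mu> open_upper_half_plane z]
      by (auto simp: has_field_derivative_def)
    have "((\<lambda>z. f (\<mu> z)) has_derivative (\<lambda>v. L z (deriv \<mu> z * v))) (at z)"
      unfolding L_def by (rule has_derivative_compose [OF d\<mu>]) (rule has_partialsD [OF f \<mu>H [OF z]])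
    from has_derivative_mult [OF d\<phi> this]
    have "((\<lambda>z. \<phi> z * f (\<mu> z)) has_derivative (\<lambda>v. \<phi> z * L z (deriv \<mu> z * v) + deriv \<phi> z * v * f (\<mu> z))) (at z)" .
    moreover have "\<phi> z * L z (deriv \<mu> z * v) + deriv \<phi> z * v * f (\<mu> z) = of_real (Re v) * Fx z + of_real (Im v) * Fy z" for v
    proof -
      have v: "v = of_real (Re v) + \<i> * of_real (Im v)" by (simp add: complex_eq_iff)
      have "L z (deriv \<mu> z * v) = of_real (Re v) * L z (deriv \<mu> z) + of_real (Im v) * L z (\<i> * deriv \<mu> z)"
        by (simp add: L_def algebra_simps)
      moreover have "deriv \<phi> z * v * f (\<mu> z) = of_real (Re v) * (deriv \<phi> z * f (\<mu> z)) + of_real (Im v) * (\<i> * deriv \<phi> z * f (\<mu> z))"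
        by (subst v) (simp add: algebra_simps)
      ultimately show ?thesis unfolding Fx_def Fy_def by (simp add: algebra_simps)
    qed
    ultimately show "((\<lambda>z. \<phi> z * f (\<mu> z)) has_derivative (\<lambda>v. of_real (Re v) * Fx z + of_real (Im v) * Fy z)) (at z)"
      by simp
  qed
  then show "\<exists>Fx Fy. has_partials (\<lambda>z. \<phi> z * f (\<mu> z)) Fx Fy" by blast
  assume z: "z \<in> \<H>"
  have y: "Im (\<mu> z) > 0" using \<mu>H [OF z] by (simp add: upper_half_plane_def)
  have "Fx z + \<i> * Fy z = \<phi> z * cnj (deriv \<mu> z) * (fx (\<mu> z) + \<i> * fy (\<mu> z))"
  proof -
    have eq: "cnj (deriv \<mu> z) = of_real (Re (deriv \<mu> z)) - \<i> * of_real (Im (deriv \<mu> z))" by (simp add: complex_eq_iff)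
    show ?thesis unfolding eq Fx_def Fy_def L_def by (simp add: algebra_simps)
  qed
  then have "d_dzbar (\<lambda>z. \<phi> z * f (\<mu> z)) z = \<phi> z * cnj (deriv \<mu> z) * d_dzbar f (\<mu> z)"
    by (simp add: has_partials_d_dzbar [OF part z] has_partials_d_dzbar [OF f \<mu>H [OF z]])
  moreover have "of_real (Im z / Im (\<mu> z)) powi k * of_real (Im (\<mu> z)) powi k = (of_real (Im z) powi k :: complex)"
    using y by (simp add: power_int_mult_distrib [symmetric])
  ultimately show "xi_op k (\<lambda>z. \<phi> z * f (\<mu> z)) z =
       of_real (Im z / Im (\<mu> z)) powi k * cnj (\<phi> z) * deriv \<mu> z * xi_op k f (\<mu> z)"
    by (simp add: xi_op_def mult_ac)
qed

abbreviation ent_a :: "int ^ 2 ^ 2 \<Rightarrow> int" where "ent_a A \<equiv> A $ 1 $ 1"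
abbreviation ent_b :: "int ^ 2 ^ 2 \<Rightarrow> int" where "ent_b A \<equiv> A $ 1 $ 2"
abbreviation ent_c :: "int ^ 2 ^ 2 \<Rightarrow> int" where "ent_c A \<equiv> A $ 2 $ 1"
abbreviation ent_d :: "int ^ 2 ^ 2 \<Rightarrow> int" where "ent_d A \<equiv> A $ 2 $ 2"

definition autofactor :: "int ^ 2 ^ 2 \<Rightarrow> complex \<Rightarrow> complex"
  where "autofactor A z = of_int (ent_c A) * z + of_int (ent_d A)"

definition mobius :: "int ^ 2 ^ 2 \<Rightarrow> complex \<Rightarrow> complex"
  where "mobius A z = (of_int (ent_a A) * z + of_int (ent_b A)) / autofactor A z"

lemma slash_altdef: "slash k A f z = autofactor A z powi (- k) * f (mobius A z)"
  by (simp add: slash_def autofactor_def mobius_def)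

lemma SL2Z_iff: "A \<in> SL2Z \<longleftrightarrow> ent_a A * ent_d A - ent_b A * ent_c A = 1"
  by (simp add: SL2Z_def det_2)

lemma autofactor_nonzero:
  assumes "A \<in> SL2Z" "z \<in> \<H>"
  shows "autofactor A z \<noteq> 0"
proof
  assume 0: "autofactor A z = 0"
  then have "Im (autofactor A z) = 0" by simp
  then have c: "ent_c A = 0"
    using assms by (simp add: autofactor_def upper_half_plane_def)
  with 0 have "ent_d A = 0" by (simp add: autofactor_def)
  with c assms show False by (simp add: SL2Z_iff)
qed

lemma mobius_Im:
  assumes "A \<in> SL2Z" "z \<in> \<H>"
  shows "Im (mobius A z) = Im z / (norm (autofactor A z))\<^sup>2"
proof -
  have det: "real_of_int (ent_a A) * of_int (ent_d A) - of_int (ent_b A) * of_int (ent_c A) = 1"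
    using arg_cong [OF assms(1) [unfolded SL2Z_iff], of real_of_int] by simp
  have "Im (mobius A z) = Im ((of_int (ent_a A) * z + of_int (ent_b A)) * cnj (autofactor A z)) / (norm (autofactor A z))\<^sup>2"
    unfolding mobius_def by (subst complex_div_cnj) (simp only: of_real_power [symmetric] Im_divide_of_real)
  also have "Im ((of_int (ent_a A) * z + of_int (ent_b A)) * cnj (autofactor A z)) =
      (real_of_int (ent_a A) * of_int (ent_d A) - of_int (ent_b A) * of_int (ent_c A)) * Im z"
  proof -
    have "Im ((of_int a * z + of_int b) * cnj (of_int c * z + of_int d)) =
        (real_of_int a * of_int d - of_int b * of_int c) * Im z" for a b c d
      by (simp add: algebra_simps)
    then show ?thesis unfolding autofactor_def .
  qed
  finally show ?thesis by (simp add: det)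
qed

lemma mobius_upper:
  assumes "A \<in> SL2Z" "z \<in> \<H>"
  shows "mobius A z \<in> \<H>"
  using assms mobius_Im [OF assms] autofactor_nonzero [OF assms]
  by (simp add: upper_half_plane_def)

lemma matrix_mult_2:
  fixes A B :: "int ^ 2 ^ 2"
  shows "ent_a (A ** B) = ent_a A * ent_a B + ent_b A * ent_c B"
    and "ent_b (A ** B) = ent_a A * ent_b B + ent_b A * ent_d B"
    and "ent_c (A ** B) = ent_c A * ent_a B + ent_d A * ent_c B"
    and "ent_d (A ** B) = ent_c A * ent_b B + ent_d A * ent_d B"
  by (simp_all add: matrix_matrix_mult_def sum_2)

lemma SL2Z_mult: "A \<in> SL2Z \<Longrightarrow> B \<in> SL2Z \<Longrightarrow> A ** B \<in> SL2Z"
  by (simp add: SL2Z_def det_mul)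

lemma autofactor_mult:
  assumes "B \<in> SL2Z" "z \<in> \<H>"
  shows "autofactor (A ** B) z = autofactor A (mobius B z) * autofactor B z"
proof -
  have "(c * a' + d * c') * z + (c * b' + d * d') = (c * ((a' * z + b') / j) + d) * j"
    if "j = c' * z + d'" "j \<noteq> 0" for a' b' c' d' c d j :: complex
    using that by (simp add: field_simps)
  from this [OF autofactor_def [of B z] autofactor_nonzero [OF assms]] show ?thesis
    unfolding autofactor_def [of "A ** B"] autofactor_def [of A] mobius_def [of B] matrix_mult_2 by simp
qed

lemma mobius_mult:
  assumes "A \<in> SL2Z" "B \<in> SL2Z" "z \<in> \<H>"
  shows "mobius (A ** B) z = mobius A (mobius B z)"
proof -
  have B: "autofactor B z \<noteq> 0" by (rule autofactor_nonzero [OF assms(2,3)])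
  have "(a * a' + b * c') * z + (a * b' + b * d') = (a * ((a' * z + b') / j) + b) * j"
    if "j = c' * z + d'" "j \<noteq> 0" for a' b' c' d' a b j :: complex
    using that by (simp add: field_simps)
  from this [OF autofactor_def [of B z] B]
  have "of_int (ent_a (A ** B)) * z + of_int (ent_b (A ** B)) =
      (of_int (ent_a A) * mobius B z + of_int (ent_b A)) * autofactor B z"
    unfolding mobius_def [of B] matrix_mult_2 by simp
  then have "mobius (A ** B) z = ((of_int (ent_a A) * mobius B z + of_int (ent_b A)) * autofactor B z) / (autofactor A (mobius B z) * autofactor B z)"
    unfolding mobius_def [of "A ** B"] autofactor_mult [OF assms(2,3)] by simp
  then show ?thesis using B by (simp add: mobius_def [of A])
qed

lemma slash_mult:
  assumes "A \<in> SL2Z" "B \<in> SL2Z" "z \<in> \<H>"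
  shows "slash k (A ** B) f z = slash k B (slash k A f) z"
  by (simp add: slash_altdef autofactor_mult [OF assms(2,3)] mobius_mult [OF assms] power_int_mult_distrib mult_ac)

definition mat2 :: "int \<Rightarrow> int \<Rightarrow> int \<Rightarrow> int \<Rightarrow> int ^ 2 ^ 2"
  where "mat2 a b c d = vector [vector [a, b], vector [c, d]]"

lemma mat2_simps [simp]:
  "ent_a (mat2 a b c d) = a" "ent_b (mat2 a b c d) = b" "ent_c (mat2 a b c d) = c" "ent_d (mat2 a b c d) = d"
  by (simp_all add: mat2_def)

lemma mat2_SL2Z: "mat2 a b c d \<in> SL2Z \<longleftrightarrow> a * d - b * c = 1"
  by (simp add: SL2Z_iff)

text \<open>Matrices with the same bottom row modulo \<open>N\<close> differ by left multiplication with \<open>A B\<^sup>-\<^sup>1\<close>, which lies in \<open>\<Gamma>\<^sub>0(N)\<close>. Hence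
  \<open>f\<close> has only finitely many slash transforms, and each of them has period \<open>N\<close>.\<close>

lemma slash_congruent:
  fixes A B :: "int ^ 2 ^ 2"
  assumes f: "\<And>A z. A \<in> Gamma0 N \<Longrightarrow> z \<in> \<H> \<Longrightarrow> slash k A f z = f z"
    and A: "A \<in> SL2Z" and B: "B \<in> SL2Z" and z: "z \<in> \<H>"
    and cong: "int N dvd ent_c A - ent_c B" "int N dvd ent_d A - ent_d B"
  shows "slash k A f z = slash k B f z"
proof -
  define B' where "B' = mat2 (ent_d B) (- ent_b B) (- ent_c B) (ent_a B)"
  have B': "B' \<in> SL2Z" using B by (simp add: B'_def mat2_SL2Z SL2Z_iff mult.commute)
  have BB: "(A ** B') ** B = A"
  proof -
    have "B' ** B = mat 1"
      using B by (simp add: B'_def vec_eq_iff forall_2 matrix_mult_2 mat_def SL2Z_iff algebra_simps)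
    then show ?thesis by (simp add: matrix_mul_assoc [symmetric])
  qed
  have "ent_c (A ** B') = (ent_c A - ent_c B) * ent_d B - (ent_d A - ent_d B) * ent_c B"
    unfolding matrix_mult_2 B'_def mat2_simps by (simp only: left_diff_distrib) simp
  also have "int N dvd \<dots>"
    by (intro dvd_diff dvd_mult2 cong)
  finally have "A ** B' \<in> Gamma0 N"
    using SL2Z_mult [OF A B'] by (simp add: Gamma0_def)
  then have "slash k B (slash k (A ** B') f) z = slash k B f z"
    unfolding slash_altdef [of k B] using f mobius_upper [OF B z] by simp
  then show ?thesis
    using slash_mult [OF SL2Z_mult [OF A B'] B z, of k f] by (simp add: BB)
qed

lemma mobius_scaled_deriv:
  assumes A: "A \<in> SL2Z" and s: "s \<ge> 1" and z: "z \<in> \<H>"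
  shows "((\<lambda>z. mobius A (of_nat s * z)) has_field_derivative of_nat s / (autofactor A (of_nat s * z))\<^sup>2) (at z)"
proof -
  have sz: "of_nat s * z \<in> \<H>" using z s by (simp add: upper_half_plane_def)
  have det: "complex_of_int (ent_a A) * of_int (ent_d A) - of_int (ent_b A) * of_int (ent_c A) = 1"
    using arg_cong [OF A [unfolded SL2Z_iff], of complex_of_int] by simp
  note nz = autofactor_nonzero [OF A sz]
  have "((\<lambda>z. mobius A (of_nat s * z)) has_field_derivative
     ((of_int (ent_a A) * of_nat s) * autofactor A (of_nat s * z) -
      (of_int (ent_a A) * (of_nat s * z) + of_int (ent_b A)) * (of_int (ent_c A) * of_nat s)) / (autofactor A (of_nat s * z) * autofactor A (of_nat s * z))) (at z)"
    using nz unfolding mobius_def autofactor_def by (auto intro!: derivative_eq_intros)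
  moreover have "(of_int (ent_a A) * of_nat s) * autofactor A (of_nat s * z) -
      (of_int (ent_a A) * (of_nat s * z) + of_int (ent_b A)) * (of_int (ent_c A) * of_nat s) =
      of_nat s * (complex_of_int (ent_a A) * of_int (ent_d A) - of_int (ent_b A) * of_int (ent_c A))"
  proof -
    have "a * n * (c * (n * z) + d) - (a * (n * z) + b) * (c * n) = n * (a * d - b * c)" for a b c d n :: complex
      by (simp add: algebra_simps)
    then show ?thesis unfolding autofactor_def .
  qed
  ultimately show ?thesis by (simp add: det power2_eq_square)
qed

text \<open>The operator \<open>\<xi>\<^sub>k\<close> intertwines the actions of weight \<open>k\<close> and \<open>2 - k\<close>. The scaling \<open>z \<mapsto> s z\<close> is built in because a
  transform of \<open>f\<close> has period \<open>N\<close>, while the expansions above are for period \<open>1\<close>.\<close>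

lemma xi_op_slash:
  assumes f: "has_partials f fx fy" and A: "A \<in> SL2Z" and s: "s \<ge> 1"
  shows "\<exists>Fx Fy. has_partials (\<lambda>z. slash k A f (of_nat s * z)) Fx Fy"
    and "z \<in> \<H> \<Longrightarrow> xi_op k (\<lambda>z. slash k A f (of_nat s * z)) z =
       of_nat s powi (1 - k) * slash (2 - k) A (xi_op k f) (of_nat s * z)"
    and "g holomorphic_on \<H> \<Longrightarrow> (\<lambda>z. slash l A g (of_nat s * z)) holomorphic_on \<H>"
proof -
  let ?j = "\<lambda>z. autofactor A (of_nat s * z)" and ?\<mu> = "\<lambda>z. mobius A (of_nat s * z)"
  have sz: "of_nat s * z \<in> \<H>" if "z \<in> \<H>" for z
    using that s by (simp add: upper_half_plane_def)
  have nz: "?j z \<noteq> 0" if "z \<in> \<H>" for z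
    by (rule autofactor_nonzero [OF A sz [OF that]])
  have j: "?j holomorphic_on \<H>" unfolding autofactor_def by (intro holomorphic_intros)
  have \<phi>: "(\<lambda>z. ?j z powi l) holomorphic_on \<H>" for l
    using nz by (intro holomorphic_intros j) auto
  have \<mu>: "?\<mu> holomorphic_on \<H>"
    unfolding mobius_def using nz by (intro holomorphic_intros j) auto
  have \<mu>H: "?\<mu> z \<in> \<H>" if "z \<in> \<H>" for z
    by (rule mobius_upper [OF A sz [OF that]])
  show "\<exists>Fx Fy. has_partials (\<lambda>z. slash k A f (of_nat s * z)) Fx Fy"
    unfolding slash_altdef by (rule xi_op_compose(1) [OF f \<phi> \<mu> \<mu>H])
  show "(\<lambda>z. slash l A g (of_nat s * z)) holomorphic_on \<H>" if g: "g holomorphic_on \<H>"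
    unfolding slash_altdef using holomorphic_on_compose_gen [OF \<mu> g] \<mu>H
    by (intro holomorphic_intros \<phi>) (auto simp: o_def)
  assume z: "z \<in> \<H>"
  define J where "J = ?j z"
  have J: "J \<noteq> 0" unfolding J_def by (rule nz [OF z])
  have s0: "of_nat s \<noteq> (0::complex)" using s by simp
  have "Im (?\<mu> z) = of_nat s * Im z / (norm J)\<^sup>2"
    unfolding J_def mobius_Im [OF A sz [OF z]] by simp
  then have "Im z / Im (?\<mu> z) = (norm J)\<^sup>2 / of_nat s"
    using z s J by (simp add: upper_half_plane_def)
  then have Im: "complex_of_real (Im z / Im (?\<mu> z)) = J * cnj J / of_nat s"
    by (simp add: complex_norm_square del: of_real_power)
  have "xi_op k (\<lambda>z. slash k A f (of_nat s * z)) z =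
      (J * cnj J / of_nat s) powi k * cnj (J powi (- k)) * (of_nat s / J\<^sup>2) * xi_op k f (?\<mu> z)"
    using xi_op_compose(2) [OF f \<phi> \<mu> _ z, of k "- k"] \<mu>H
    unfolding slash_altdef Im DERIV_imp_deriv [OF mobius_scaled_deriv [OF A s z]] J_def by simp
  also have "(J * cnj J / of_nat s) powi k * cnj (J powi (- k)) * (of_nat s / J\<^sup>2) =
      of_nat s powi (1 - k) * J powi (- (2 - k))"
  proof -
    have "(J * cnj J / of_nat s) powi k * cnj (J powi (- k)) = J powi k / of_nat s powi k"
      using J by (simp add: power_int_mult_distrib power_int_divide_distrib power_int_minus field_simps)
    moreover have "J powi (- (2 - k)) = J powi k / J\<^sup>2"
      using J by (simp add: power_int_diff)
    moreover have "of_nat s powi (1 - k) = (of_nat s :: complex) / of_nat s powi k"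
      using s0 by (simp add: power_int_diff)
    ultimately show ?thesis by simp
  qed
  finally show "xi_op k (\<lambda>z. slash k A f (of_nat s * z)) z =
       of_nat s powi (1 - k) * slash (2 - k) A (xi_op k f) (of_nat s * z)"
    by (simp add: slash_altdef J_def mult_ac)
qed

lemma xi_op_cong:
  assumes f: "has_partials f fx fy" and eq: "\<And>z. z \<in> \<H> \<Longrightarrow> f z = g z" and z: "z \<in> \<H>"
  shows "xi_op k f z = xi_op k g z"
proof -
  have "(g has_derivative (\<lambda>v. of_real (Re v) * fx z + of_real (Im v) * fy z)) (at z)"
    by (rule has_derivative_transform_within_open [OF has_partialsD [OF f z] open_upper_half_plane z]) (use eq in auto)
  then have "frechet_derivative g (at z) = frechet_derivative f (at z)"
    using has_partialsD [OF f z] frechet_derivative_at by metis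
  then show ?thesis by (simp add: xi_op_def d_dzbar_def)
qed

section \<open>Reduction modulo the full modular group\<close>

text \<open>Choose a nonzero integral pair \<open>(c, d)\<close> that minimises \<open>\<bar>c z + d\<bar>\<close>. It is coprime, hence the bottom row of some matrix
  in \<open>SL\<^sub>2(\<int>)\<close>, and for the image \<open>w\<^sub>0\<close> of \<open>z\<close> minimality says \<open>\<bar>w\<^sub>0 - n\<bar> \<ge> 1\<close> for all integers \<open>n\<close>. With \<open>n\<close> nearest to
  \<open>Re w\<^sub>0\<close> this bounds \<open>Im w\<^sub>0\<close> from below; the bound \<open>1 / 2\<close> (instead of the optimal \<open>\<surd>3 / 2\<close>) is enough.\<close>

lemma reduction_to_fundamental_domain:
  assumes z: "z \<in> \<H>"
  obtains A w where "A \<in> SL2Z" and "z = mobius A w" and "Im w \<ge> 1 / 2" and "0 \<le> Re w" and "Re w \<le> 1"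
proof -
  have y: "Im z > 0" using z by (simp add: upper_half_plane_def)
  define lf where "lf p = norm (of_int (fst p) * z + of_int (snd p))" for p :: "int \<times> int"
  \<comment> \<open>the pair \<open>(0, 1)\<close> has value \<open>1\<close>, so a minimum over the finite set \<open>S\<close> is a global one\<close>
  define S where "S = {p. p \<noteq> (0, 0) \<and> lf p \<le> 1}"
  have lf_pos: "lf p > 0" if "p \<noteq> (0, 0)" for p
  proof -
    have "of_int (fst p) * z + of_int (snd p) \<noteq> 0"
    proof
      assume 0: "of_int (fst p) * z + of_int (snd p) = 0"
      then have "Im (of_int (fst p) * z + of_int (snd p)) = 0" by simp
      then have "fst p = 0" using y by simp
      with 0 that show False by (simp add: prod_eq_iff)
    qed
    then show ?thesis by (simp add: lf_def)
  qed
  have "finite S"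
  proof (rule finite_subset)
    define K where "K = \<lceil>1 / Im z\<rceil>"
    define M where "M = \<lceil>1 + of_int K * norm z\<rceil>"
    show "S \<subseteq> {- K..K} \<times> {- M..M}"
    proof
      fix p assume p: "p \<in> S"
      obtain c d where cd: "p = (c, d)" by (cases p)
      have le: "norm (of_int c * z + of_int d) \<le> 1" using p by (simp add: S_def lf_def cd)
      have "\<bar>Im (of_int c * z + of_int d)\<bar> \<le> 1" using abs_Im_le_cmod le order_trans by blast
      then have "of_int \<bar>c\<bar> * Im z \<le> 1" using y by (simp add: abs_mult)
      then have "of_int \<bar>c\<bar> \<le> 1 / Im z" using y by (simp add: field_simps)
      then have c: "\<bar>c\<bar> \<le> K" unfolding K_def by linarith
      have "norm (of_int d :: complex) \<le> norm (of_int c * z + of_int d) + norm (of_int c * z)"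
        using norm_triangle_ineq4 [of "of_int c * z + of_int d" "of_int c * z"] by simp
      also have "\<dots> \<le> 1 + of_int K * norm z"
        using le c by (intro add_mono) (auto simp: norm_mult intro!: mult_right_mono)
      finally have "of_int \<bar>d\<bar> \<le> 1 + of_int K * norm z" by simp
      then have "\<bar>d\<bar> \<le> M" unfolding M_def by linarith
      then show "p \<in> {- K..K} \<times> {- M..M}" using c by (auto simp: cd)
    qed
  qed simp
  moreover have "(0, 1) \<in> S" by (simp add: S_def lf_def)
  ultimately obtain p where p: "p \<in> S" and p_min: "\<And>q. q \<in> S \<Longrightarrow> lf p \<le> lf q"
    using ex_min_if_finite [of "lf ` S"] by (metis (no_types, lifting) arg_min_if_finite(1) arg_min_least empty_iff)
  have min: "lf p \<le> lf q" if "q \<noteq> (0, 0)" for q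
  proof (cases "lf q \<le> 1")
    case True
    then show ?thesis using p_min that by (simp add: S_def)
  next
    case False
    then show ?thesis using p by (simp add: S_def)
  qed
  obtain c d where cd: "p = (c, d)" by (cases p)
  have cd0: "(c, d) \<noteq> (0, 0)" using p by (simp add: S_def cd)
  have "coprime c d"
  proof -
    obtain c' d' where c': "c = c' * gcd c d" and d': "d = d' * gcd c d" and "coprime c' d'"
      using cd0 gcd_coprime_exists [of c d] by auto
    have g: "gcd c d > 0" using cd0 by auto
    have cd': "(c', d') \<noteq> (0, 0)" using cd0 c' d' by auto
    have "of_int c * z + of_int d = of_int (gcd c d) * (of_int c' * z + of_int d')"
      by (subst c', subst d') (simp add: algebra_simps)
    then have "lf p = of_int (gcd c d) * lf (c', d')"
      using g by (simp add: lf_def cd norm_mult)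
    then have "of_int (gcd c d) * lf (c', d') \<le> 1 * lf (c', d')" using min [OF cd'] by simp
    then have "of_int (gcd c d) \<le> (1::real)" using lf_pos [OF cd'] by (simp only: mult_le_cancel_right_pos)
    then have "gcd c d = 1" using g by linarith
    then show ?thesis by (simp add: coprime_iff_gcd_eq_1)
  qed
  then obtain u v where uv: "u * c + v * d = 1"
    using bezout_int [of c d] by auto
  define a b where "a = v" and "b = - u"
  have det: "a * d - b * c = 1" using uv by (simp add: a_def b_def)
  define w0 where "w0 = mobius (mat2 a b c d) z"
  have B: "mat2 a b c d \<in> SL2Z" using det by (simp add: mat2_SL2Z)
  have j: "of_int c * z + of_int d \<noteq> 0" using autofactor_nonzero [OF B z] by (simp add: autofactor_def)
  have w0: "w0 \<in> \<H>" unfolding w0_def by (rule mobius_upper [OF B z])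
  define n where "n = \<lfloor>Re w0 + 1 / 2\<rfloor>"
  have near: "\<bar>Re w0 - of_int n\<bar> \<le> 1 / 2" unfolding n_def by linarith
  have "norm (w0 - of_int n) \<ge> 1"
  proof -
    have "w0 = (of_int a * z + of_int b) / (of_int c * z + of_int d)"
      by (simp add: w0_def mobius_def autofactor_def)
    then have "w0 - of_int n = (of_int (a - n * c) * z + of_int (b - n * d)) / (of_int c * z + of_int d)"
      using j by (simp add: field_simps)
    then have "norm (w0 - of_int n) = lf (a - n * c, b - n * d) / lf p"
      by (simp add: lf_def cd norm_divide)
    moreover have "(a - n * c, b - n * d) \<noteq> (0, 0)"
    proof
      assume "(a - n * c, b - n * d) = (0, 0)"
      then have "a = n * c" "b = n * d" by auto
      with det show False by (simp add: algebra_simps)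
    qed
    ultimately show ?thesis using min lf_pos cd cd0 by simp
  qed
  then have "1 \<le> (norm (w0 - of_int n))\<^sup>2" by (simp add: one_le_power)
  also have "\<dots> = (Re w0 - of_int n)\<^sup>2 + (Im w0)\<^sup>2" by (simp add: cmod_power2)
  also have "(Re w0 - of_int n)\<^sup>2 \<le> (1 / 2)\<^sup>2" using near by (simp add: abs_le_square_iff [symmetric])
  finally have "(1 / 2)\<^sup>2 \<le> (Im w0)\<^sup>2" by (simp add: power2_eq_square)
  then have Im: "1 / 2 \<le> Im w0" using w0 by (simp add: upper_half_plane_def abs_le_square_iff [symmetric])
  define m where "m = \<lfloor>Re w0\<rfloor>"
  define w where "w = w0 - of_int m"
  have wH: "w \<in> \<H>" using w0 by (simp add: w_def upper_half_plane_def)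
  define A where "A = mat2 d (- b) (- c) a ** mat2 1 m 0 1"
  have T: "mat2 1 m 0 1 \<in> SL2Z" and B': "mat2 d (- b) (- c) a \<in> SL2Z" using det by (simp_all add: mat2_SL2Z algebra_simps)
  show thesis
  proof (rule that)
    show "A \<in> SL2Z" unfolding A_def by (rule SL2Z_mult [OF B' T])
    have "mobius A w = mobius (mat2 d (- b) (- c) a) (mobius (mat2 1 m 0 1) w)"
      unfolding A_def by (rule mobius_mult [OF B' T wH])
    also have "mobius (mat2 1 m 0 1) w = w0" by (simp add: mobius_def autofactor_def w_def)
    also have "mobius (mat2 d (- b) (- c) a) w0 = mobius (mat2 d (- b) (- c) a ** mat2 a b c d) z"
      unfolding w0_def by (rule mobius_mult [OF B' B z, symmetric])
    also have "mat2 d (- b) (- c) a ** mat2 a b c d = mat2 1 0 0 1"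
      using det by (simp add: vec_eq_iff forall_2 matrix_mult_2 algebra_simps)
    also have "mobius (mat2 1 0 0 1) z = z" by (simp add: mobius_def autofactor_def)
    finally show "z = mobius A w" by simp
    have "of_int m \<le> Re w0" "Re w0 \<le> of_int m + 1" unfolding m_def by linarith+
    then show "Im w \<ge> 1 / 2" "0 \<le> Re w" "Re w \<le> 1"
      using Im by (simp_all add: w_def)
  qed
qed

section \<open>Harmonic Maass cusp forms\<close>

lemma HC_basic:
  assumes "f \<in> HC k N"
  shows "has_partials f (\<lambda>z. frechet_derivative f (at z) 1) (\<lambda>z. frechet_derivative f (at z) \<i>)"
    and "xi_op k f holomorphic_on \<H>"
    and "A \<in> Gamma0 N \<Longrightarrow> z \<in> \<H> \<Longrightarrow> slash k A f z = f z"
    and "A \<in> SL2Z \<Longrightarrow> \<exists>P. principal_part (slash k A f) P \<and> coeff P 0 = 0"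
proof -
  from assms have "smooth_on \<H> f" and "\<And>z. z \<in> \<H> \<Longrightarrow> hyp_Laplace k f z = 0"
    by (auto simp: HC_def harmonic_maass_forms_def)
  then show "has_partials f (\<lambda>z. frechet_derivative f (at z) 1) (\<lambda>z. frechet_derivative f (at z) \<i>)"
    and "xi_op k f holomorphic_on \<H>"
    using smooth_has_partials xi_op_holomorphic by auto
  show "A \<in> Gamma0 N \<Longrightarrow> z \<in> \<H> \<Longrightarrow> slash k A f z = f z"
    using assms by (simp add: HC_def harmonic_maass_forms_def)
  assume A: "A \<in> SL2Z"
  then obtain P where "principal_part (slash k A f) P"
    using assms unfolding HC_def harmonic_maass_forms_def by blast
  moreover from this have "coeff P 0 = 0"
    using assms A unfolding HC_def by blast
  ultimately show "\<exists>P. principal_part (slash k A f) P \<and> coeff P 0 = 0" by blast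
qed

lemma slash_translation:
  shows "slash k (mat2 1 j 0 1) f z = f (z + of_int j)"
  by (simp add: slash_altdef autofactor_def mobius_def)

lemma HC_periodic:
  assumes "f \<in> HC k N" "z \<in> \<H>"
  shows "f (z + 1) = f z"
proof -
  have "mat2 1 1 0 1 \<in> Gamma0 N" by (simp add: Gamma0_def mat2_SL2Z)
  from HC_basic(3) [OF assms(1) this assms(2)] show ?thesis
    by (simp add: slash_translation)
qed

lemma HC_principal_part:
  assumes "f \<in> HC k N"
  obtains P where "principal_part f P" "coeff P 0 = 0"
proof -
  have "mat2 1 0 0 1 \<in> SL2Z" by (simp add: mat2_SL2Z)
  moreover have "slash k (mat2 1 0 0 1) f = f"
    by (rule ext) (simp add: slash_translation)
  ultimately show thesis using HC_basic(4) [OF assms] that by metis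
qed

lemma HC_cusp_expansion_infinity:
  assumes "f \<in> HC k N"
  shows "\<exists>g. cusp_expansion (xi_op k f) g"
proof -
  obtain P where P: "principal_part f P" "coeff P 0 = 0" by (rule HC_principal_part [OF assms])
  show ?thesis
    by (rule xi_expansion [OF HC_basic(1) [OF assms] _ HC_basic(2) [OF assms] P]) (rule HC_periodic [OF assms])
qed

text \<open>At the cusp \<open>A \<infinity>\<close> the transform of \<open>f\<close> has period \<open>N\<close>; in the variable \<open>z / N\<close> it is \<open>1\<close>-periodic and its principal
  part becomes a polynomial in \<open>q\<^sup>-\<^sup>N\<close>, still without constant term.\<close>

lemma HC_cusp_expansion:
  assumes f: "f \<in> HC k N" and N: "N \<ge> 1" and A: "A \<in> SL2Z"
  shows "\<exists>g. cusp_expansion (xi_op k (\<lambda>z. slash k A f (of_nat N * z))) g"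
proof -
  define F where "F z = slash k A f (of_nat N * z)" for z
  note fp = HC_basic(1) [OF f]
  obtain Fx Fy where F: "has_partials F Fx Fy"
    using xi_op_slash(1) [OF fp A N, of k] unfolding F_def [abs_def] by blast
  have per: "F (z + 1) = F z" if z: "z \<in> \<H>" for z
  proof -
    have Nz: "of_nat N * z \<in> \<H>" using z N by (simp add: upper_half_plane_def)
    have T: "mat2 1 (int N) 0 1 \<in> SL2Z" by (simp add: mat2_SL2Z)
    have "F (z + 1) = slash k (mat2 1 (int N) 0 1) (slash k A f) (of_nat N * z)"
      by (simp add: F_def slash_translation algebra_simps)
    also have "\<dots> = slash k (A ** mat2 1 (int N) 0 1) f (of_nat N * z)"
      by (rule slash_mult [OF A T Nz, symmetric])
    also have "\<dots> = slash k A f (of_nat N * z)"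
    proof (rule slash_congruent [OF HC_basic(3) [OF f] SL2Z_mult [OF A T] A Nz])
      show "int N dvd ent_c (A ** mat2 1 (int N) 0 1) - ent_c A" by (simp add: matrix_mult_2)
      have "ent_d (A ** mat2 1 (int N) 0 1) - ent_d A = ent_c A * int N" by (simp add: matrix_mult_2)
      then show "int N dvd ent_d (A ** mat2 1 (int N) 0 1) - ent_d A" by (simp only: dvd_triv_right)
    qed
    finally show ?thesis by (simp add: F_def)
  qed
  have hol: "xi_op k F holomorphic_on \<H>"
  proof -
    have "(\<lambda>z. of_nat N powi (1 - k) * slash (2 - k) A (xi_op k f) (of_nat N * z)) holomorphic_on \<H>"
      by (intro holomorphic_intros xi_op_slash(3) [OF fp A N] HC_basic(2) [OF f])
    then show ?thesis
      by (rule holomorphic_transform) (simp add: F_def [abs_def] xi_op_slash(2) [OF fp A N])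
  qed
  obtain P where P: "principal_part (slash k A f) P" "coeff P 0 = 0"
    using HC_basic(4) [OF f A] by blast
  then obtain \<epsilon> C Y where \<epsilon>: "\<epsilon> > 0" and
    b: "\<And>z. Im z > 0 \<and> Im z \<ge> Y \<Longrightarrow> norm (slash k A f z - poly P (exp (- 2 * of_real pi * \<i> * z))) \<le> C * exp (- \<epsilon> * Im z)"
    unfolding principal_part_def by blast
  have "principal_part F (P \<circ>\<^sub>p monom 1 N)"
    unfolding principal_part_def
  proof (intro exI conjI allI impI)
    show "\<epsilon> * of_nat N > 0" using \<epsilon> N by simp
    fix z assume z: "Im z > 0 \<and> Im z \<ge> \<bar>Y\<bar>"
    have "1 * Im z \<le> real N * Im z" using N z by (intro mult_right_mono) auto
    then have "Y \<le> real N * Im z" using z by linarith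
    then have "Im (of_nat N * z) > 0 \<and> Im (of_nat N * z) \<ge> Y" using z N by simp
    from b [OF this]
    have "norm (F z - poly P (exp (- 2 * of_real pi * \<i> * (of_nat N * z)))) \<le> C * exp (- \<epsilon> * Im (of_nat N * z))"
      by (simp add: F_def)
    moreover have "exp (- 2 * of_real pi * \<i> * (of_nat N * z)) = exp (- 2 * of_real pi * \<i> * z) ^ N"
      by (simp add: exp_of_nat_mult [symmetric] mult_ac)
    ultimately show "norm (F z - poly (P \<circ>\<^sub>p monom 1 N) (exp (- 2 * of_real pi * \<i> * z))) \<le> C * exp (- (\<epsilon> * of_nat N) * Im z)"
      by (simp add: poly_pcompose poly_monom mult_ac)
  qed
  moreover have "coeff (P \<circ>\<^sub>p monom 1 N) 0 = 0"
  proof -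
    have "coeff (P \<circ>\<^sub>p monom 1 N) 0 = poly (P \<circ>\<^sub>p monom 1 N) 0" by (simp add: poly_0_coeff_0)
    also have "\<dots> = poly P 0" using N by (simp add: poly_pcompose poly_monom power_0_left)
    finally show ?thesis using P(2) by (simp add: poly_0_coeff_0)
  qed
  ultimately have "\<exists>g. cusp_expansion (xi_op k F) g"
    by (intro xi_expansion [OF F _ hol]) (use per in auto)
  then show ?thesis by (simp add: F_def [abs_def])
qed

text \<open>The matrix \<open>- I\<close> belongs to \<open>\<Gamma>\<^sub>0(N)\<close>.\<close>

lemma HC_odd_weight_zero:
  assumes "f \<in> HC k N" "odd k" "z \<in> \<H>"
  shows "f z = 0"
proof -
  have "mat2 (- 1) 0 0 (- 1) \<in> Gamma0 N" by (simp add: Gamma0_def mat2_SL2Z)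
  from HC_basic(3) [OF assms(1) this assms(3)]
  have "(- 1) powi (- k) * f z = f z"
    by (simp add: slash_altdef autofactor_def mobius_def)
  moreover have "(- 1) powi (- k) = (- 1 :: complex)"
    using assms(2) by (simp add: power_int_minus_left)
  ultimately show ?thesis by simp
qed

text \<open>Here \<open>G = \<xi>\<^sub>k f\<close> is a holomorphic cusp form of weight \<open>2 - k = - 2 \<nu> \<le> 0\<close>, and \<open>h = \<bar>G\<bar> / y\<^sup>\<nu>\<close> is invariant
  under \<open>\<Gamma>\<^sub>0(N)\<close> and decays at every cusp. If \<open>G\<close> were nonzero, \<open>h\<close> would attain a positive maximum \<open>M\<close>, at \<open>z\<^sub>0\<close> say. Since
  \<open>y / \<bar>z - z\<^sub>0\<^sup>*\<bar>\<^sup>2\<close> is maximal at \<open>z = z\<^sub>0\<close> as well, the holomorphic function \<open>\<Phi> = G / (z - z\<^sub>0\<^sup>*)\<^sup>2\<^sup>\<nu>\<close> has maximal modulus at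
  \<open>z\<^sub>0\<close>, so it is constant; but then \<open>h \<ge> M\<close> everywhere, contradicting the decay.\<close>

lemma HC_xi_zero:
  assumes f: "f \<in> HC k N" and N: "N \<ge> 1" and k: "k = 2 * int \<nu> + 2" and z1: "z1 \<in> \<H>"
  shows "xi_op k f z1 = 0"
proof (rule ccontr)
  assume nz: "xi_op k f z1 \<noteq> 0"
  define G where "G = xi_op k f"
  define h where "h z = norm (G z) / Im z ^ \<nu>" for z
  note fp = HC_basic(1) [OF f]
  have G: "G holomorphic_on \<H>" unfolding G_def by (rule HC_basic(2) [OF f])
  have h_slash: "h (mobius A w) = norm (slash (2 - k) A G w) / Im w ^ \<nu>"
    if A: "A \<in> SL2Z" and w: "w \<in> \<H>" for A w
  proof -
    define j where "j = autofactor A w"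
    have j: "j \<noteq> 0" unfolding j_def by (rule autofactor_nonzero [OF A w])
    have "- (2 - k) = int (2 * \<nu>)" using k by simp
    then have "slash (2 - k) A G w = j ^ (2 * \<nu>) * G (mobius A w)"
      unfolding slash_altdef j_def [symmetric] by (simp only: power_int_of_nat)
    then have "norm (slash (2 - k) A G w) = ((norm j)\<^sup>2) ^ \<nu> * norm (G (mobius A w))"
      by (simp add: norm_mult norm_power power_mult)
    moreover have "h (mobius A w) = norm (G (mobius A w)) / (Im w ^ \<nu> / ((norm j)\<^sup>2) ^ \<nu>)"
      unfolding h_def mobius_Im [OF A w] j_def power_divide ..
    ultimately show ?thesis by simp
  qed
  have G_slash: "slash (2 - k) A G w = xi_op k (\<lambda>z. slash k A f z) w"
    if A: "A \<in> SL2Z" and w: "w \<in> \<H>" for A w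
    using xi_op_slash(2) [OF fp A _ w, of 1 k] by (simp add: G_def)
  have h_cong: "h (mobius A w) = h (mobius B w)"
    if A: "A \<in> SL2Z" and B: "B \<in> SL2Z" and w: "w \<in> \<H>"
      and "int N dvd ent_c A - ent_c B" "int N dvd ent_d A - ent_d B" for A B w
  proof -
    obtain Fx Fy where "has_partials (\<lambda>z. slash k A f (of_nat 1 * z)) Fx Fy"
      using xi_op_slash(1) [OF fp A, of 1 k] by auto
    then have F: "has_partials (\<lambda>z. slash k A f z) Fx Fy" by simp
    have "xi_op k (\<lambda>z. slash k A f z) w = xi_op k (\<lambda>z. slash k B f z) w"
      by (rule xi_op_cong [OF F _ w]) (rule slash_congruent [OF HC_basic(3) [OF f] A B]; use that in blast)
    then show ?thesis using A B w by (simp add: h_slash G_slash)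
  qed
  have h_decay: "\<exists>C. \<forall>w. Im w \<ge> 1 / 2 \<longrightarrow> h (mobius A w) \<le> C * exp (- (2 * pi / N) * Im w)"
    if A: "A \<in> SL2Z" for A
  proof -
    obtain g where g: "cusp_expansion (xi_op k (\<lambda>z. slash k A f (of_nat N * z))) g"
      using HC_cusp_expansion [OF f N A] by blast
    obtain C where C: "\<And>z. Im z \<ge> 1 / (2 * real N) \<Longrightarrow>
       norm (xi_op k (\<lambda>z. slash k A f (of_nat N * z)) z) \<le> C * exp (- 2 * pi * Im z)"
      by (rule cusp_expansion_decay [OF g, of "1 / (2 * real N)"]) (use N in auto)
    define c where "c = norm (of_nat N powi (1 - k) :: complex)"
    have c: "c > 0" using N by (simp add: c_def)
    show ?thesis
    proof (intro exI allI impI)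
      fix w assume w: "Im w \<ge> 1 / 2"
      then have wH: "w \<in> \<H>" by (simp add: upper_half_plane_def)
      define z where "z = w / of_nat N"
      have z: "of_nat N * z = w" "Im z = Im w / N" "z \<in> \<H>" "Im z \<ge> 1 / (2 * real N)"
        using N w by (auto simp: z_def upper_half_plane_def field_simps)
      have "c * norm (slash (2 - k) A G w) = norm (xi_op k (\<lambda>z. slash k A f (of_nat N * z)) z)"
        by (simp add: xi_op_slash(2) [OF fp A N z(3)] norm_mult c_def G_def z(1))
      also have "\<dots> \<le> C * exp (- 2 * pi * Im z)" by (rule C [OF z(4)])
      finally have 1: "norm (slash (2 - k) A G w) \<le> C / c * exp (- (2 * pi / N) * Im w)"
        using c by (simp add: field_simps z(2))
      have "0 \<le> C / c * exp (- (2 * pi / N) * Im w)" using 1 norm_ge_zero order_trans by blast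
      moreover have "(1 / 2) ^ \<nu> \<le> Im w ^ \<nu>" using w by (intro power_mono) auto
      ultimately have "C / c * exp (- (2 * pi / N) * Im w) / Im w ^ \<nu> \<le> C / c * exp (- (2 * pi / N) * Im w) / (1 / 2) ^ \<nu>"
        using w by (intro divide_left_mono) auto
      moreover have "norm (slash (2 - k) A G w) / Im w ^ \<nu> \<le> C / c * exp (- (2 * pi / N) * Im w) / Im w ^ \<nu>"
        using 1 w by (intro divide_right_mono) auto
      ultimately show "h (mobius A w) \<le> C / c * 2 ^ \<nu> * exp (- (2 * pi / N) * Im w)"
        unfolding h_slash [OF A wH] by (simp add: power_one_over mult_ac)
    qed
  qed
  \<comment> \<open>finitely many representatives \<open>R\<close> describe \<open>h\<close> near all cusps\<close>
  define res where "res A = (ent_c A mod int N, ent_d A mod int N)" for A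
  have "finite (res ` SL2Z)"
    by (rule finite_subset [of _ "{0..<int N} \<times> {0..<int N}"]) (use N in \<open>auto simp: res_def\<close>)
  then obtain R where R: "R \<subseteq> SL2Z" "finite R" "res ` SL2Z = res ` R"
    using finite_subset_image [of "res ` SL2Z" res SL2Z] by blast
  have rep: "\<exists>B\<in>R. \<forall>w\<in>\<H>. h (mobius A w) = h (mobius B w)" if A: "A \<in> SL2Z" for A
  proof -
    have "res A \<in> res ` R" using A R(3) by blast
    then obtain B where B: "B \<in> R" "res A = res B" by auto
    then have "int N dvd ent_c A - ent_c B" "int N dvd ent_d A - ent_d B"
      by (auto simp: res_def mod_eq_dvd_iff)
    then show ?thesis using h_cong [OF A] B R(1) by blast
  qed
  define \<eta> where "\<eta> = h z1"
  have \<eta>: "\<eta> > 0" using nz z1 by (simp add: \<eta>_def h_def G_def upper_half_plane_def)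
  have "\<forall>\<^sub>F y in at_top. \<forall>w. Im w = y \<longrightarrow> h (mobius B w) < \<eta>" if B: "B \<in> R" for B
  proof -
    obtain C where C: "\<And>w. Im w \<ge> 1 / 2 \<Longrightarrow> h (mobius B w) \<le> C * exp (- (2 * pi / N) * Im w)"
      using h_decay B R(1) by blast
    have "2 * pi / real N > 0" using N by simp
    then have "((\<lambda>y. C * (y ^ 0 * exp (- (2 * pi / N * y)))) \<longlongrightarrow> C * 0) at_top"
      by (intro tendsto_intros power_times_exp_tendsto_0)
    then have "((\<lambda>y. C * exp (- (2 * pi / N) * y)) \<longlongrightarrow> 0) at_top" by simp
    then have "\<forall>\<^sub>F y in at_top. C * exp (- (2 * pi / N) * y) < \<eta>"
      using \<eta> order_tendstoD(2) by blast
    then show ?thesis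
      using eventually_ge_at_top [of "1 / 2"] by eventually_elim (use C in force)
  qed
  then have "\<forall>\<^sub>F y in at_top. \<forall>B\<in>R. \<forall>w. Im w = y \<longrightarrow> h (mobius B w) < \<eta>"
    by (intro eventually_ball_finite R(2)) blast
  then obtain Y' where Y': "\<And>y B w. y \<ge> Y' \<Longrightarrow> B \<in> R \<Longrightarrow> Im w = y \<Longrightarrow> h (mobius B w) < \<eta>"
    unfolding eventually_at_top_linorder by blast
  define Y where "Y = max Y' 1"
  have Y: "h (mobius B w) < \<eta>" if "Im w \<ge> Y" "B \<in> R" for B w
    using Y' [OF _ that(2) refl, of w] that(1) by (simp add: Y_def)
  \<comment> \<open>above height \<open>Y\<close> the function \<open>h\<close> stays below the value \<open>\<eta>\<close> that it attains, so its supremum is taken over the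
    images of the compact box \<open>K\<close>\<close>
  define K where "K = cbox (Complex 0 (1 / 2)) (Complex 1 Y)"
  have K_iff: "w \<in> K \<longleftrightarrow> 0 \<le> Re w \<and> Re w \<le> 1 \<and> 1 / 2 \<le> Im w \<and> Im w \<le> Y" for w
    by (auto simp: K_def in_cbox_complex_iff)
  have KH: "K \<subseteq> \<H>" using K_iff by (auto simp: upper_half_plane_def)
  define V where "V = (\<Union>B\<in>R. (\<lambda>w. h (mobius B w)) ` K)"
  have "compact V"
    unfolding V_def
  proof (intro compact_UN R(2))
    fix B assume "B \<in> R"
    then have B: "B \<in> SL2Z" using R(1) by blast
    have "(\<lambda>z. slash (2 - k) B G z) holomorphic_on \<H>"
      using xi_op_slash(3) [OF fp B _ G, of 1 "2 - k"] by simp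
    then have "continuous_on K (\<lambda>z. slash (2 - k) B G z)"
      using holomorphic_on_imp_continuous_on continuous_on_subset KH by blast
    then have "continuous_on K (\<lambda>w. norm (slash (2 - k) B G w) / Im w ^ \<nu>)"
      by (intro continuous_intros) (auto simp: K_iff)
    then have "continuous_on K (\<lambda>w. h (mobius B w))"
      by (rule continuous_on_eq) (use h_slash [OF B] KH in auto)
    then show "compact ((\<lambda>w. h (mobius B w)) ` K)"
      by (rule compact_continuous_image) (simp add: K_def)
  qed
  have dom: "(\<exists>v\<in>V. h z = v) \<or> h z < \<eta>" if z: "z \<in> \<H>" for z
  proof -
    obtain A w where A: "A \<in> SL2Z" and w: "z = mobius A w" "Im w \<ge> 1 / 2" "0 \<le> Re w" "Re w \<le> 1"
      by (rule reduction_to_fundamental_domain [OF z])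
    obtain B where B: "B \<in> R" and hB: "\<forall>w\<in>\<H>. h (mobius A w) = h (mobius B w)"
      using rep [OF A] by blast
    have "w \<in> \<H>" using w(2) by (simp add: upper_half_plane_def)
    then have hz: "h z = h (mobius B w)" using hB w(1) by blast
    show ?thesis
    proof (cases "Im w \<le> Y")
      case True
      then have "w \<in> K" using w by (simp add: K_iff)
      then show ?thesis using B hz by (auto simp: V_def)
    next
      case False
      then show ?thesis using Y [of w B] B hz by simp
    qed
  qed
  have \<eta>V: "\<eta> \<in> V" using dom [OF z1] by (auto simp: \<eta>_def)
  then obtain M where M: "M \<in> V" "\<And>v. v \<in> V \<Longrightarrow> v \<le> M"
    using compact_attains_sup [OF \<open>compact V\<close>] by blast
  have \<eta>M: "\<eta> \<le> M" using M \<eta>V by blast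
  then have M0: "M > 0" using \<eta> by linarith
  have hM: "h z \<le> M" if "z \<in> \<H>" for z
    using dom [OF that] M(2) \<eta>M by force
  obtain B w where Bw: "B \<in> R" "w \<in> K" "M = h (mobius B w)" using M(1) by (auto simp: V_def)
  define z0 where "z0 = mobius B w"
  have z0: "z0 \<in> \<H>" unfolding z0_def using mobius_upper Bw R(1) KH by blast
  have hz0: "h z0 = M" by (simp add: z0_def Bw(3))
  define y0 where "y0 = Im z0"
  have y0: "y0 > 0" using z0 by (simp add: y0_def upper_half_plane_def)
  define \<Phi> where "\<Phi> z = G z / ((z - cnj z0)\<^sup>2) ^ \<nu>" for z
  have ne: "z - cnj z0 \<noteq> 0" if "z \<in> \<H>" for z
  proof -
    have "Im (z - cnj z0) > 0" using that y0 by (simp add: y0_def upper_half_plane_def)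
    then show ?thesis by force
  qed
  have \<Phi>: "\<Phi> holomorphic_on \<H>"
    unfolding \<Phi>_def using ne by (intro holomorphic_intros G) auto
  define r where "r z = Im z / (norm (z - cnj z0))\<^sup>2" for z
  have norm_\<Phi>: "norm (\<Phi> z) = h z * r z ^ \<nu>" if "z \<in> \<H>" for z
  proof -
    have "Im z ^ \<nu> \<noteq> 0" using that by (simp add: upper_half_plane_def)
    then show ?thesis
      by (simp add: \<Phi>_def h_def r_def norm_divide norm_power power_divide)
  qed
  have r: "0 \<le> r z" "r z \<le> 1 / (4 * y0)" if z: "z \<in> \<H>" for z
  proof -
    have y: "Im z > 0" using z by (simp add: upper_half_plane_def)
    then show "0 \<le> r z" by (simp add: r_def)
    have "4 * y0 * Im z \<le> (Im z + y0)\<^sup>2"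
      using zero_le_power2 [of "Im z - y0"] by (simp add: power2_eq_square algebra_simps)
    also have "\<dots> \<le> (norm (z - cnj z0))\<^sup>2"
      by (simp add: cmod_power2 y0_def)
    finally show "r z \<le> 1 / (4 * y0)"
      using y0 ne [OF z] by (simp add: r_def field_simps)
  qed
  \<comment> \<open>\<open>z\<^sub>0\<close> is the point of equality in the bound on \<open>r\<close>\<close>
  have "norm (z0 - cnj z0) = 2 * y0" using y0 by (simp add: complex_diff_cnj y0_def norm_mult)
  then have rz0: "r z0 = 1 / (4 * y0)" using y0 by (simp add: r_def y0_def [symmetric] power2_eq_square)
  have max: "norm (\<Phi> z) \<le> norm (\<Phi> z0)" if "z \<in> \<H>" for z
    unfolding norm_\<Phi> [OF that] norm_\<Phi> [OF z0] hz0 rz0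
    using hM [OF that] r [OF that] M0 by (intro mult_mono power_mono) auto
  have "convex \<H>" unfolding upper_half_plane_def by (rule convex_halfspace_Im_gt)
  then have "connected \<H>" by (rule convex_connected)
  then have "\<Phi> constant_on \<H>"
    using maximum_modulus_principle [OF \<Phi> open_upper_half_plane _ open_upper_half_plane _ z0 max] by blast
  then have const: "\<Phi> z = \<Phi> z0" if "z \<in> \<H>" for z
    using that z0 unfolding constant_on_def by metis
  have ge: "M \<le> h z" if z: "z \<in> \<H>" for z
  proof -
    have "M * (1 / (4 * y0)) ^ \<nu> = h z * r z ^ \<nu>"
      using const [OF z] norm_\<Phi> [OF z] norm_\<Phi> [OF z0] hz0 rz0 by metis
    also have "\<dots> \<le> h z * (1 / (4 * y0)) ^ \<nu>"
      using r [OF z] z by (intro mult_left_mono power_mono) (auto simp: h_def upper_half_plane_def)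
    finally show ?thesis using y0 by (simp add: mult_le_cancel_right)
  qed
  obtain B1 where B1: "B1 \<in> R" "\<forall>w\<in>\<H>. h (mobius (mat2 1 0 0 1) w) = h (mobius B1 w)"
    using rep [of "mat2 1 0 0 1"] by (auto simp: mat2_SL2Z)
  have YH: "Complex 0 Y \<in> \<H>" by (simp add: Y_def)
  have "h (Complex 0 Y) = h (mobius (mat2 1 0 0 1) (Complex 0 Y))" by (simp add: mobius_def autofactor_def)
  also have "\<dots> = h (mobius B1 (Complex 0 Y))" using B1(2) YH by blast
  also have "\<dots> < \<eta>" by (rule Y) (use B1 in auto)
  also have "\<eta> \<le> M" by (rule \<eta>M)
  also have "M \<le> h (Complex 0 Y)" by (rule ge [OF YH])
  finally show False by simp
qed

lemma HC_xi_zero_positive_weight: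
  assumes f: "f \<in> HC k N" and N: "N \<ge> 1" and k: "k \<ge> 1" and z: "z \<in> \<H>"
  shows "xi_op k f z = 0"
proof (cases "even k")
  case True
  then obtain l where "k = 2 * l" by blast
  then have "k = 2 * int (nat (l - 1)) + 2" using k by simp
  then show ?thesis by (rule HC_xi_zero [OF f N _ z])
next
  case False
  have "xi_op k f z = xi_op k (\<lambda>z. 0) z"
    by (rule xi_op_cong [OF HC_basic(1) [OF f] _ z]) (rule HC_odd_weight_zero [OF f False])
  then show ?thesis by (simp add: xi_op_def d_dzbar_def)
qed

text \<open>The chosen coefficient data form an actual expansion, because one exists.\<close>

lemma HC_maass_expansion:
  assumes f: "f \<in> HC k N" and N: "N \<ge> 1"
  shows "maass_expansion k f (coeff_start k f) (coeff_a k f) (coeff_b k f)"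
proof -
  obtain P where P: "principal_part f P" "coeff P 0 = 0" by (rule HC_principal_part [OF f])
  have "k \<le> 0 \<or> (\<forall>z\<in>\<H>. xi_op k f z = 0)"
    using HC_xi_zero_positive_weight [OF f N] by force
  then have "\<exists>n0 a b. maass_expansion k f n0 a b"
    by (intro maass_expansion_exists [OF HC_basic(1) [OF f] _ HC_basic(2) [OF f] P]) (use HC_periodic [OF f] in auto)
  then have "\<exists>x. case x of (n0, a, b) \<Rightarrow> maass_expansion k f n0 a b" by auto
  from someI_ex [OF this] show ?thesis
    by (simp add: coeff_start_def coeff_a_def coeff_b_def maass_data_def split: prod.splits)
qed

lemma xi_op_f_conj:
  assumes f: "has_partials f fx fy" and z: "z \<in> \<H>"
  shows "xi_op k (f_conj f) z = cnj (xi_op k f (- cnj z))"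
proof -
  have \<sigma>z: "- cnj z \<in> \<H>" using z by (simp add: upper_half_plane_def)
  have "((\<lambda>z. - cnj z) has_derivative (\<lambda>v. - cnj v)) (at z)"
    by (auto intro!: derivative_eq_intros)
  then have "((\<lambda>z. f (- cnj z)) has_derivative (\<lambda>v. of_real (Re (- cnj v)) * fx (- cnj z) + of_real (Im (- cnj v)) * fy (- cnj z))) (at z)"
    by (rule has_derivative_compose) (rule has_partialsD [OF f \<sigma>z])
  then have "((\<lambda>z. cnj (f (- cnj z))) has_derivative (\<lambda>v. cnj (of_real (Re (- cnj v)) * fx (- cnj z) + of_real (Im (- cnj v)) * fy (- cnj z)))) (at z)"
    by (rule has_derivative_cnj)
  then have "frechet_derivative (f_conj f) (at z) = (\<lambda>v. cnj (of_real (Re (- cnj v)) * fx (- cnj z) + of_real (Im (- cnj v)) * fy (- cnj z)))"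
    by (simp add: f_conj_def [abs_def] frechet_derivative_at [symmetric])
  then show ?thesis
    by (simp add: xi_op_def d_dzbar_def [of "f_conj f"] has_partials_d_dzbar [OF f \<sigma>z] algebra_simps flip: of_real_power_int)
qed

section \<open>Period integrals against Bernoulli polynomials\<close>

text \<open>The generating function of the Bernoulli numbers. The division is exact since \<open>exp X - 1\<close> has order \<open>1\<close>.\<close>

definition bern_fps :: "complex fps" where "bern_fps = fps_X / (fps_exp 1 - 1)"

lemma bern_fps_divides: "(fps_exp 1 - 1 :: complex fps) dvd fps_X"
proof -
  have "subdegree (fps_exp 1 - 1 :: complex fps) = 1"
    by (rule subdegreeI) auto
  moreover from this have "fps_exp 1 - 1 \<noteq> (0 :: complex fps)" by auto
  ultimately show ?thesis by (simp add: fps_dvd_iff)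
qed

lemma bern_fps_times: "bern_fps * (fps_exp 1 - 1) = fps_X"
  unfolding bern_fps_def by (rule dvd_div_mult_self [OF bern_fps_divides])

lemma bernpoly_altdef: "bernpoly n z = fact n * fps_nth (bern_fps * fps_exp z) n"
  unfolding bernpoly_def bern_fps_def by (simp add: dvd_div_mult [OF bern_fps_divides])

lemma bernpoly_sum: "bernpoly n z = fact n * (\<Sum>i\<le>n. fps_nth bern_fps i * (z ^ (n - i) / fact (n - i)))"
  by (simp add: bernpoly_altdef fps_mult_nth atLeast0AtMost)

lemma bernpoly_0: "bernpoly 0 z = 1"
proof -
  have "fps_nth (bern_fps * (fps_exp 1 - 1)) 1 = fps_nth fps_X 1" by (simp only: bern_fps_times)
  then have "fps_nth bern_fps 0 = 1" by (simp add: fps_mult_nth)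
  then show ?thesis by (simp add: bernpoly_sum)
qed

text \<open>Multiplying the generating function by \<open>exp X - 1\<close> cancels its denominator.\<close>

lemma bernpoly_difference: "bernpoly (Suc n) (z + 1) - bernpoly (Suc n) z = of_nat (Suc n) * z ^ n"
proof -
  have "bern_fps * fps_exp (z + 1) - bern_fps * fps_exp z = (bern_fps * (fps_exp 1 - 1)) * fps_exp z"
    by (simp add: fps_exp_add_mult algebra_simps)
  then have "bern_fps * fps_exp (z + 1) - bern_fps * fps_exp z = fps_X * fps_exp z"
    unfolding bern_fps_times .
  then have "fps_nth (bern_fps * fps_exp (z + 1) - bern_fps * fps_exp z) (Suc n) = fps_nth (fps_X * fps_exp z) (Suc n)"
    by (simp only:)
  then have "fps_nth (bern_fps * fps_exp (z + 1)) (Suc n) - fps_nth (bern_fps * fps_exp z) (Suc n) = z ^ n / fact n"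
    unfolding fps_sub_nth by simp
  then have "fact (Suc n) * (fps_nth (bern_fps * fps_exp (z + 1)) (Suc n) - fps_nth (bern_fps * fps_exp z) (Suc n)) = of_nat (Suc n) * z ^ n"
    by (simp add: mult.assoc)
  then show ?thesis
    unfolding bernpoly_altdef right_diff_distrib .
qed

lemma bernpoly_has_field_derivative:
  "(bernpoly (Suc n) has_field_derivative of_nat (Suc n) * bernpoly n z) (at z)"
proof -
  have d: "((\<lambda>z. z ^ Suc j / fact (Suc j)) has_field_derivative (z ^ j / fact j :: complex)) (at z)" for j
  proof -
    have "((\<lambda>z. z ^ Suc j / fact (Suc j)) has_field_derivative (of_nat (Suc j) * z ^ j / fact (Suc j) :: complex)) (at z)"
      by (rule derivative_eq_intros refl | simp del: power_Suc of_nat_Suc fact_Suc)+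
    then show ?thesis by (simp add: field_simps del: of_nat_Suc)
  qed
  have "bernpoly (Suc n) = (\<lambda>z. fact (Suc n) * ((\<Sum>i\<le>n. fps_nth bern_fps i * (z ^ Suc (n - i) / fact (Suc (n - i)))) + fps_nth bern_fps (Suc n)))"
    by (rule ext) (simp add: bernpoly_sum Suc_diff_le del: fact_Suc power_Suc)
  moreover have "((\<lambda>z. fact (Suc n) * ((\<Sum>i\<le>n. fps_nth bern_fps i * (z ^ Suc (n - i) / fact (Suc (n - i)))) + fps_nth bern_fps (Suc n)))
      has_field_derivative (fact (Suc n) * ((\<Sum>i\<le>n. fps_nth bern_fps i * (z ^ (n - i) / fact (n - i))) + 0))) (at z)"
    by (intro DERIV_cmult DERIV_add DERIV_sum DERIV_const d)
  ultimately show ?thesis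
    by (simp add: bernpoly_sum mult.assoc)
qed

lemma continuous_on_bernpoly [continuous_intros]:
  assumes "continuous_on S f"
  shows "continuous_on S (\<lambda>t. bernpoly n (f t))"
  unfolding bernpoly_sum by (intro continuous_intros assms) auto

text \<open>Integration by parts lowers \<open>r\<close> by one. The boundary term is \<open>B\<^sub>r(c + 1) - B\<^sub>r(c) = r c\<^sup>r\<^sup>-\<^sup>1\<close>, which contributes the
  summand \<open>l = r - 1\<close>.\<close>

lemma bernpoly_fourier_integral:
  assumes n: "n \<noteq> 0"
  defines "\<theta> \<equiv> 2 * of_real pi * \<i> * of_int n"
  shows "integral {0..1} (\<lambda>t. ee n (of_real t) * bernpoly r (of_real t + c)) =
    fact r * (\<Sum>l<r. (- 1) ^ (r - 1 - l) * c ^ l / (fact l * \<theta> ^ (r - l)))"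
proof (induction r)
  case 0
  then show ?case using integral_unique [OF ee_has_integral [of n]] n by (simp add: bernpoly_0)
next
  case (Suc r)
  define J where "J r = integral {0..1} (\<lambda>t. ee n (of_real t) * bernpoly r (of_real t + c))" for r
  have \<theta>: "\<theta> \<noteq> 0" using n by (simp add: \<theta>_def)
  have int: "((\<lambda>t. ee n (of_real t) * bernpoly r (of_real t + c)) has_integral J r) {0..1}" for r
    unfolding J_def by (intro integrable_integral integrable_continuous_real continuous_intros)
  have "((\<lambda>t. ee n (of_real t) * (of_nat (Suc r) * bernpoly r (of_real t + c)) + \<theta> * ee n (of_real t) * bernpoly (Suc r) (of_real t + c)) has_integral
     (ee n (of_real 1) * bernpoly (Suc r) (of_real 1 + c) - ee n (of_real 0) * bernpoly (Suc r) (of_real 0 + c))) {0..1}"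
  proof (rule fundamental_theorem_of_calculus)
    fix t :: real
    have "((\<lambda>z. z + c) has_field_derivative 1) (at (of_real t))"
      by (auto intro!: derivative_eq_intros)
    from DERIV_chain2 [OF bernpoly_has_field_derivative this]
    have "((\<lambda>z. bernpoly (Suc r) (z + c)) has_field_derivative of_nat (Suc r) * bernpoly r (of_real t + c)) (at (of_real t))"
      by (simp only: mult_1_right)
    then have "((\<lambda>t. bernpoly (Suc r) (of_real t + c)) has_vector_derivative of_nat (Suc r) * bernpoly r (of_real t + c)) (at t within {0..1})"
      by (rule has_vector_derivative_real_field)
    from has_vector_derivative_mult [OF ee_has_vector_derivative this]
    show "((\<lambda>t. ee n (of_real t) * bernpoly (Suc r) (of_real t + c)) has_vector_derivative
       ee n (of_real t) * (of_nat (Suc r) * bernpoly r (of_real t + c)) + \<theta> * ee n (of_real t) * bernpoly (Suc r) (of_real t + c)) (at t within {0..1})"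
      by (simp add: \<theta>_def mult.assoc)
  qed simp
  moreover have "((\<lambda>t. of_nat (Suc r) * (ee n (of_real t) * bernpoly r (of_real t + c)) + \<theta> * (ee n (of_real t) * bernpoly (Suc r) (of_real t + c))) has_integral
      (of_nat (Suc r) * J r + \<theta> * J (Suc r))) {0..1}"
    by (intro has_integral_add has_integral_mult_right int)
  ultimately have "of_nat (Suc r) * J r + \<theta> * J (Suc r) = bernpoly (Suc r) (c + 1) - bernpoly (Suc r) c"
    by (simp add: has_integral_unique mult_ac add.commute del: of_nat_Suc)
  then have rec: "of_nat (Suc r) * J r + \<theta> * J (Suc r) = of_nat (Suc r) * c ^ r"
    by (simp only: bernpoly_difference)
  define S where "S = (\<Sum>l<r. (- 1) ^ (r - 1 - l) * c ^ l / (fact l * \<theta> ^ (r - l)))"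
  have IH: "J r = fact r * S" using Suc.IH by (simp add: J_def S_def)
  have "(\<Sum>l<r. (- 1) ^ (Suc r - 1 - l) * c ^ l / (fact l * \<theta> ^ (Suc r - l))) = - S / \<theta>"
  proof -
    have "(- 1) ^ (Suc r - 1 - l) * c ^ l / (fact l * \<theta> ^ (Suc r - l)) = - ((- 1) ^ (r - 1 - l) * c ^ l / (fact l * \<theta> ^ (r - l))) / \<theta>"
      if "l < r" for l
    proof -
      have "Suc r - 1 - l = Suc (r - 1 - l)" "Suc r - l = Suc (r - l)" using that by auto
      then show ?thesis by simp
    qed
    then have "(\<Sum>l<r. (- 1) ^ (Suc r - 1 - l) * c ^ l / (fact l * \<theta> ^ (Suc r - l))) =
        (\<Sum>l<r. - ((- 1) ^ (r - 1 - l) * c ^ l / (fact l * \<theta> ^ (r - l))) / \<theta>)"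
      by (intro sum.cong) auto
    then show ?thesis by (simp add: S_def sum_divide_distrib sum_negf)
  qed
  then have "fact (Suc r) * (\<Sum>l<Suc r. (- 1) ^ (Suc r - 1 - l) * c ^ l / (fact l * \<theta> ^ (Suc r - l))) =
      of_nat (Suc r) * (fact r * (- S / \<theta> + c ^ r / (fact r * \<theta>)))"
    by (simp add: mult.assoc del: of_nat_Suc)
  also have "\<dots> = (of_nat (Suc r) * c ^ r - of_nat (Suc r) * J r) / \<theta>"
    using \<theta> unfolding IH by (simp add: field_simps del: of_nat_Suc)
  also have "\<dots> = J (Suc r)"
    using rec \<theta> by (simp add: field_simps del: of_nat_Suc)
  finally show ?case unfolding J_def by simp
qed

lemma incexp_of_real: "incexp p (of_real u :: complex) 1 = of_real (incexp p u 1)"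
  by (simp add: incexp_def)

text \<open>The case \<open>c = i\<close>: the powers of \<open>i\<close> coming from \<open>c\<close> and from \<open>\<theta> = i u\<close> combine to the same
  factor in every summand, and \<open>incexp\<close> remains.\<close>

lemma bernpoly_kernel_integral:
  assumes n: "n \<noteq> 0"
  shows "((\<lambda>t. ee n (of_real t) * (bernpoly (r + 1) (of_real t + \<i>) / of_nat (r + 1))) has_integral
    - (\<i> ^ (r + 1)) * incexp r (of_real (2 * pi * of_int n)) 1) {0..1}"
proof -
  define u where "u = complex_of_real (2 * pi * of_int n)"
  have u: "u \<noteq> 0" using n by (simp add: u_def)
  have \<theta>: "2 * of_real pi * \<i> * of_int n = \<i> * u" by (simp add: u_def)
  have nz: "of_nat (r + 1) \<noteq> (0 :: complex)" by (simp only: of_nat_eq_0_iff)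
  have "integral {0..1} (\<lambda>t. ee n (of_real t) * (bernpoly (r + 1) (of_real t + \<i>) / of_nat (r + 1))) =
      integral {0..1} (\<lambda>t. ee n (of_real t) * bernpoly (r + 1) (of_real t + \<i>)) / of_nat (r + 1)"
    by (simp add: times_divide_eq_right)
  also have "\<dots> = fact r * (\<Sum>l\<le>r. (- 1) ^ (r - l) * \<i> ^ l / (fact l * (\<i> * u) ^ (r + 1 - l)))"
    unfolding bernpoly_fourier_integral [OF n] \<theta>
    by (simp add: lessThan_Suc_atMost del: of_nat_Suc)
  also have "\<dots> = fact r * (\<Sum>l\<le>r. - (\<i> ^ (r + 1)) * (1 / (fact l * u ^ (r - l + 1))))"
  proof (intro arg_cong2 [where f = "(*)"] sum.cong refl)
    fix l assume l: "l \<in> {..r}"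
    define d where "d = r - l"
    have r: "r = l + d" using l by (simp add: d_def)
    have "\<i> ^ (d + 1) * \<i> ^ (d + 1) = (- 1) ^ (d + 1)"
      by (simp add: power_mult_distrib [symmetric] del: power_Suc)
    then have "(- 1) ^ d * \<i> ^ l = - (\<i> ^ (r + 1)) * \<i> ^ (d + 1)"
      by (simp add: r power_add mult_ac)
    then show "(- 1) ^ (r - l) * \<i> ^ l / (fact l * (\<i> * u) ^ (r + 1 - l)) = - (\<i> ^ (r + 1)) * (1 / (fact l * u ^ (r - l + 1)))"
      using u by (simp add: r power_mult_distrib field_simps Suc_diff_le)
  qed
  also have "\<dots> = - (\<i> ^ (r + 1)) * incexp r u 1"
    by (simp add: incexp_def sum_distrib_left mult_ac)
  finally have eq: "integral {0..1} (\<lambda>t. ee n (of_real t) * (bernpoly (r + 1) (of_real t + \<i>) / of_nat (r + 1))) =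
      - (\<i> ^ (r + 1)) * incexp r u 1" .
  have "(\<lambda>t. ee n (of_real t) * (bernpoly (r + 1) (of_real t + \<i>) / of_nat (r + 1))) integrable_on {0..1}"
    by (intro integrable_continuous_real continuous_intros) (use nz in simp)
  then show ?thesis
    unfolding u_def [symmetric] eq [symmetric] by (rule integrable_integral)
qed

text \<open>The factor \<open>e\<^sup>-\<^sup>2\<^sup>\<pi>\<^sup>n\<close> is the size of \<open>e(nz)\<close> on the line \<open>Im z = 1\<close>; the statement covers negative \<open>n\<close>, where the
  right-hand side is the continued exponential integral.\<close>

lemma expint_kernel_integral:
  assumes n: "n \<noteq> 0"
  shows "- (\<i> powi (- int m - 1)) * (of_real (exp (- 2 * pi * of_int n)) *
      integral {0..1} (\<lambda>t. ee n (of_real t) * (bernpoly (m + 1) (of_real t + \<i>) / of_nat (m + 1)))) =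
    expint_closed m (of_real (2 * pi * of_int n))"
proof -
  have ipow: "\<i> powi (- int m - 1) * \<i> ^ (m + 1) = 1"
  proof -
    have "- int m - 1 = - int (m + 1)" by simp
    moreover have "\<i> ^ (m + 1) \<noteq> 0" by simp
    ultimately show ?thesis by (simp only: power_int_minus power_int_of_nat left_inverse not_False_eq_True)
  qed
  have *: "- (\<i> powi (- int m - 1)) * (E * (- (\<i> ^ (m + 1)) * X)) = (\<i> powi (- int m - 1) * \<i> ^ (m + 1)) * (E * X)" for E X
    by (simp only: mult_ac mult_minus_left mult_minus_right minus_minus)
  show ?thesis
    unfolding integral_unique [OF bernpoly_kernel_integral [OF n]] * ipow
    by (simp add: expint_closed_def exp_of_real [symmetric])
qed

text \<open>The case \<open>c = 0\<close>, where only the summand \<open>l = 0\<close> survives. The factor \<open>i\<^sup>M\<close> makes the result real.\<close>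

lemma bernpoly_real_kernel_integral:
  assumes n: "n \<noteq> 0" and M: "M \<ge> 1"
  shows "((\<lambda>t. ee n (of_real t) * (\<i> ^ M * bernpoly M (of_real t))) has_integral
    (- 1) ^ (M - 1) * fact M / of_real (2 * pi * of_int n) ^ M) {0..1}"
proof -
  define U where "U = complex_of_real (2 * pi * of_int n)"
  have th: "2 * of_real pi * \<i> * of_int n = \<i> * U" by (simp add: U_def)
  have z: "(\<Sum>l<M. (- 1) ^ (M - 1 - l) * 0 ^ l / (fact l * (\<i> * U) ^ (M - l))) = (- 1) ^ (M - 1) / (\<i> * U) ^ M"
  proof -
    have "(\<Sum>l<M. (- 1) ^ (M - 1 - l) * 0 ^ l / (fact l * (\<i> * U) ^ (M - l))) =
        (\<Sum>l\<in>{0}. (- 1) ^ (M - 1 - l) * 0 ^ l / (fact l * (\<i> * U) ^ (M - l)))"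
      using M by (intro sum.mono_neutral_right) auto
    then show ?thesis by simp
  qed
  have "integral {0..1} (\<lambda>t. ee n (of_real t) * bernpoly M (of_real t + 0)) = fact M * ((- 1) ^ (M - 1) / (\<i> * U) ^ M)"
    unfolding bernpoly_fourier_integral [OF n] th z ..
  moreover have "((\<lambda>t. ee n (of_real t) * bernpoly M (of_real t + 0)) has_integral integral {0..1} (\<lambda>t. ee n (of_real t) * bernpoly M (of_real t + 0))) {0..1}"
    by (intro integrable_integral integrable_continuous_real continuous_intros)
  ultimately have "((\<lambda>t. \<i> ^ M * (ee n (of_real t) * bernpoly M (of_real t + 0))) has_integral \<i> ^ M * (fact M * ((- 1) ^ (M - 1) / (\<i> * U) ^ M))) {0..1}"
    by (intro has_integral_mult_right) simp
  moreover have "\<i> ^ M * (fact M * ((- 1) ^ (M - 1) / (\<i> * U) ^ M)) = (- 1) ^ (M - 1) * fact M / U ^ M"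
    by (simp add: power_mult_distrib)
  moreover have "(\<lambda>t. \<i> ^ M * (ee n (of_real t) * bernpoly M (of_real t + 0))) = (\<lambda>t. ee n (of_real t) * (\<i> ^ M * bernpoly M (of_real t)))"
    by (rule ext) (simp only: add_0_right mult_ac)
  ultimately show ?thesis by (simp only: U_def)
qed

text \<open>For \<open>k = - p\<close> the powers of \<open>i\<close> multiply to \<open>i\<^sup>k\<^sup>+\<^sup>m\<^sup>+\<^sup>2\<^sup>l i\<^sup>R\<^sup>+\<^sup>1 = i\<^sup>2\<^sup>(\<^sup>m\<^sup>+\<^sup>l\<^sup>+\<^sup>1\<^sup>)\<close>, a sign that depends on the parity of
  \<open>m - l\<close> only.\<close>

lemma c_const_times:
  assumes R: "R = m + p + 1"
  shows "c_const (- int p) m * (- (\<i> ^ (R + 1)) * X) =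
    (\<Sum>l\<le>m. (- 1) ^ (m - l + 1) * (fact m * fact (l + p) / fact l) * (X / fact R))"
proof -
  have 1: "nat (int l - (- int p)) = l + p" "nat (1 + int m - (- int p)) = R" for l
    by (simp_all add: R)
  have ipow: "\<i> powi (- int p + int m + 2 * int l) * \<i> ^ (R + 1) = (- 1) ^ (m - l + 1)" if "l \<le> m" for l
  proof -
    have "\<i> powi (- int p + int m + 2 * int l) * \<i> ^ (R + 1) = \<i> powi (- int p + int m + 2 * int l) * \<i> powi (int (R + 1))"
      by (simp only: power_int_of_nat)
    also have "\<dots> = \<i> powi (- int p + int m + 2 * int l + int (R + 1))"
      by (rule power_int_add [symmetric]) simp
    also have "- int p + int m + 2 * int l + int (R + 1) = int (2 * (m + l + 1))" by (simp add: R)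
    also have "\<i> powi (int (2 * (m + l + 1))) = (- 1) ^ (m + l + 1)"
      by (simp only: power_int_of_nat power_mult) simp
    also have "m + l + 1 = (m - l + 1) + 2 * l" using that by simp
    also have "(- 1 :: complex) ^ ((m - l + 1) + 2 * l) = (- 1) ^ (m - l + 1)"
      by (simp only: power_add power_mult) simp
    finally show ?thesis .
  qed
  have "(- 1) ^ (m - l + 1) * (fact m * fact (l + p) / fact l) * (X / fact R) =
      (fact m * fact (l + p) * \<i> powi (- int p + int m + 2 * int l) / (fact R * fact l)) * (\<i> ^ (R + 1) * X)" if "l \<in> {..m}" for l
  proof -
    have "l \<le> m" using that by simp
    show ?thesis
      unfolding ipow [OF \<open>l \<le> m\<close>, symmetric]
      by (simp only: times_divide_eq_left times_divide_eq_right divide_divide_eq_left mult_ac)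
  qed
  then have "(\<Sum>l\<le>m. (- 1) ^ (m - l + 1) * (fact m * fact (l + p) / fact l) * (X / fact R)) =
      (\<Sum>l\<le>m. (fact m * fact (l + p) * \<i> powi (- int p + int m + 2 * int l) / (fact R * fact l)) * (\<i> ^ (R + 1) * X))"
    by (rule sum.cong [OF refl])
  then show ?thesis
    unfolding c_const_def 1 by (simp only: sum_distrib_right [symmetric] mult_minus_left mult_minus_right minus_minus)
qed

text \<open>The factorial of the degree \<open>M = 1 + m - l - j\<close> cancels, and the sign becomes that of the \<open>c\<close>-term; the exponent of \<open>U\<close> is
  written so that it matches the summand \<open>s = j + l + p + 1\<close> of \<open>incexp R U 1\<close>.\<close>

lemma d_const_times:
  assumes l: "l \<le> m" and j: "j \<le> m - l" and R: "R = m + p + 1"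
  shows "d_const (- int p) m l j * ((- 1) ^ (1 + m - l - j - 1) * fact (1 + m - l - j) / U ^ (1 + m - l - j)) =
      (- 1) ^ (m - l + 1) * (fact m * fact (l + p) / fact l) * (1 / (fact (j + l + p + 1) * U ^ (R - (j + l + p + 1) + 1)))"
proof -
  define M where "M = 1 + m - l - j"
  have M1: "M - 1 = m - l - j" using j l by (simp add: M_def)
  have Rs: "R - (j + l + p + 1) + 1 = M" using j l by (simp add: R M_def)
  have sgn: "(- 1) powi (int j - 1) * (- 1) ^ (M - 1) = (- 1 :: complex) ^ (m - l + 1)"
  proof -
    have "(- 1) powi (int j - 1) = (- 1 :: complex) ^ (j + 1)"
    proof (cases "even j")
      case True
      then show ?thesis by (simp add: power_int_minus_left)
    next
      case False
      then show ?thesis by (simp add: power_int_minus_left)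
    qed
    moreover have "j + 1 + (m - l - j) = m - l + 1" using j by simp
    ultimately show ?thesis unfolding M1 by (metis power_add)
  qed
  have "d_const (- int p) m l j = fact m * ((- 1) powi (int j - 1) * fact (l + p) / (fact l * fact (j + l + p + 1) * fact M))"
  proof -
    have "nat (int l - (- int p)) = l + p" "nat (int j + int l - (- int p) + 1) = j + l + p + 1" by simp_all
    then show ?thesis by (simp only: d_const_def M_def)
  qed
  then have "d_const (- int p) m l j * ((- 1) ^ (M - 1) * fact M / U ^ M) =
      ((- 1) powi (int j - 1) * (- 1) ^ (M - 1)) * (fact m * fact (l + p) / fact l) * (1 / (fact (j + l + p + 1) * U ^ M))"
    by (simp add: mult_ac del: fact_Suc)
  then show ?thesis unfolding sgn Rs M_def [symmetric] .
qed

text \<open>In \<open>incexp R U 1 / R! = \<Sum>\<^sub>s\<^sub>\<le>\<^sub>R U\<^sup>s\<^sup>-\<^sup>R\<^sup>-\<^sup>1 / s!\<close> the subtracted terms are those with \<open>s > l + p\<close>; the others form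
  \<open>incexp (l + p) U 1\<close> up to a power of \<open>U\<close>.\<close>

lemma incexp_split:
  fixes U :: complex
  assumes l: "l \<le> m" and R: "R = m + p + 1"
  shows "(- 1) ^ (m - l + 1) * (fact m * fact (l + p) / fact l) * (incexp R U 1 / fact R) -
      (\<Sum>j\<le>m - l. (- 1) ^ (m - l + 1) * (fact m * fact (l + p) / fact l) * (1 / (fact (j + l + p + 1) * U ^ (R - (j + l + p + 1) + 1)))) =
    fact m / (fact l * (- U) ^ (m - l + 1)) * incexp (l + p) U 1"
proof -
  define C where "C = (- 1) ^ (m - l + 1) * (fact m * fact (l + p) / fact l :: complex)"
  have "incexp R U 1 / fact R = (\<Sum>s\<le>R. 1 / (fact s * U ^ (R - s + 1)))"
    by (simp add: incexp_def sum_divide_distrib)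
  also have "\<dots> = (\<Sum>s\<le>l + p. 1 / (fact s * U ^ (R - s + 1))) + (\<Sum>s\<in>{l + p + 1..R}. 1 / (fact s * U ^ (R - s + 1)))"
  proof -
    have "{..R} = {..l + p} \<union> {l + p + 1..R}" using l by (auto simp: R)
    then show ?thesis by (simp only:) (rule sum.union_disjoint, auto)
  qed
  also have "(\<Sum>s\<in>{l + p + 1..R}. 1 / (fact s * U ^ (R - s + 1))) = (\<Sum>j\<le>m - l. 1 / (fact (j + l + p + 1) * U ^ (R - (j + l + p + 1) + 1)))"
    by (rule sum.reindex_bij_witness [of _ "\<lambda>j. j + l + p + 1" "\<lambda>s. s - (l + p + 1)"]) (use l in \<open>auto simp: R\<close>)
  also have "(\<Sum>s\<le>l + p. 1 / (fact s * U ^ (R - s + 1))) = (\<Sum>s\<le>l + p. 1 / (fact s * U ^ (l + p - s + 1))) / U ^ (m - l + 1)"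
    unfolding sum_divide_distrib
  proof (rule sum.cong [OF refl])
    fix s assume "s \<in> {..l + p}"
    then have "R - s + 1 = (l + p - s + 1) + (m - l + 1)" using l by (simp add: R)
    then show "1 / (fact s * U ^ (R - s + 1)) = 1 / (fact s * U ^ (l + p - s + 1)) / U ^ (m - l + 1)"
      by (simp only: power_add) simp
  qed
  finally have "C * (incexp R U 1 / fact R) - (\<Sum>j\<le>m - l. C * (1 / (fact (j + l + p + 1) * U ^ (R - (j + l + p + 1) + 1)))) =
      C * ((\<Sum>s\<le>l + p. 1 / (fact s * U ^ (l + p - s + 1))) / U ^ (m - l + 1))"
    by (simp only: sum_distrib_left [symmetric] right_diff_distrib [symmetric] add_diff_cancel_right')
  also have "(\<Sum>s\<le>l + p. 1 / (fact s * U ^ (l + p - s + 1))) = incexp (l + p) U 1 / fact (l + p)"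
    by (simp add: incexp_def sum_divide_distrib)
  also have "C * (incexp (l + p) U 1 / fact (l + p) / U ^ (m - l + 1)) = fact m / (fact l * ((- 1) ^ (m - l + 1) * U ^ (m - l + 1))) * incexp (l + p) U 1"
    unfolding C_def by (cases "even (m - l)") simp_all
  also have "(- 1) ^ (m - l + 1) * U ^ (m - l + 1) = (- U) ^ (m - l + 1)"
    by (simp only: power_mult_distrib [symmetric] mult_minus1)
  finally show ?thesis unfolding C_def .
qed

text \<open>The sum on the right is the one produced by integration by parts of the incomplete Gamma moment; the factor \<open>e\<^sup>u\<close> will cancel
  against the exponential in the expansion of \<open>\<xi>\<^sub>k f\<close> on the line \<open>Im z = 1\<close>.\<close>

lemma xi_kernel_integral:
  assumes n: "n > 0" and k: "k \<le> 0"
  defines "u \<equiv> 2 * pi * of_int n" and "p \<equiv> nat (- k)"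
  shows "integral {0..1} (\<lambda>t. ee n (of_real t) * xi_kernel k m (Complex t 1)) =
    of_real (exp u) * of_real (\<Sum>l\<le>m. fact m / (fact l * (- u) ^ (m - l + 1)) * (exp (- u) * incexp (l + p) u 1))"
proof -
  define R where "R = m + p + 1"
  define U where "U = complex_of_real u"
  have kp: "k = - int p" using k by (simp add: p_def)
  have n0: "n \<noteq> 0" using n by simp
  have cR: "Complex t 1 = of_real t + \<i>" for t by (simp add: complex_eq_iff)
  have I1: "((\<lambda>t. ee n (of_real t) * (bernpoly (R + 1) (of_real t + \<i>) / of_nat (R + 1))) has_integral
      - (\<i> ^ (R + 1)) * incexp R U 1) {0..1}"
    using bernpoly_kernel_integral [OF n0, of R] by (simp only: U_def u_def)
  have I2: "((\<lambda>t. ee n (of_real t) * (\<i> ^ M * bernpoly M (of_real t))) has_integral (- 1) ^ (M - 1) * fact M / U ^ M) {0..1}"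
    if "M \<ge> 1" for M
    using bernpoly_real_kernel_integral [OF n0 that] by (simp only: U_def u_def)
  have "((\<lambda>t. c_const k m * (ee n (of_real t) * (bernpoly (R + 1) (of_real t + \<i>) / of_nat (R + 1))) -
      (\<Sum>l\<le>m. \<Sum>j\<le>m - l. d_const k m l j * (ee n (of_real t) * (\<i> ^ (1 + m - l - j) * bernpoly (1 + m - l - j) (of_real t))))) has_integral
      (c_const k m * (- (\<i> ^ (R + 1)) * incexp R U 1) - (\<Sum>l\<le>m. \<Sum>j\<le>m - l. d_const k m l j * ((- 1) ^ (1 + m - l - j - 1) * fact (1 + m - l - j) / U ^ (1 + m - l - j))))) {0..1}"
    by (intro has_integral_diff has_integral_mult_right has_integral_sum I1 I2) auto
  moreover have "(\<lambda>t. c_const k m * (ee n (of_real t) * (bernpoly (R + 1) (of_real t + \<i>) / of_nat (R + 1))) -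
      (\<Sum>l\<le>m. \<Sum>j\<le>m - l. d_const k m l j * (ee n (of_real t) * (\<i> ^ (1 + m - l - j) * bernpoly (1 + m - l - j) (of_real t))))) =
      (\<lambda>t. ee n (of_real t) * xi_kernel k m (Complex t 1))"
  proof
    fix t :: real
    have "nat (2 + int m - k) = R + 1" "(of_int (2 + int m - k) :: complex) = of_nat (R + 1)"
      by (simp_all add: kp R_def)
    then show "c_const k m * (ee n (of_real t) * (bernpoly (R + 1) (of_real t + \<i>) / of_nat (R + 1))) -
      (\<Sum>l\<le>m. \<Sum>j\<le>m - l. d_const k m l j * (ee n (of_real t) * (\<i> ^ (1 + m - l - j) * bernpoly (1 + m - l - j) (of_real t)))) =
      ee n (of_real t) * xi_kernel k m (Complex t 1)"
      unfolding xi_kernel_def cR [symmetric] right_diff_distrib sum_distrib_left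
      by (intro arg_cong2 [where f = "(-)"] sum.cong refl) (simp_all only: mult_ac complex.sel times_divide_eq_right)
  qed
  ultimately have "integral {0..1} (\<lambda>t. ee n (of_real t) * xi_kernel k m (Complex t 1)) =
      c_const k m * (- (\<i> ^ (R + 1)) * incexp R U 1) - (\<Sum>l\<le>m. \<Sum>j\<le>m - l. d_const k m l j * ((- 1) ^ (1 + m - l - j - 1) * fact (1 + m - l - j) / U ^ (1 + m - l - j)))"
    by (simp only: integral_unique)
  also have "c_const k m * (- (\<i> ^ (R + 1)) * incexp R U 1) = (\<Sum>l\<le>m. (- 1) ^ (m - l + 1) * (fact m * fact (l + p) / fact l) * (incexp R U 1 / fact R))"
    unfolding kp by (rule c_const_times [OF R_def])
  also have "(\<Sum>l\<le>m. \<Sum>j\<le>m - l. d_const k m l j * ((- 1) ^ (1 + m - l - j - 1) * fact (1 + m - l - j) / U ^ (1 + m - l - j))) =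
     (\<Sum>l\<le>m. \<Sum>j\<le>m - l. (- 1) ^ (m - l + 1) * (fact m * fact (l + p) / fact l) * (1 / (fact (j + l + p + 1) * U ^ (R - (j + l + p + 1) + 1))))"
    unfolding kp by (intro sum.cong refl d_const_times R_def) auto
  also have "(\<Sum>l\<le>m. (- 1) ^ (m - l + 1) * (fact m * fact (l + p) / fact l) * (incexp R U 1 / fact R)) -
     (\<Sum>l\<le>m. \<Sum>j\<le>m - l. (- 1) ^ (m - l + 1) * (fact m * fact (l + p) / fact l) * (1 / (fact (j + l + p + 1) * U ^ (R - (j + l + p + 1) + 1)))) =
      (\<Sum>l\<le>m. fact m / (fact l * (- U) ^ (m - l + 1)) * incexp (l + p) U 1)"
    unfolding sum_subtractf [symmetric] by (intro sum.cong refl incexp_split R_def) auto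
  also have "\<dots> = of_real (exp u) * of_real (\<Sum>l\<le>m. fact m / (fact l * (- u) ^ (m - l + 1)) * (exp (- u) * incexp (l + p) u 1))"
  proof -
    have "of_real (exp u) * of_real (\<Sum>l\<le>m. fact m / (fact l * (- u) ^ (m - l + 1)) * (exp (- u) * incexp (l + p) u 1)) =
      complex_of_real (\<Sum>l\<le>m. fact m / (fact l * (- u) ^ (m - l + 1)) * ((exp u * exp (- u)) * incexp (l + p) u 1))"
      unfolding of_real_mult [symmetric] sum_distrib_left
      by (intro arg_cong [where f = complex_of_real] sum.cong refl) (simp only: mult_ac)
    also have "exp u * exp (- u) = 1" by (simp add: exp_add [symmetric])
    finally show ?thesis by (simp add: U_def incexp_of_real)
  qed
  finally show ?thesis .
qed

section \<open>The limit of the L-series\<close>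

text \<open>For \<open>\<bar>z\<bar> \<ge> 1\<close> all negative powers of \<open>z\<close> in the closed form of \<open>E\<^sub>-\<^sub>m(z)\<close> are bounded by \<open>1\<close>.\<close>

definition expint_bound :: "nat \<Rightarrow> real"
  where "expint_bound m = (\<Sum>l\<le>m. fact m / fact l)"

lemma expint_bound_nonneg: "0 \<le> expint_bound m"
  unfolding expint_bound_def by (intro sum_nonneg) simp

lemma norm_expint_closed_le:
  assumes "norm z \<ge> 1"
  shows "norm (expint_closed m z) \<le> exp (- Re z) * expint_bound m"
proof -
  have "norm (incexp m z 1) \<le> (\<Sum>l\<le>m. norm (fact m / (fact l * z ^ (m - l + 1)) * 1 ^ l))"
    unfolding incexp_def by (rule norm_sum)
  also have "\<dots> \<le> expint_bound m"
    unfolding expint_bound_def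
  proof (rule sum_mono)
    fix l
    have "1 \<le> norm z ^ (m - l + 1)" using assms by (rule one_le_power)
    then have "(fact m / fact l) / norm z ^ (m - l + 1) \<le> fact m / (fact l :: real)"
      by (simp add: divide_le_eq mult_le_cancel_left1 del: power_Suc)
    then show "norm (fact m / (fact l * z ^ (m - l + 1)) * 1 ^ l) \<le> fact m / fact l"
      by (simp add: norm_divide norm_mult norm_power)
  qed
  finally show ?thesis
    by (simp add: expint_closed_def norm_mult)
qed

lemma tendsto_expint_closed:
  assumes "c \<noteq> 0"
  shows "((\<lambda>x. expint_closed m (c + \<i> * of_real x)) \<longlongrightarrow> expint_closed m c) (at_right 0)"
proof -
  have "((\<lambda>x::real. c + \<i> * of_real x) \<longlongrightarrow> c + \<i> * of_real 0) (at_right 0)"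
    by (intro tendsto_intros)
  then have c: "((\<lambda>x::real. c + \<i> * of_real x) \<longlongrightarrow> c) (at_right 0)" by simp
  show ?thesis
    unfolding expint_closed_def incexp_def by (intro tendsto_intros c) (use assms in auto)
qed

text \<open>The bound is independent of \<open>w\<close>, as dominated convergence for \<open>w \<rightarrow> 0\<close> requires. The exponent \<open>p + 1\<close> is chosen to
  match the size of the Fourier coefficients of \<open>\<xi>\<^sub>k f\<close>.\<close>

lemma norm_incgamma_moment_le:
  assumes u: "u \<ge> 1" and w: "Re w \<ge> 0"
  shows "norm (incgamma_moment p m u w) \<le>
    (2 * u) ^ (p + 1) * exp (- u) * (\<Sum>j\<le>p. fact p / fact j * expint_bound (j + m))"
proof -
  have nz: "norm (of_real u + w) \<ge> 1"
    using abs_Re_le_cmod [of "of_real u + w"] u w by simp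
  have "norm (incgamma_moment p m u w) \<le> (\<Sum>j\<le>p. norm (of_real (fact p / fact j * (2 * u) ^ j) * expint_closed (j + m) (of_real u + w)))"
    unfolding incgamma_moment_def by (rule norm_sum)
  also have "\<dots> \<le> (\<Sum>j\<le>p. (2 * u) ^ (p + 1) * exp (- u) * (fact p / fact j * expint_bound (j + m)))"
  proof (rule sum_mono)
    fix j assume j: "j \<in> {..p}"
    have "norm (expint_closed (j + m) (of_real u + w)) \<le> exp (- Re (of_real u + w)) * expint_bound (j + m)"
      by (rule norm_expint_closed_le [OF nz])
    also have "\<dots> \<le> exp (- u) * expint_bound (j + m)"
      using w by (intro mult_right_mono expint_bound_nonneg) simp
    finally have 1: "norm (expint_closed (j + m) (of_real u + w)) \<le> exp (- u) * expint_bound (j + m)" .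
    have 2: "(2 * u) ^ j \<le> (2 * u) ^ (p + 1)"
      using u j by (intro power_increasing) auto
    have "norm (of_real (fact p / fact j * (2 * u) ^ j) * expint_closed (j + m) (of_real u + w)) =
        fact p / fact j * (2 * u) ^ j * norm (expint_closed (j + m) (of_real u + w))"
      using u by (simp add: norm_mult norm_divide norm_power)
    also have "\<dots> \<le> fact p / fact j * (2 * u) ^ (p + 1) * (exp (- u) * expint_bound (j + m))"
      using u by (intro mult_mono mult_left_mono 1 2) auto
    also have "\<dots> = (2 * u) ^ (p + 1) * exp (- u) * (fact p / fact j * expint_bound (j + m))"
      by (simp only: mult_ac)
    finally show "norm (of_real (fact p / fact j * (2 * u) ^ j) * expint_closed (j + m) (of_real u + w)) \<le>
        (2 * u) ^ (p + 1) * exp (- u) * (fact p / fact j * expint_bound (j + m))" .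
  qed
  finally show ?thesis by (simp only: sum_distrib_left)
qed

lemma incgamma_moment_by_parts:
  assumes u: "u > 0"
  shows "incgamma_moment p m u 0 - of_real (exp (- (2 * u)) * incexp p 1 (2 * u)) * expint_closed m (of_real (- u)) =
    - of_real ((2 * u) ^ (p + 1) * (\<Sum>l\<le>m. fact m / (fact l * (- u) ^ (m - l + 1)) * (exp (- u) * incexp (l + p) u 1)))"
proof -
  have E: "expint_closed r (of_real v) = of_real (exp (- v) * incexp r v 1)" for r v
    by (simp add: expint_closed_def incexp_of_real exp_of_real [symmetric])
  have "incgamma_moment p m u 0 = of_real (\<Sum>j\<le>p. fact p / fact j * (2 * u) ^ j * (exp (- u) * incexp (j + m) u 1))"
    unfolding incgamma_moment_def of_real_sum of_real_mult [symmetric] add_0_right E ..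
  then have "incgamma_moment p m u 0 - of_real (exp (- (2 * u)) * incexp p 1 (2 * u)) * expint_closed m (of_real (- u)) =
     of_real ((\<Sum>j\<le>p. fact p / fact j * (2 * u) ^ j * (exp (- u) * incexp (j + m) u 1))
      - (exp (- (2 * u)) * incexp p 1 (2 * u)) * (exp u * incexp m (- u) 1))"
    unfolding E of_real_diff of_real_mult by simp
  then show ?thesis
    unfolding incgamma_moment_by_parts_real [OF u] by simp
qed

text \<open>Each term of the L-series extends continuously to \<open>w = 0\<close>. The \<open>a\<close>-part is dominated by the expansion of \<open>f\<close> at
  the point \<open>i\<close>, the \<open>b\<close>-part by the expansion of \<open>\<xi>\<^sub>k f\<close> at that point, which is the hypothesis \<open>summ\<close>.\<close>

lemma L_phi_limit:
  assumes exp: "maass_expansion k f n0 a b"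
    and data: "n0 = coeff_start k f" "a = coeff_a k f" "b = coeff_b k f"
    and zero: "k \<ge> 1 \<Longrightarrow> \<forall>n<0. b n = 0"
    and summ: "k \<le> 0 \<Longrightarrow> (\<lambda>n. norm (b n) * (- 4 * pi * of_int n) ^ (nat (- k) + 1) * exp (2 * pi * of_int n)) summable_on {n. n < 0}"
  shows "((\<lambda>x::real. L_phi k f (1 + of_nat m) (\<i> * of_real x)) \<longlongrightarrow>
      (\<Sum>\<^sub>\<infinity>n\<in>{n. n \<ge> - int n0 \<and> n \<noteq> 0}. a n * expint_closed m (of_real (2 * pi * of_int n))) +
      (\<Sum>\<^sub>\<infinity>n\<in>{n. n < 0}. b n * incgamma_moment (nat (- k)) m (- 2 * pi * of_int n) 0)) (at_right 0)"
    and "(\<lambda>n. a n * expint_closed m (of_real (2 * pi * of_int n))) summable_on {n. n \<ge> - int n0 \<and> n \<noteq> 0}"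
proof -
  define A where "A = {n. n \<ge> - int n0 \<and> n \<noteq> 0}"
  define p where "p = nat (- k)"
  define M where "M n = norm (a n) * exp (- 2 * pi * of_int n) * expint_bound m" for n
  have "\<i> \<in> \<H>" by (simp add: upper_half_plane_def)
  then have "(\<lambda>n. a n * exp (2 * of_real pi * \<i> * of_int n * \<i>)) summable_on A"
    using exp unfolding maass_expansion_def A_def summable_on_def by blast
  then have "(\<lambda>n. norm (a n * exp (2 * of_real pi * \<i> * of_int n * \<i>))) summable_on A"
    by (simp only: summable_on_iff_abs_summable_on_complex)
  then have M: "M summable_on A"
    unfolding M_def by (intro summable_on_cmult_left) (simp add: norm_mult)
  have ge1: "1 \<le> norm (of_real (2 * pi * of_int n) + \<i> * of_real x)" if "n \<noteq> 0" for n x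
  proof -
    have "1 * 1 \<le> (2 * pi) * real_of_int \<bar>n\<bar>"
      using that pi_ge_two by (intro mult_mono) auto
    also have "\<dots> = \<bar>Re (of_real (2 * pi * of_int n) + \<i> * of_real x)\<bar>" by (simp add: abs_mult)
    also have "\<dots> \<le> norm (of_real (2 * pi * of_int n) + \<i> * of_real x)" by (rule abs_Re_le_cmod)
    finally show ?thesis by simp
  qed
  have bound: "norm (a n * expint_closed m (of_real (2 * pi * of_int n) + \<i> * of_real x)) \<le> M n" if "n \<in> A" for n x
  proof -
    have "norm (expint_closed m (of_real (2 * pi * of_int n) + \<i> * of_real x)) \<le> exp (- 2 * pi * of_int n) * expint_bound m"
      using norm_expint_closed_le [OF ge1 [of n x], of m] that by (simp add: A_def)
    then show ?thesis
      unfolding M_def norm_mult mult.assoc by (intro mult_left_mono) auto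
  qed
  show "(\<lambda>n. a n * expint_closed m (of_real (2 * pi * of_int n))) summable_on {n. n \<ge> - int n0 \<and> n \<noteq> 0}"
    unfolding A_def [symmetric]
    by (rule Infinite_Sum.abs_summable_summable, rule Infinite_Sum.abs_summable_on_comparison_test' [OF M])
       (use bound [of _ 0] in simp)
  have limA: "((\<lambda>x. \<Sum>\<^sub>\<infinity>n\<in>A. a n * expint_closed m (of_real (2 * pi * of_int n) + \<i> * of_real x)) \<longlongrightarrow>
      (\<Sum>\<^sub>\<infinity>n\<in>A. a n * expint_closed m (of_real (2 * pi * of_int n)))) (at_right 0)"
    by (rule tendsto_infsum_dominated [where S = UNIV, OF _ _ bound M])
       (auto simp: A_def intro!: tendsto_intros tendsto_expint_closed)
  have limB: "((\<lambda>x. \<Sum>\<^sub>\<infinity>n\<in>{n. n < 0}. b n * incgamma_moment p m (- 2 * pi * of_int n) (\<i> * of_real x)) \<longlongrightarrow>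
      (\<Sum>\<^sub>\<infinity>n\<in>{n. n < 0}. b n * incgamma_moment p m (- 2 * pi * of_int n) 0)) (at_right 0)"
  proof (cases "k \<le> 0")
    case True
    define D where "D = (\<Sum>j\<le>p. fact p / fact j * expint_bound (j + m))"
    show ?thesis
    proof (rule tendsto_infsum_dominated [where S = UNIV])
      show "((\<lambda>x. b n * incgamma_moment p m (- 2 * pi * of_int n) (\<i> * of_real x)) \<longlongrightarrow>
          b n * incgamma_moment p m (- 2 * pi * of_int n) 0) (at_right 0)" if "n \<in> {n. n < 0}" for n
        unfolding incgamma_moment_def add_0_right using that
        by (intro tendsto_intros tendsto_expint_closed) auto
      show "(\<lambda>n. norm (b n) * (- 4 * pi * of_int n) ^ (p + 1) * exp (2 * pi * of_int n) * D) summable_on {n. n < 0}"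
        using summ [OF True] unfolding p_def by (rule summable_on_cmult_left)
      fix n :: int and x :: real assume "n \<in> {n. n < 0}"
      then have n: "n < 0" by simp
      have "1 * 1 \<le> (2 * pi) * of_int (- n)"
        using n pi_ge_two by (intro mult_mono) auto
      then have "1 \<le> - 2 * pi * of_int n" by simp
      moreover have "Re (\<i> * of_real x) \<ge> 0" by simp
      ultimately have "norm (incgamma_moment p m (- 2 * pi * of_int n) (\<i> * of_real x)) \<le>
          (2 * (- 2 * pi * of_int n)) ^ (p + 1) * exp (- (- 2 * pi * of_int n)) * D"
        unfolding D_def by (rule norm_incgamma_moment_le)
      moreover have "2 * (- 2 * pi * of_int n) = - 4 * pi * of_int n" "- (- 2 * pi * of_int n) = 2 * pi * of_int n"
        by simp_all
      ultimately have "norm (incgamma_moment p m (- 2 * pi * of_int n) (\<i> * of_real x)) \<le> (- 4 * pi * of_int n) ^ (p + 1) * exp (2 * pi * of_int n) * D"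
        by (simp only:)
      then show "norm (b n * incgamma_moment p m (- 2 * pi * of_int n) (\<i> * of_real x)) \<le>
          norm (b n) * (- 4 * pi * of_int n) ^ (p + 1) * exp (2 * pi * of_int n) * D"
        unfolding norm_mult mult.assoc by (intro mult_left_mono) auto
    qed auto
  next
    case False
    then have "\<forall>n<0. b n = 0" using zero by simp
    then have "(\<Sum>\<^sub>\<infinity>n\<in>{n. n < 0}. b n * incgamma_moment p m (- 2 * pi * of_int n) w) = 0" for w
      by (intro infsum_0) auto
    then show ?thesis by simp
  qed
  have eq: "L_phi k f (1 + of_nat m) (\<i> * of_real x) =
      (\<Sum>\<^sub>\<infinity>n\<in>A. a n * expint_closed m (of_real (2 * pi * of_int n) + \<i> * of_real x)) +
      (\<Sum>\<^sub>\<infinity>n\<in>{n. n < 0}. b n * incgamma_moment p m (- 2 * pi * of_int n) (\<i> * of_real x))" if x: "x > 0" for x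
  proof -
    have s: "1 - (1 + of_nat m) = (- of_nat m :: complex)" "(1 + of_nat m) - 1 = (of_nat m :: complex)" by simp_all
    have "gen_expint (- of_nat m) (2 * of_real pi * of_int n + \<i> * of_real x) = expint_closed m (of_real (2 * pi * of_int n) + \<i> * of_real x)" for n
      using gen_expint_eq [of "2 * of_real pi * of_int n + \<i> * of_real x" m] x by (simp add: complex_nonpos_Reals_iff)
    moreover have "b n * integral {1..} (\<lambda>t. of_real (upper_Gamma (1 - of_int k) (- 4 * pi * of_int n * t)) *
          exp (- (2 * of_real pi * of_int n + \<i> * of_real x) * of_real t) * of_real t powr of_nat m) =
        b n * incgamma_moment p m (- 2 * pi * of_int n) (\<i> * of_real x)" if n: "n \<in> {n. n < 0}" for n
    proof (cases "k \<le> 0")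
      case True
      have "- 2 * pi * of_int n > 0" using n by (simp add: mult_pos_neg)
      from incgamma_moment_integral [OF True this, of "\<i> * of_real x" m]
      have "integral {1..} (\<lambda>t. of_real (upper_Gamma (1 - of_int k) (2 * (- 2 * pi * of_int n) * t)) *
          exp (- (- of_real (- 2 * pi * of_int n) + \<i> * of_real x) * of_real t) * of_real t powr of_nat m) =
          incgamma_moment p m (- 2 * pi * of_int n) (\<i> * of_real x)"
        by (simp add: p_def)
      moreover have "2 * (- 2 * pi * of_int n) = - 4 * pi * of_int n" "- of_real (- 2 * pi * of_int n) = (2 * of_real pi * of_int n :: complex)"
        by simp_all
      ultimately show ?thesis by (simp only:)
    next
      case False
      then have "b n = 0" using zero n by simp
      then show ?thesis by simp
    qed
    ultimately show ?thesis
      unfolding L_phi_def s data [symmetric] A_def by (intro arg_cong2 [where f = "(+)"] infsum_cong) auto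
  qed
  have "((\<lambda>x. (\<Sum>\<^sub>\<infinity>n\<in>A. a n * expint_closed m (of_real (2 * pi * of_int n) + \<i> * of_real x)) +
      (\<Sum>\<^sub>\<infinity>n\<in>{n. n < 0}. b n * incgamma_moment p m (- 2 * pi * of_int n) (\<i> * of_real x))) \<longlongrightarrow>
      (\<Sum>\<^sub>\<infinity>n\<in>A. a n * expint_closed m (of_real (2 * pi * of_int n))) +
      (\<Sum>\<^sub>\<infinity>n\<in>{n. n < 0}. b n * incgamma_moment p m (- 2 * pi * of_int n) 0)) (at_right 0)"
    by (intro tendsto_add limA limB)
  moreover have "\<forall>\<^sub>F x in at_right 0. (\<Sum>\<^sub>\<infinity>n\<in>A. a n * expint_closed m (of_real (2 * pi * of_int n) + \<i> * of_real x)) +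
      (\<Sum>\<^sub>\<infinity>n\<in>{n. n < 0}. b n * incgamma_moment p m (- 2 * pi * of_int n) (\<i> * of_real x)) = L_phi k f (1 + of_nat m) (\<i> * of_real x)"
    using eventually_at_right_less [of 0] by eventually_elim (simp add: eq)
  ultimately show "((\<lambda>x::real. L_phi k f (1 + of_nat m) (\<i> * of_real x)) \<longlongrightarrow>
      (\<Sum>\<^sub>\<infinity>n\<in>{n. n \<ge> - int n0 \<and> n \<noteq> 0}. a n * expint_closed m (of_real (2 * pi * of_int n))) +
      (\<Sum>\<^sub>\<infinity>n\<in>{n. n < 0}. b n * incgamma_moment (nat (- k)) m (- 2 * pi * of_int n) 0)) (at_right 0)"
    unfolding A_def [symmetric] p_def [symmetric] by (rule Lim_transform_eventually)
qed

section \<open>The summation formula\<close>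

lemma contour_integral_horizontal:
  "contour_integral (linepath \<i> (\<i> + 1)) h = integral {0..1} (\<lambda>t. h (Complex t 1))"
proof -
  have "linepath \<i> (\<i> + 1) t = Complex t 1" for t
    by (simp add: linepath_def complex_eq_iff)
  then show ?thesis by (simp add: contour_integral_integral)
qed

lemma continuous_on_xi_kernel:
  assumes "k \<le> 0"
  shows "continuous_on S (\<lambda>t. xi_kernel k m (Complex t 1))"
proof -
  have "of_int (2 + int m - k) \<noteq> (0 :: complex)" using assms by (simp only: of_int_eq_0_iff)
  then show ?thesis
    unfolding xi_kernel_def complex.sel Complex_eq by (intro continuous_intros) simp
qed

text \<open>With \<open>R1\<close> and \<open>R2\<close> the two terms on the right and \<open>LA + LB\<close> the limit of the L-series, \<open>R1 - LA\<close> is the series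
  of the nonholomorphic coefficients against \<open>E\<^sub>-\<^sub>m\<close>, and the claim becomes \<open>LB = R2 + (R1 - LA)\<close>, an
  identity between series that holds for each index \<open>n\<close>.\<close>

theorem theorem5p4:
  fixes k :: int and N :: nat and f :: "complex \<Rightarrow> complex" and m :: nat
  assumes "N \<ge> 1" and "f \<in> HC k N" and "m \<ge> 1"
  shows "((\<lambda>x::real. L_phi k f (1 + of_nat m) (\<i> * of_real x)) \<longlongrightarrow>
           - (\<i> powi (- int m - 1)) *
               contour_integral (linepath \<i> (\<i> + 1)) (\<lambda>z. f z * (bernpoly (m + 1) z / of_nat (m + 1)))
           + (if k \<le> 0
              then contour_integral (linepath \<i> (\<i> + 1)) (\<lambda>z. xi_op k (f_conj f) z * xi_kernel k m z)
              else 0)) (at_right 0)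
         \<and> (k \<ge> 1 \<longrightarrow> (\<forall>z\<in>upper_half_plane. xi_op k (f_conj f) z = 0))"
proof
  note N = assms(1) and f = assms(2)
  note fp = HC_basic(1) [OF f]
  define n0 a b where "n0 = coeff_start k f" and "a = coeff_a k f" and "b = coeff_b k f"
  have exp: "maass_expansion k f n0 a b"
    unfolding n0_def a_def b_def by (rule HC_maass_expansion [OF f N])
  obtain g where g: "cusp_expansion (xi_op k f) g"
    using HC_cusp_expansion_infinity [OF f] by blast
  define p where "p = nat (- k)"
  \<comment> \<open>the terms of the two halves of the L-series at \<open>w = 0\<close>\<close>
  define E where "E n = expint_closed m (of_real (2 * pi * of_int n))" for n
  define T where "T n = incgamma_moment p m (- 2 * pi * of_int n) 0" for n
  have upper: "xi_op k (f_conj f) z = cnj (xi_op k f (- cnj z))" if "z \<in> \<H>" for z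
    by (rule xi_op_f_conj [OF fp that])
  have neg_cnj: "- cnj z \<in> \<H>" if "z \<in> \<H>" for z
    using that by (simp add: upper_half_plane_def)
  show vanish: "k \<ge> 1 \<longrightarrow> (\<forall>z\<in>\<H>. xi_op k (f_conj f) z = 0)"
    using upper neg_cnj HC_xi_zero_positive_weight [OF f N] by simp
  have b0: "\<forall>n<0. b n = 0" if k: "k \<ge> 1"
  proof (intro allI impI)
    fix n :: int assume n: "n < 0"
    have "fourier_at (xi_op k f) (- n) 1 = 0"
      using HC_xi_zero_positive_weight [OF f N k] by (simp add: fourier_at_def fcoeff_def)
    then have "g (- n) = 0" using cusp_expansionD(2) [OF g, of 1 "- n"] by simp
    then show "b n = 0"
      by (intro maass_expansion_b(2) [OF fp _ g exp n k]) (use HC_periodic [OF f] in auto)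
  qed
  have bg: "cnj (g (- n)) = - of_real ((- 4 * pi * of_int n) ^ (p + 1)) * b n" if "k \<le> 0" "n < 0" for n
    unfolding p_def using that by (intro maass_expansion_b(1) [OF fp _ g exp]) (use HC_periodic [OF f] in auto)
  have summ: "(\<lambda>n. norm (b n) * (- 4 * pi * of_int n) ^ (p + 1) * exp (2 * pi * of_int n)) summable_on {n. n < 0}" if k: "k \<le> 0"
  proof -
    have "(\<lambda>n. norm (g n) * exp (- 2 * pi * of_int n * 1)) summable_on UNIV"
      by (rule cusp_expansionD(3) [OF g]) simp
    then have "(\<lambda>n. norm (g (- n)) * exp (- 2 * pi * of_int (- n) * 1)) summable_on UNIV"
      using summable_on_reindex_bij_betw [of uminus UNIV UNIV "\<lambda>n. norm (g n) * exp (- 2 * pi * of_int n * 1)"]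
      by (simp add: bij_uminus)
    then have "(\<lambda>n. norm (g (- n)) * exp (- 2 * pi * of_int (- n) * 1)) summable_on {n. n < 0}"
      by (rule summable_on_subset_banach) simp
    moreover have "norm (g (- n)) * exp (- 2 * pi * of_int (- n) * 1) =
        norm (b n) * (- 4 * pi * of_int n) ^ (p + 1) * exp (2 * pi * of_int n)" if n: "n \<in> {n. n < 0}" for n
    proof -
      have "- 4 * pi * of_int n > 0" using n by (simp add: mult_pos_neg)
      then have "0 < (- 4 * pi * of_int n) ^ (p + 1)" by (rule zero_less_power)
      moreover have "norm (g (- n)) = norm (- of_real ((- 4 * pi * of_int n) ^ (p + 1)) * b n)"
        using bg [OF k, of n] n by (metis complex_mod_cnj mem_Collect_eq)
      ultimately have "norm (g (- n)) = (- 4 * pi * of_int n) ^ (p + 1) * norm (b n)"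
        by (simp only: norm_mult norm_minus_cancel norm_of_real abs_of_pos)
      then show ?thesis by simp
    qed
    ultimately show ?thesis
      by (rule summable_on_cong [THEN iffD1, rotated])
  qed
  define LA where "LA = (\<Sum>\<^sub>\<infinity>n\<in>{n. n \<ge> - int n0 \<and> n \<noteq> 0}. a n * E n)"
  define LB where "LB = (\<Sum>\<^sub>\<infinity>n\<in>{n. n < 0}. b n * T n)"
  note lim = L_phi_limit [OF exp n0_def a_def b_def b0 summ [unfolded p_def], of m]
  have limit: "((\<lambda>x::real. L_phi k f (1 + of_nat m) (\<i> * of_real x)) \<longlongrightarrow> LA + LB) (at_right 0)"
    using lim(1) unfolding LA_def LB_def E_def T_def p_def .
  have SA: "((\<lambda>n. hol_coeff n0 a n * E n) has_sum LA) UNIV"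
  proof -
    have "((\<lambda>n. a n * E n) has_sum LA) {n. n \<ge> - int n0 \<and> n \<noteq> 0}"
      unfolding LA_def using lim(2) unfolding E_def by (rule has_sum_infsum)
    then show ?thesis
      by (rule has_sum_cong_neutral [THEN iffD1, rotated 3]) (auto simp: hol_coeff_def)
  qed
  define R1 where "R1 = - (\<i> powi (- int m - 1)) *
      contour_integral (linepath \<i> (\<i> + 1)) (\<lambda>z. f z * (bernpoly (m + 1) z / of_nat (m + 1)))"
  have S1: "((\<lambda>n. (hol_coeff n0 a n + nonhol_coeff k b n 1) * E n) has_sum R1) UNIV"
  proof -
    define c where "c n = (hol_coeff n0 a n + nonhol_coeff k b n 1) * of_real (exp (- 2 * pi * of_int n))" for n
    define J where "J n = integral {0..1} (\<lambda>t. ee n (of_real t) * (bernpoly (m + 1) (of_real t + \<i>) / of_nat (m + 1)))" for n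
    have nz: "of_nat (m + 1) \<noteq> (0 :: complex)" by (simp only: of_nat_eq_0_iff)
    have "((\<lambda>n. c n * ee n (of_real t)) has_sum f (Complex t 1)) UNIV" for t
      using maass_expansion_has_sum [OF exp, of 1 t] by (simp add: c_def ee_Complex mult_ac)
    then have "((\<lambda>n. c n * J n) has_sum integral {0..1} (\<lambda>t. f (Complex t 1) * (bernpoly (m + 1) (of_real t + \<i>) / of_nat (m + 1)))) UNIV"
      unfolding J_def by (rule has_sum_line_integral) (intro continuous_intros, use nz in blast)
    also have "integral {0..1} (\<lambda>t. f (Complex t 1) * (bernpoly (m + 1) (of_real t + \<i>) / of_nat (m + 1))) =
        contour_integral (linepath \<i> (\<i> + 1)) (\<lambda>z. f z * (bernpoly (m + 1) z / of_nat (m + 1)))"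
      unfolding contour_integral_horizontal by (simp add: Complex_eq)
    finally have "((\<lambda>n. - (\<i> powi (- int m - 1)) * (c n * J n)) has_sum R1) UNIV"
      unfolding R1_def by (rule has_sum_cmult_right)
    moreover have "- (\<i> powi (- int m - 1)) * (c n * J n) = (hol_coeff n0 a n + nonhol_coeff k b n 1) * E n" for n
    proof (cases "n = 0")
      case True
      then show ?thesis by (simp add: c_def hol_coeff_def nonhol_coeff_def)
    next
      case False
      have "- (\<i> powi (- int m - 1)) * (c n * J n) = (hol_coeff n0 a n + nonhol_coeff k b n 1) *
          (- (\<i> powi (- int m - 1)) * (of_real (exp (- 2 * pi * of_int n)) * J n))"
        unfolding c_def by (simp only: mult_ac)
      also have "- (\<i> powi (- int m - 1)) * (of_real (exp (- 2 * pi * of_int n)) * J n) = E n"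
        unfolding J_def E_def by (rule expint_kernel_integral [OF False])
      finally show ?thesis .
    qed
    ultimately show ?thesis by simp
  qed
  have SB: "((\<lambda>n. nonhol_coeff k b n 1 * E n) has_sum (R1 - LA)) UNIV"
  proof -
    have "((\<lambda>n. (hol_coeff n0 a n + nonhol_coeff k b n 1) * E n + - (hol_coeff n0 a n * E n)) has_sum (R1 + - LA)) UNIV"
      by (intro has_sum_add S1 has_sum_uminusI SA)
    then show ?thesis by (simp add: algebra_simps)
  qed
  show "((\<lambda>x::real. L_phi k f (1 + of_nat m) (\<i> * of_real x)) \<longlongrightarrow>
           - (\<i> powi (- int m - 1)) *
               contour_integral (linepath \<i> (\<i> + 1)) (\<lambda>z. f z * (bernpoly (m + 1) z / of_nat (m + 1)))
           + (if k \<le> 0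
              then contour_integral (linepath \<i> (\<i> + 1)) (\<lambda>z. xi_op k (f_conj f) z * xi_kernel k m z)
              else 0)) (at_right 0)"
  proof (cases "k \<le> 0")
    case False
    then have b0': "\<forall>n<0. b n = 0" using b0 by simp
    have "((\<lambda>n. 0) has_sum (R1 - LA)) (UNIV :: int set)"
      using SB b0' by (simp add: nonhol_coeff_def cong: if_cong)
    then have "R1 - LA = 0" using has_sum_unique has_sum_0_simp by blast
    moreover have "LB = 0" unfolding LB_def using b0' by (intro infsum_0) auto
    ultimately show ?thesis using limit False by (simp add: R1_def)
  next
    case True
    define K where "K t = xi_kernel k m (Complex t 1)" for t
    define c where "c n = cnj (g n) * of_real (exp (- 2 * pi * of_int n))" for n
    define R2 where "R2 = contour_integral (linepath \<i> (\<i> + 1)) (\<lambda>z. xi_op k (f_conj f) z * xi_kernel k m z)"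
    have "((\<lambda>n. c n * ee n (of_real t)) has_sum xi_op k (f_conj f) (Complex t 1)) UNIV" for t
    proof -
      have z: "Complex t 1 \<in> \<H>" by simp
      have "((\<lambda>n. cnj (g n * ee n (- cnj (Complex t 1)))) has_sum cnj (xi_op k f (- cnj (Complex t 1)))) UNIV"
        unfolding has_sum_cnj_iff by (rule cusp_expansionD(4) [OF g neg_cnj [OF z]])
      moreover have "cnj (g n * ee n (- cnj (Complex t 1))) = c n * ee n (of_real t)" for n
        by (simp add: cnj_ee ee_Complex c_def)
      ultimately show ?thesis by (simp add: upper [OF z])
    qed
    then have "((\<lambda>n. c n * integral {0..1} (\<lambda>t. ee n (of_real t) * K t)) has_sum
        integral {0..1} (\<lambda>t. xi_op k (f_conj f) (Complex t 1) * K t)) UNIV"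
      by (rule has_sum_line_integral) (unfold K_def, rule continuous_on_xi_kernel [OF True])
    then have "((\<lambda>n. c n * integral {0..1} (\<lambda>t. ee n (of_real t) * K t)) has_sum R2) UNIV"
      by (simp add: R2_def contour_integral_horizontal K_def)
    \<comment> \<open>the conjugation in \<open>\<xi>\<^sub>k\<close> pairs the index \<open>n > 0\<close> of \<open>\<xi>\<^sub>k f\<close> with the index \<open>- n\<close> of \<open>f\<close>\<close>
    then have S2: "((\<lambda>n. c (- n) * integral {0..1} (\<lambda>t. ee (- n) (of_real t) * K t)) has_sum R2) UNIV"
      by (subst has_sum_reindex_bij_witness [where i = uminus and j = uminus and T = UNIV and s' = R2
            and h = "\<lambda>n. c n * integral {0..1} (\<lambda>t. ee n (of_real t) * K t)"]) auto
    \<comment> \<open>what integration by parts leaves of the incomplete Gamma moment is the kernel integral\<close>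
    have coeff_eq: "c (- n) * integral {0..1} (\<lambda>t. ee (- n) (of_real t) * K t) =
        (if n < 0 then b n * T n else 0) - nonhol_coeff k b n 1 * E n" for n
    proof (cases "n < 0")
      case n: True
      define u where "u = 2 * pi * of_int (- n)"
      have u: "u > 0" using n by (simp add: u_def mult_pos_neg)
      have u2: "- 4 * pi * of_int n = 2 * u" and u1: "2 * pi * of_int n = - u" "- 2 * pi * of_int n = u" by (simp_all add: u_def)
      define S where "S = (\<Sum>l\<le>m. fact m / (fact l * (- u) ^ (m - l + 1)) * (exp (- u) * incexp (l + p) u 1))"
      have "c (- n) * integral {0..1} (\<lambda>t. ee (- n) (of_real t) * K t) =
          cnj (g (- n)) * of_real (exp (- u)) * (of_real (exp u) * of_real S)"
        using xi_kernel_integral [of "- n" k m] n True unfolding K_def c_def S_def p_def u_def by simp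
      also have "\<dots> = cnj (g (- n)) * of_real S * of_real (exp (- u) * exp u)"
        by (simp only: of_real_mult mult_ac)
      also have "exp (- u) * exp u = 1" by (simp add: exp_add [symmetric])
      also have "cnj (g (- n)) * of_real S * of_real 1 = b n * - of_real ((2 * u) ^ (p + 1) * S)"
        unfolding bg [OF True n] u2 by (simp del: power_Suc)
      also have "- of_real ((2 * u) ^ (p + 1) * S) =
          incgamma_moment p m u 0 - of_real (exp (- (2 * u)) * incexp p 1 (2 * u)) * expint_closed m (of_real (- u))"
        unfolding S_def by (rule incgamma_moment_by_parts [OF u, symmetric])
      also have "exp (- (2 * u)) * incexp p 1 (2 * u) = upper_Gamma (1 - of_int k) (2 * u)"
        unfolding p_def by (rule upper_Gamma_closed_form [OF True, symmetric]) (use u in simp)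
      finally have "c (- n) * integral {0..1} (\<lambda>t. ee (- n) (of_real t) * K t) =
          b n * (incgamma_moment p m u 0 - of_real (upper_Gamma (1 - of_int k) (2 * u)) * expint_closed m (of_real (- u)))" .
      moreover have "nonhol_coeff k b n 1 = b n * of_real (upper_Gamma (1 - of_int k) (2 * u))"
        using n by (simp only: nonhol_coeff_def mult_1_right if_True u2)
      moreover have "E n = expint_closed m (of_real (- u))" "T n = incgamma_moment p m u 0"
        by (simp_all only: E_def T_def u1)
      ultimately show ?thesis
        using n by (simp only: if_True right_diff_distrib mult.assoc)
    next
      case False
      then have "g (- n) = 0" by (intro cusp_expansionD(1) [OF g]) simp
      then show ?thesis using False by (simp add: c_def nonhol_coeff_def)
    qed
    have "((\<lambda>n. if n < 0 then b n * T n else 0) has_sum (R2 + (R1 - LA))) UNIV"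
      using has_sum_add [OF S2 SB] unfolding coeff_eq by simp
    then have "((\<lambda>n. b n * T n) has_sum (R2 + (R1 - LA))) {n. n < 0}"
      by (rule has_sum_cong_neutral [THEN iffD1, rotated 3]) auto
    then have "LB = R2 + (R1 - LA)" unfolding LB_def by (rule infsumI)
    then have "LA + LB = R1 + R2" by simp
    then show ?thesis using limit True by (simp add: R1_def R2_def)
  qed
qed

end
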